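(* There is $\beta_0<\infty$ such that for all $\beta\ge\beta_0$ the following holds. Let $\mu\in\mathcal{M}$ and let $U$ be the telescoping potential of $\nu_\beta^+$. Then $$e^U_\mu=\lim_{V\uparrow\mathbb{Z}}\frac1{|V|}\,\mu(H^f_V).$$
   Context: Ising model on $\mathbb{Z}^2$ at zero field: for finite $\Lambda\subset\mathbb{Z}^2$, $\mu^+_{\Lambda,\beta}$ is the probability measure on $\{\pm1\}^\Lambda$ with weights proportional to $\exp[\beta\sum_{\langle xy\rangle:\{x,y\}\cap\Lambda\ne\emptyset}(\sigma_x\sigma_y-1)]$ (nearest neighbour pairs, $\sigma_y=+1$ for $y\notin\Lambda$); $\mu_\beta^+=\lim_\Lambda\mu^+_{\Lambda,\beta}$ is the plus phase with random field $X$. $\Omega=\{\pm1\}^{\mathbb{Z}}$, $\Omega_V=\{\pm1\}^V$; $\nu_\beta^+$ is the law on $\Omega$ of $(X((i,0)))_{i\in\mathbb{Z}}$. $\sigma^V$ equals $\sigma$ on $V$ and $+1$ off $V$; $+$ is the all-plus configuration. $V\uparrow\mathbb{Z}$ denotes the thermodynamic limit over finite volumes $V\subset\mathbb{Z}$. Specification $\Gamma$ (the monotone right-continuous specification with which $\nu_\beta^+$ is consistent): with $\Lambda_n=([-n,n]\cap\mathbb{Z})^2$, for finite $V\subset\mathbb{Z}$, $\sigma\in\Omega_V$, $\omega\in\Omega$, $$\gamma_V(\sigma|\omega)=\lim_{n\to\infty}\mu^+_{\Lambda_n,\beta}\big(X(i,0)=\sigma_i,\ i\in V\,\big|\,X(i,0)=\omega_i,\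 i\in[-n,n]\setminus V\big).$$ Telescoping potential $U$: for $i\in\mathbb{Z}$, $U(\{i\},\xi)=\ln\frac{\gamma_{\{i\}}(+|+)}{\gamma_{\{i\}}(\xi^{\{i\}}|+)}$; for $j<i$, with $\gamma=\gamma_{[j,i]}$, $$U([j,i],\xi)=\ln\frac{\gamma(\xi^{]j,i]}|+)\,\gamma(\xi^{[j,i[}|+)}{\gamma(\xi^{]j,i[}|+)\,\gamma(\xi^{[j,i]}|+)},$$ where $[j,i]=\{j,\dots,i\}$, $]j,i]=\{j+1,\dots,i\}$, $[j,i[=\{j,\dots,i-1\}$, $]j,i[=\{j+1,\dots,i-1\}$; $U(A,\cdot)=0$ for all other finite $A$. For $1\le\alpha<9/8$ and $i\in\mathbb{Z}$ ($\mathbb{N}=\{1,2,\dots\}$): $l_i^{\alpha,+}(\sigma)=\min\{n\in\mathbb{N}:\forall k\ge n,\ \frac1k\sum_{j=0}^{k-1}\sigma_{i+j}\ge\frac89\alpha\}$ and $l_i^{\alpha,-}(\sigma)=\min\{n\in\mathbb{N}:\forall k\ge n,\ \frac1k\sum_{j=0}^{k-1}\sigma_{i-j}\ge\frac89\alpha\}$ ($=\infty$ if there is no such $n$). $\mathcal{M}_\alpha$ is the set of translation invariant probability measures $\mu$ on $\Omega$ for which there is $c>0$ with $\mu[l_0^{\alpha,\pm}>n]\le e^{-cn}$ for all $n\in\mathbb{N}$ (both signs); $\mathcal{M}=\bigcup_{\alpha>1}\mathcal{M}_\alpha$. $f_U(\sigma)=\sum_{A\ni0}\frac1{|A|}U(A,\sigma)$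 and $e^U_\mu=\int f_U\,d\mu$ (well defined for $\mu\in\mathcal{M}$). The free boundary condition energy is $H^f_V(\sigma)=\sum_{A\subset V}U(A,\sigma)$. *)

theory Defs
  imports "HOL-Probability.Probability"
begin

text \<open>Spins are the reals \<open>-1\<close> and \<open>1\<close>; the all-plus configuration is \<open>\<lambda>_. 1\<close>.\<close>

definition plus_off :: "'a set \<Rightarrow> ('a \<Rightarrow> real) \<Rightarrow> 'a \<Rightarrow> real" where
  "plus_off V \<sigma> x = (if x \<in> V then \<sigma> x else 1)"


subsection \<open>The Ising model with plus boundary condition\<close>

type_synonym site = "int \<times> int"

definition nn :: "site \<Rightarrow> site \<Rightarrow> bool" where
  "nn x y \<longleftrightarrow> \<bar>fst x - fst y\<bar> + \<bar>snd x - snd y\<bar> = 1"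

definition bonds :: "site set \<Rightarrow> site set set" where
  "bonds \<Lambda> = {{x, y} | x y. nn x y \<and> {x, y} \<inter> \<Lambda> \<noteq> {}}"

text \<open>A bond is an unordered pair, so the product over its two sites is
  \<open>\<sigma>\<^sub>x \<sigma>\<^sub>y\<close>.\<close>

definition ising_weight :: "real \<Rightarrow> site set \<Rightarrow> (site \<Rightarrow> real) \<Rightarrow> real" where
  "ising_weight \<beta> \<Lambda> \<sigma> =
     exp (\<beta> * (\<Sum>b\<in>bonds \<Lambda>. (\<Prod>x\<in>b. plus_off \<Lambda> \<sigma> x) - 1))"

definition ising_plus :: "real \<Rightarrow> site set \<Rightarrow> (site \<Rightarrow> real) measure" where
  "ising_plus \<beta> \<Lambda> =
     point_measure (\<Lambda> \<rightarrow>\<^sub>E {-1, 1})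
       (\<lambda>\<sigma>. ennreal (ising_weight \<beta> \<Lambda> \<sigma> / (\<Sum>\<tau>\<in>\<Lambda> \<rightarrow>\<^sub>E {-1, 1}. ising_weight \<beta> \<Lambda> \<tau>)))"

definition box :: "nat \<Rightarrow> site set" where
  "box n = {- int n..int n} \<times> {- int n..int n}"


subsection \<open>The specification of the restriction to the layer\<close>

text \<open>\<open>layer_spec \<beta> V \<sigma> \<omega>\<close> is \<open>\<gamma>\<^sub>V(\<sigma>|\<omega>)\<close>. It depends on \<open>\<sigma>\<close> only through its
  values on \<open>V\<close>, so full configurations stand for elements of \<open>\<Omega>\<^sub>V\<close>. If \<open>V\<close> is not contained
  in \<open>[-n,n]\<close> the finite-volume term is meaningless; this concerns only finitely many \<open>n\<close>.\<close>

definition layer_spec ::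
    "real \<Rightarrow> int set \<Rightarrow> (int \<Rightarrow> real) \<Rightarrow> (int \<Rightarrow> real) \<Rightarrow> real" where
  "layer_spec \<beta> V \<sigma> \<omega> =
     lim (\<lambda>n. \<P>(X in ising_plus \<beta> (box n).
                 (\<forall>i\<in>V. X (i, 0) = \<sigma> i)
               \<bar> (\<forall>i\<in>{- int n..int n} - V. X (i, 0) = \<omega> i)))"


subsection \<open>The telescoping potential\<close>

definition telescoping :: "real \<Rightarrow> int set \<Rightarrow> (int \<Rightarrow> real) \<Rightarrow> real" where
  "telescoping \<beta> A \<xi> =
     (let j = Min A; i = Max A; \<gamma> = (\<lambda>\<sigma>. layer_spec \<beta> A \<sigma> (\<lambda>_. 1)) in
      if A = {} \<or> A \<noteq> {j..i} then 0
      else if j = i then ln (\<gamma> (\<lambda>_. 1) / \<gamma> (plus_off {i} \<xi>))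
      else ln (\<gamma> (plus_off {j<..i} \<xi>) * \<gamma> (plus_off {j..<i} \<xi>) /
              (\<gamma> (plus_off {j<..<i} \<xi>) * \<gamma> (plus_off {j..i} \<xi>))))"

lemma telescoping_singleton:
  "telescoping \<beta> {i} \<xi> =
     ln (layer_spec \<beta> {i} (\<lambda>_. 1) (\<lambda>_. 1) / layer_spec \<beta> {i} (plus_off {i} \<xi>) (\<lambda>_. 1))"
  by (simp add: telescoping_def)

lemma telescoping_interval:
  assumes "j < i"
  shows "telescoping \<beta> {j..i} \<xi> =
     (let \<gamma> = (\<lambda>\<sigma>. layer_spec \<beta> {j..i} \<sigma> (\<lambda>_. 1)) in
      ln (\<gamma> (plus_off {j<..i} \<xi>) * \<gamma> (plus_off {j..<i} \<xi>) /
         (\<gamma> (plus_off {j<..<i} \<xi>) * \<gamma> (plus_off {j..i} \<xi>))))"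
proof -
  have "Min {j..i} = j" "Max {j..i} = i"
    using assms by (auto intro!: Min_eqI Max_eqI)
  then show ?thesis
    using assms by (simp add: telescoping_def Let_def)
qed

lemma telescoping_other:
  assumes "\<And>j i. j \<le> i \<Longrightarrow> A \<noteq> {j..i}"
  shows "telescoping \<beta> A \<xi> = 0"
proof (cases "A = {} \<or> A \<noteq> {Min A..Max A}")
  case True
  then show ?thesis by (simp add: telescoping_def Let_def)
next
  case False
  then have "Min A \<le> Max A" by (metis atLeastatMost_empty_iff2)
  with assms False show ?thesis by blast
qed


subsection \<open>The class of measures\<close>

definition Omega :: "(int \<Rightarrow> real) measure" where
  "Omega = PiM UNIV (\<lambda>_. count_space {-1, 1})"

text \<open>The infimum of the empty set of extended naturals is \<open>\<infinity>\<close>.\<close>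

definition l_plus :: "real \<Rightarrow> int \<Rightarrow> (int \<Rightarrow> real) \<Rightarrow> enat" where
  "l_plus \<alpha> i \<sigma> =
     Inf {enat n | n. n \<ge> 1 \<and> (\<forall>k\<ge>n. (1 / real k) * (\<Sum>j<k. \<sigma> (i + int j)) \<ge> 8 / 9 * \<alpha>)}"

definition l_minus :: "real \<Rightarrow> int \<Rightarrow> (int \<Rightarrow> real) \<Rightarrow> enat" where
  "l_minus \<alpha> i \<sigma> =
     Inf {enat n | n. n \<ge> 1 \<and> (\<forall>k\<ge>n. (1 / real k) * (\<Sum>j<k. \<sigma> (i - int j)) \<ge> 8 / 9 * \<alpha>)}"

definition M_alpha :: "real \<Rightarrow> (int \<Rightarrow> real) measure set" where
  "M_alpha \<alpha> = {\<mu>. prob_space \<mu> \<and> sets \<mu> = sets Omega \<and>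
     (\<forall>a::int. distr \<mu> Omega (\<lambda>\<sigma> i. \<sigma> (i + a)) = \<mu>) \<and>
     (\<exists>c>0. \<forall>n\<ge>1.
        \<P>(\<sigma> in \<mu>. l_plus \<alpha> 0 \<sigma> > enat n) \<le> exp (- c * real n) \<and>
        \<P>(\<sigma> in \<mu>. l_minus \<alpha> 0 \<sigma> > enat n) \<le> exp (- c * real n))}"

definition M_class :: "(int \<Rightarrow> real) measure set" where
  "M_class = (\<Union>\<alpha>\<in>{1<..<9/8}. M_alpha \<alpha>)"


subsection \<open>Energies and the thermodynamic limit\<close>

text \<open>The sum in \<open>f_pot\<close> is an unconditional one, with value \<open>0\<close> where it diverges.\<close>

definition f_pot :: "(int set \<Rightarrow> (int \<Rightarrow> real) \<Rightarrow> real) \<Rightarrow> (int \<Rightarrow> real) \<Rightarrow> real" where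
  "f_pot U \<sigma> = (\<Sum>\<^sub>\<infinity>A\<in>{A. finite A \<and> 0 \<in> A}. 1 / real (card A) * U A \<sigma>)"

definition energy :: "(int set \<Rightarrow> (int \<Rightarrow> real) \<Rightarrow> real) \<Rightarrow> (int \<Rightarrow> real) measure \<Rightarrow> real" where
  "energy U \<mu> = (\<integral>\<sigma>. f_pot U \<sigma> \<partial>\<mu>)"

definition H_free :: "(int set \<Rightarrow> (int \<Rightarrow> real) \<Rightarrow> real) \<Rightarrow> int set \<Rightarrow> (int \<Rightarrow> real) \<Rightarrow> real" where
  "H_free U V \<sigma> = (\<Sum>A\<in>Pow V. U A \<sigma>)"

definition boundary :: "int set \<Rightarrow> int set" where
  "boundary V = {x \<in> V. x - 1 \<notin> V \<or> x + 1 \<notin> V}"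

text \<open>The limit \<open>V \<up> \<int>\<close> is taken in the sense of van Hove: \<open>V\<close> is a finite set that eventually
  contains every fixed finite set and whose boundary is negligible with respect to its cardinality.
  Without the latter condition, volumes consisting mostly of isolated points would be
  allowed, and energies per site would not have limits.\<close>

definition thermodynamic :: "int set filter" where
  "thermodynamic = (INF (F, e)\<in>{F. finite F} \<times> {0<..}.
     principal {V. finite V \<and> F \<subseteq> V \<and> real (card (boundary V)) \<le> e * real (card V)})"

lemma eventually_thermodynamic:
  "eventually P thermodynamic \<longleftrightarrow>
     (\<exists>F e. finite F \<and> e > 0 \<and>
        (\<forall>V. finite V \<and> F \<subseteq> V \<and> real (card (boundary V)) \<le> e * real (card V) \<longrightarrow> P V))"
proof -
  let ?S = "\<lambda>(F, e). {V. finite V \<and> F \<subseteq> V \<and> real (card (boundary V)) \<le> e * real (card V)}"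
  let ?I = "{F :: int set. finite F} \<times> {0::real<..}"
  have eq: "thermodynamic = (INF p\<in>?I. principal (?S p))"
    unfolding thermodynamic_def by (simp add: case_prod_unfold)
  have "eventually P thermodynamic \<longleftrightarrow> (\<exists>p\<in>?I. eventually P (principal (?S p)))"
    unfolding eq
  proof (rule eventually_INF_base)
    show "?I \<noteq> {}" by (auto intro: gt_ex)
    fix a b assume a: "a \<in> ?I" and b: "b \<in> ?I"
    obtain F e G d where [simp]: "a = (F, e)" "b = (G, d)" by (cases a, cases b)
    have "?S (F \<union> G, min e d) \<subseteq> ?S a \<inter> ?S b"
      by (auto intro: order_trans[OF _ mult_right_mono])
    with a b show "\<exists>x\<in>?I. principal (?S x) \<le> inf (principal (?S a)) (principal (?S b))"
      by (intro bexI[of _ "(F \<union> G, min e d)"]) auto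
  qed
  then show ?thesis by (auto simp: eventually_principal)
qed

lemma filterlim_intervals_thermodynamic:
  "filterlim (\<lambda>n. {- int n..int n}) thermodynamic sequentially"
  unfolding filterlim_iff eventually_thermodynamic
proof safe
  fix P and F :: "int set" and e :: real
  assume F: "finite F" and e: "e > 0"
    and P: "\<forall>V. finite V \<and> F \<subseteq> V \<and> real (card (boundary V)) \<le> e * real (card V) \<longrightarrow> P V"
  obtain N :: nat where N: "\<And>x. x \<in> F \<Longrightarrow> \<bar>x\<bar> \<le> int N"
  proof
    fix x assume "x \<in> F"
    then have "nat \<bar>x\<bar> \<le> (\<Sum>y\<in>F. nat \<bar>y\<bar>)" using F by (intro member_le_sum) auto
    then show "\<bar>x\<bar> \<le> int (\<Sum>y\<in>F. nat \<bar>y\<bar>)" by linarith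
  qed
  obtain K :: nat where K: "2 / e \<le> real K" using real_arch_simple by blast
  have "P {- int n..int n}" if n: "n \<ge> N + K" for n
  proof (rule P[rule_format], intro conjI)
    show "F \<subseteq> {- int n..int n}"
    proof
      fix x assume "x \<in> F"
      from N[OF this] n show "x \<in> {- int n..int n}" unfolding atLeastAtMost_iff by linarith
    qed
    have "boundary {- int n..int n} \<subseteq> {- int n, int n}" by (auto simp: boundary_def)
    then have "card (boundary {- int n..int n}) \<le> card {- int n, int n}"
      by (intro card_mono) auto
    also have "\<dots> \<le> 2" by (simp add: card_insert_if)
    finally have "real (card (boundary {- int n..int n})) \<le> 2" by simp
    also have "\<dots> \<le> e * real K" using K e by (simp add: field_simps)
    also have "\<dots> \<le> e * real (card {- int n..int n})" using n e by simp
    finally show "real (card (boundary {- int n..int n})) \<le> e * real (card {- int n..int n})" .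
  qed simp
  then show "\<forall>\<^sub>F n in sequentially. P {- int n..int n}"
    unfolding eventually_sequentially by blast
qed

end

theory Submission
  imports Defs
begin

text \<open>The potential of an interval is controlled by one number: its mean absolute value. Once these
  numbers are summable over the length of the interval, the statement is a counting argument. By
  translation invariance the mean of an interval potential depends only on the length \<open>k\<close>; the
  free energy of \<open>V\<close> contains it once for each of the \<open>card V - O(k * card (boundary V))\<close>
  positions of such an interval in \<open>V\<close>, while the energy per site contains it exactly once,
  namely \<open>k + 1\<close> intervals with weight \<open>1 / (k + 1)\<close>. Dominated convergence for series finishes
  the proof (\<open>lost_placements\<close>, \<open>energy_eq\<close>, \<open>energy_density_limit\<close>).

  Summability is a matter of low temperature. The specification with plus spins outside \<open>V\<close>
  assigns to a layer configuration with minus spins on \<open>M\<close> a weight proportional to the limit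
  \<open>rho \<beta> M\<close> of partition function ratios of the box with the layer removed. The potential of an
  interval with minus end spins \<open>j\<close> and \<open>i\<close> is the logarithm of the ratio between \<open>rho\<close> with one
  of these spins at a time and \<open>rho\<close> with both of them, that is, up to constants, a covariance
  of local observables at the two ends in the Ising model off the layer, the layer carrying the
  given configuration (\<open>ratio_covariance\<close>, \<open>telescoping_decay\<close>).

  Covariances are estimated with two independent copies. If the cluster of sites around one end
  on which the copies disagree does not reach the other end, the copies can be exchanged on this
  cluster without change of energy, and the contributions cancel (\<open>covariance_bound\<close>). Otherwise
  there is a path from one end to the other on which at least one copy is minus at every site. A
  contour of the union of the two minus sets surrounds this path, and it belongs to a connected
  union of contours of the two copies, which are erased by flipping spins (\<open>far_pair_contour\<close>,
  \<open>contour_weight\<close>). Contours are plaquette-connected parts of edge boundaries; that they are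
  boundaries themselves is the triviality of the first cohomology of the plane modulo two
  (\<open>bd_enclosed\<close>). The erased contours have more edges than the distance between the
  neighbourhoods of the two ends, while minus spins in the layer lower the energy gain by a
  fixed amount for each of them. If at most one spin out of 18 in the interval is minus, the
  gain still wins over the entropy for large \<open>\<beta>\<close>, and the potential is exponentially small. This
  is the meaning of the threshold \<open>8 / 9\<close> for the average spin: the measures in the class
  violate it on an interval with exponentially small probability, and there the potential is at
  least bounded (\<open>telescoping_bounded\<close>, \<open>u_abs_le\<close>).

  The same exchange argument, applied to copies in two different volumes, shows that the finite
  volume ratios converge and that the limit is translation invariant (\<open>volume_comparison\<close>,
  \<open>ratio_tendsto\<close>, \<open>rho_shift\<close>).\<close>

section \<open>Contours in the square lattice\<close>

text \<open>The edge \<open>(z, False)\<close> leaves \<open>z\<close> to the right, \<open>(z, True)\<close> leaves it upwards. In this way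
  every bond of the lattice has exactly one name, and no quotient by orientation is needed.\<close>
type_synonym edge = "site \<times> bool"

fun tip :: "edge \<Rightarrow> site" where
  "tip ((a, b), False) = (a + 1, b)"
| "tip ((a, b), True) = (a, b + 1)"

definition bd :: "site set \<Rightarrow> edge set" where
  "bd A = {e. fst e \<in> A \<longleftrightarrow> tip e \<notin> A}"

text \<open>The condition says that every unit square has an even number of its four edges in \<open>E\<close>:
  modulo two, \<open>E\<close> is a closed 1-form. Edge boundaries have this property, and so has every
  plaquette component of one; this is why the notion is convenient for cutting a boundary into
  single contours.\<close>
definition cocycle :: "edge set \<Rightarrow> bool" where
  "cocycle E \<longleftrightarrow> (\<forall>a b. (((a, b), False) \<in> E \<longleftrightarrow> ((a, b + 1), False) \<in> E) \<longleftrightarrow>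
                      (((a, b), True) \<in> E \<longleftrightarrow> ((a + 1, b), True) \<in> E))"

definition above_edges :: "edge set \<Rightarrow> site \<Rightarrow> edge set" where
  "above_edges E z = {e \<in> E. \<exists>t\<ge>snd z. e = ((fst z, t), True)}"

text \<open>Counting crossings with the upward ray decides on which side of \<open>E\<close> a site lies. For a
  cocycle any other way to infinity would give the same answer.\<close>
definition enclosed :: "edge set \<Rightarrow> site set" where
  "enclosed E = {z. odd (card (above_edges E z))}"

definition inc :: "site set \<Rightarrow> edge set" where
  "inc M = {e. fst e \<in> M \<or> tip e \<in> M}"

lemma inc_eq:
  "inc M = (\<Union>p\<in>M. {(p, False), (p, True), ((fst p - 1, snd p), False), ((fst p, snd p - 1), True)})"
  (is "_ = ?R")
proof (intro set_eqI iffI)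
  fix e assume "e \<in> inc M"
  then show "e \<in> ?R"
  proof (cases e rule: tip.cases)
    case (1 a b)
    with \<open>e \<in> inc M\<close> have "(a, b) \<in> M \<or> (a + 1, b) \<in> M" by (simp add: inc_def)
    then show ?thesis unfolding 1 by (force intro: bexI[of _ "(a, b)"] bexI[of _ "(a + 1, b)"])
  next
    case (2 a b)
    with \<open>e \<in> inc M\<close> have "(a, b) \<in> M \<or> (a, b + 1) \<in> M" by (simp add: inc_def)
    then show ?thesis unfolding 2 by (force intro: bexI[of _ "(a, b)"] bexI[of _ "(a, b + 1)"])
  qed
next
  fix e assume "e \<in> ?R"
  then show "e \<in> inc M" by (auto simp: inc_def)
qed

lemma finite_inc [simp]: "finite M \<Longrightarrow> finite (inc M)"
  by (simp add: inc_eq)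

lemma card_inc_le:
  assumes "finite M"
  shows "card (inc M) \<le> 4 * card M"
proof -
  have "card (inc M) \<le> (\<Sum>p\<in>M. card {(p, False), (p, True), ((fst p - 1, snd p), False), ((fst p, snd p - 1), True)})"
    unfolding inc_eq by (rule card_UN_le[OF assms])
  also have "\<dots> \<le> (\<Sum>p\<in>M. 4)"
    by (intro sum_mono) (simp add: card_insert_if)
  finally show ?thesis by simp
qed

lemma bd_subset_inc: "bd A \<subseteq> inc A"
  by (auto simp: bd_def inc_def)

lemma finite_bd [simp]: "finite A \<Longrightarrow> finite (bd A)"
  using bd_subset_inc finite_inc finite_subset by metis

lemma cocycle_bd: "cocycle (bd A)"
  by (auto simp: cocycle_def bd_def)

lemma finite_edges_bounded:
  assumes "finite E"
  obtains N :: int where "N \<ge> 0" "\<And>a b d. ((a, b), d) \<in> E \<Longrightarrow> \<bar>a\<bar> \<le> N \<and> \<bar>b\<bar> \<le> N"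
proof
  let ?N = "\<Sum>e\<in>E. \<bar>fst (fst e)\<bar> + \<bar>snd (fst e)\<bar>"
  show "?N \<ge> 0" by (simp add: sum_nonneg)
  fix a b d assume "((a, b), d) \<in> E"
  then have "\<bar>fst (fst ((a, b), d))\<bar> + \<bar>snd (fst ((a, b), d))\<bar> \<le> ?N"
    using assms by (intro member_le_sum) auto
  then show "\<bar>a\<bar> \<le> ?N \<and> \<bar>b\<bar> \<le> ?N" by auto
qed

lemma finite_above_edges [simp]: "finite E \<Longrightarrow> finite (above_edges E z)"
  by (simp add: above_edges_def)

lemma enclosed_step_vertical:
  assumes "finite E"
  shows "((a, b) \<in> enclosed E \<longleftrightarrow> (a, b + 1) \<notin> enclosed E) \<longleftrightarrow> ((a, b), True) \<in> E"
proof -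
  have "b \<le> t \<longleftrightarrow> t = b \<or> b + 1 \<le> t" for t by auto
  then have "above_edges E (a, b) = (if ((a, b), True) \<in> E then insert ((a, b), True) (above_edges E (a, b + 1))
                          else above_edges E (a, b + 1))"
    by (auto simp: above_edges_def)
  moreover have "((a, b), True) \<notin> above_edges E (a, b + 1)" by (auto simp: above_edges_def)
  ultimately show ?thesis using assms by (auto simp: enclosed_def)
qed

text \<open>The plane is simply connected: every finite closed 1-form modulo two is exact. Vertical
  edges of \<open>E\<close> are met by construction of \<^const>\<open>enclosed\<close>. Horizontal edges are met far
  above \<open>E\<close>, where nothing is enclosed, and evenness on the unit squares carries this down row
  by row.\<close>
lemma bd_enclosed:
  assumes "finite E" "cocycle E"
  shows "bd (enclosed E) = E"
proof -
  obtain N where N: "N \<ge> 0" "\<And>a b d. ((a, b), d) \<in> E \<Longrightarrow> \<bar>a\<bar> \<le> N \<and> \<bar>b\<bar> \<le> N"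
    using finite_edges_bounded[OF assms(1)] by blast
  have top: "((a, b), d) \<notin> E \<and> (a, b) \<notin> enclosed E" if "b > N" for a b d
  proof -
    have "above_edges E (a, b) = {}" using N(2) that by (fastforce simp: above_edges_def)
    with N(2) that show ?thesis by (fastforce simp: enclosed_def)
  qed
  have hor: "((a, b) \<in> enclosed E \<longleftrightarrow> (a + 1, b) \<notin> enclosed E) \<longleftrightarrow> ((a, b), False) \<in> E" for a b
  proof (cases "b \<le> N + 1")
    case False
    then show ?thesis using top[of b] by auto
  next
    case True
    then show ?thesis
    proof (induction b rule: int_le_induct)
      case base
      then show ?case using top[of "N + 1"] by auto
    next
      case (step b)
      have "(((a, b - 1), False) \<in> E \<longleftrightarrow> ((a, b), False) \<in> E) \<longleftrightarrow>
            (((a, b - 1), True) \<in> E \<longleftrightarrow> ((a + 1, b - 1), True) \<in> E)"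
        using assms(2)[unfolded cocycle_def, rule_format, of a "b - 1"] by simp
      then show ?case
        using step.IH enclosed_step_vertical[OF assms(1), of a "b - 1"]
          enclosed_step_vertical[OF assms(1), of "a + 1" "b - 1"] by auto
    qed
  qed
  have "e \<in> bd (enclosed E) \<longleftrightarrow> e \<in> E" for e
    using hor enclosed_step_vertical[OF assms(1)]
    by (cases e rule: tip.cases) (auto simp: bd_def)
  then show ?thesis by blast
qed

lemma finite_enclosed:
  assumes "finite E" "cocycle E"
  shows "finite (enclosed E)"
proof -
  obtain N where N: "N \<ge> 0" "\<And>a b d. ((a, b), d) \<in> E \<Longrightarrow> \<bar>a\<bar> \<le> N \<and> \<bar>b\<bar> \<le> N"
    using finite_edges_bounded[OF assms(1)] by blast
  have far: "(a, b) \<notin> enclosed E" if "b > N \<or> \<bar>a\<bar> > N" for a b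
  proof -
    have "above_edges E (a, b) = {}" using N(2) that by (fastforce simp: above_edges_def)
    then show ?thesis by (simp add: enclosed_def)
  qed
  \<comment> \<open>Below \<open>E\<close> the parity is constant along rows, because there are no horizontal edges, and it vanishes far to the right.\<close>
  have low: "(a, b) \<notin> enclosed E" if b: "b < - N" for a b
  proof (cases "a \<le> N + 1")
    case False
    then show ?thesis using far[of b a] N(1) by linarith
  next
    case True
    then show ?thesis
    proof (induction a rule: int_le_induct)
      case base
      show ?case using far[of b "N + 1"] N(1) by linarith
    next
      case (step a)
      have "((a - 1, b), False) \<notin> E" using N(2) b by fastforce
      then have "((a - 1, b), False) \<notin> bd (enclosed E)" using bd_enclosed[OF assms] by simp
      with step.IH show ?case by (auto simp: bd_def)
    qed
  qed
  have "enclosed E \<subseteq> {- N..N} \<times> {- N..N}"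
  proof
    fix z assume z: "z \<in> enclosed E"
    obtain a b where [simp]: "z = (a, b)" by (cases z)
    have "\<not> (b > N \<or> \<bar>a\<bar> > N)" "\<not> b < - N" using far low z by auto
    then show "z \<in> {- N..N} \<times> {- N..N}" by auto
  qed
  then show ?thesis by (rule finite_subset) auto
qed

subsection \<open>Rays\<close>

definition ray :: "site \<Rightarrow> site \<Rightarrow> nat \<Rightarrow> site" where
  "ray z v t = (fst z + int t * fst v, snd z + int t * snd v)"

definition units :: "site set" where
  "units = {(1, 0), (-1, 0), (0, 1), (0, -1)}"

lemma finite_not_ray:
  assumes "finite T" "v \<in> units" "\<And>t. ray z v t \<in> T"
  shows False
proof -
  have "inj (ray z v)" using assms(2) by (auto simp: inj_def ray_def units_def)
  moreover have "finite (range (ray z v))" by (rule finite_subset[OF _ assms(1)]) (use assms(3) in auto)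
  ultimately show False using finite_imageD[of "ray z v" UNIV] infinite_UNIV_nat by simp
qed

lemma nn_iff_edge: "nn x y \<longleftrightarrow> (\<exists>e. (x = fst e \<and> y = tip e) \<or> (y = fst e \<and> x = tip e))"
proof
  assume nn: "nn x y"
  obtain a b c d where [simp]: "x = (a, b)" "y = (c, d)" by (cases x, cases y)
  from nn have "\<bar>a - c\<bar> + \<bar>b - d\<bar> = 1" by (simp add: nn_def)
  then have "(c = a + 1 \<and> d = b) \<or> (a = c + 1 \<and> b = d) \<or> (c = a \<and> d = b + 1) \<or> (a = c \<and> b = d + 1)"
    by arith
  then show "\<exists>e. (x = fst e \<and> y = tip e) \<or> (y = fst e \<and> x = tip e)"
  proof (elim disjE conjE)
    assume "c = a + 1" "d = b"
    then show ?thesis by (intro exI[of _ "((a, b), False)"]) auto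
  next
    assume "a = c + 1" "b = d"
    then show ?thesis by (intro exI[of _ "((c, d), False)"]) auto
  next
    assume "c = a" "d = b + 1"
    then show ?thesis by (intro exI[of _ "((a, b), True)"]) auto
  next
    assume "a = c" "b = d + 1"
    then show ?thesis by (intro exI[of _ "((c, d), True)"]) auto
  qed
next
  assume "\<exists>e. (x = fst e \<and> y = tip e) \<or> (y = fst e \<and> x = tip e)"
  then obtain e where "(x = fst e \<and> y = tip e) \<or> (y = fst e \<and> x = tip e)" by blast
  then show "nn x y" by (cases e rule: tip.cases) (auto simp: nn_def)
qed

lemma same_side_of_bd:
  assumes "nn x y" "\<And>e. {fst e, tip e} = {x, y} \<Longrightarrow> e \<notin> bd T"
  shows "x \<in> T \<longleftrightarrow> y \<in> T"
proof -
  obtain e where e: "(x = fst e \<and> y = tip e) \<or> (y = fst e \<and> x = tip e)"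
    using assms(1) nn_iff_edge by blast
  then have "{fst e, tip e} = {x, y}" by auto
  with assms(2) have "e \<notin> bd T" by blast
  with e show ?thesis by (auto simp: bd_def)
qed

lemma nn_ray: "v \<in> units \<Longrightarrow> nn (ray z v t) (ray z v (Suc t))"
  by (auto simp: nn_def ray_def units_def algebra_simps)

text \<open>A finite set with a point on such a ray would contain the whole ray, since membership
  changes only across the boundary.\<close>
lemma not_in_if_ray_avoids_bd:
  assumes "finite T" "v \<in> units"
    and "\<And>t e. {fst e, tip e} = {ray z v t, ray z v (Suc t)} \<Longrightarrow> e \<notin> bd T"
  shows "z \<notin> T"
proof
  assume z: "z \<in> T"
  have "ray z v t \<in> T" for t
  proof (induction t)
    case 0
    show ?case using z by (simp add: ray_def)
  next
    case (Suc t)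
    have "ray z v t \<in> T \<longleftrightarrow> ray z v (Suc t) \<in> T"
      by (rule same_side_of_bd[OF nn_ray[OF assms(2)] assms(3)])
    with Suc show ?case by simp
  qed
  with assms(1,2) show False by (rule finite_not_ray)
qed

lemma bd_inject:
  assumes "finite A" "finite B" "bd A = bd B"
  shows "A = B"
proof -
  let ?D = "(A - B) \<union> (B - A)"
  have "e \<notin> bd ?D" for e
  proof -
    have "e \<in> bd A \<longleftrightarrow> e \<in> bd B" using assms(3) by simp
    then show ?thesis by (auto simp: bd_def)
  qed
  then have "z \<notin> ?D" for z
    using assms(1,2) by (intro not_in_if_ray_avoids_bd[where v = "(1, 0)" and T = ?D]) (simp_all add: units_def)
  then show ?thesis by blast
qed

lemma enclosed_bd: "finite S \<Longrightarrow> enclosed (bd S) = S"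
  by (rule bd_inject) (simp_all add: finite_enclosed cocycle_bd bd_enclosed)

subsection \<open>Plaquette components\<close>

fun plaq :: "site \<Rightarrow> edge set" where
  "plaq (a, b) = {((a, b), False), ((a, b + 1), False), ((a, b), True), ((a + 1, b), True)}"

text \<open>Two edges are adjacent if they lie on a common unit square, which is the adjacency that
  makes a contour connected.\<close>
definition steps :: "edge set \<Rightarrow> edge rel" where
  "steps G = {(e, f). e \<in> G \<and> f \<in> G \<and> (\<exists>p. e \<in> plaq p \<and> f \<in> plaq p)}"

definition pcomp :: "edge set \<Rightarrow> edge \<Rightarrow> edge set" where
  "pcomp G e = (steps G)\<^sup>* `` {e}"

definition linked :: "edge set \<Rightarrow> bool" where
  "linked F \<longleftrightarrow> (\<forall>e\<in>F. \<forall>f\<in>F. (e, f) \<in> (steps F)\<^sup>*)"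

lemma sym_steps_rtrancl: "(e, f) \<in> (steps G)\<^sup>* \<Longrightarrow> (f, e) \<in> (steps G)\<^sup>*"
proof -
  have "sym (steps G)" by (auto simp: sym_def steps_def)
  then show "(e, f) \<in> (steps G)\<^sup>* \<Longrightarrow> (f, e) \<in> (steps G)\<^sup>*"
    by (meson sym_rtrancl symD)
qed

lemma pcomp_subset: "e \<in> G \<Longrightarrow> pcomp G e \<subseteq> G"
proof
  fix f assume "e \<in> G" "f \<in> pcomp G e"
  then have "(e, f) \<in> (steps G)\<^sup>*" by (simp add: pcomp_def)
  then show "f \<in> G" using \<open>e \<in> G\<close> by induction (auto simp: steps_def)
qed

lemma self_in_pcomp: "e \<in> pcomp G e"
  by (simp add: pcomp_def)

lemma pcomp_closed:
  assumes "f \<in> pcomp G e" "(f, g) \<in> steps G"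
  shows "g \<in> pcomp G e"
  using assms unfolding pcomp_def by (auto intro: rtrancl_into_rtrancl)

lemma pcomp_eq_if_meet:
  assumes "g \<in> pcomp G e" "g \<in> pcomp G f"
  shows "pcomp G e = pcomp G f"
proof -
  have "(e, g) \<in> (steps G)\<^sup>*" "(f, g) \<in> (steps G)\<^sup>*" using assms by (auto simp: pcomp_def)
  then have "(e, f) \<in> (steps G)\<^sup>*" "(f, e) \<in> (steps G)\<^sup>*"
    by (meson rtrancl_trans sym_steps_rtrancl)+
  then show ?thesis by (auto simp: pcomp_def intro: rtrancl_trans)
qed

lemma linked_pcomp: "linked (pcomp G e)"
proof -
  have "(e, f) \<in> (steps (pcomp G e))\<^sup>*" if "f \<in> pcomp G e" for f
  proof -
    have "(e, f) \<in> (steps G)\<^sup>*" using that by (simp add: pcomp_def)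
    then show ?thesis
    proof induction
      case (step f g)
      have f: "f \<in> pcomp G e" using step.hyps by (simp add: pcomp_def)
      have "g \<in> pcomp G e" using pcomp_closed[OF f step.hyps(2)] .
      with f have "(f, g) \<in> steps (pcomp G e)" using step.hyps(2) by (auto simp: steps_def)
      with step.IH show ?case by (rule rtrancl_into_rtrancl)
    qed simp
  qed
  then show ?thesis unfolding linked_def
    by (meson rtrancl_trans sym_steps_rtrancl)
qed

lemma linked_subset_pcomp:
  assumes "linked E" "E \<subseteq> G" "e \<in> E"
  shows "E \<subseteq> pcomp G e"
proof -
  have "steps E \<subseteq> steps G" using assms(2) by (auto simp: steps_def)
  then have "(steps E)\<^sup>* \<subseteq> (steps G)\<^sup>*" by (rule rtrancl_mono)
  then show ?thesis using assms(1,3) by (auto simp: linked_def pcomp_def)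
qed

text \<open>A unit square with an edge in the component has all its edges from \<open>G\<close> in the component. So
  the restriction to the component keeps either all edges of \<open>A\<close> on the square or none of
  them.\<close>
lemma cocycle_pcomp_Int:
  assumes "e \<in> G" "A \<subseteq> G" "cocycle A"
  shows "cocycle (pcomp G e \<inter> A)"
  unfolding cocycle_def
proof (intro allI)
  fix a b
  have all: "f \<in> pcomp G e" if "g \<in> pcomp G e" "g \<in> plaq (a, b)" "f \<in> plaq (a, b)" "f \<in> A" for f g
  proof -
    have "(g, f) \<in> steps G"
      using that assms(2) pcomp_subset[OF assms(1)] unfolding steps_def by blast
    then show ?thesis by (rule pcomp_closed[OF that(1)])
  qed
  have c: "(((a, b), False) \<in> A \<longleftrightarrow> ((a, b + 1), False) \<in> A) \<longleftrightarrow>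
         (((a, b), True) \<in> A \<longleftrightarrow> ((a + 1, b), True) \<in> A)"
    using assms(3) by (simp add: cocycle_def)
  show "(((a, b), False) \<in> pcomp G e \<inter> A \<longleftrightarrow> ((a, b + 1), False) \<in> pcomp G e \<inter> A) \<longleftrightarrow>
         (((a, b), True) \<in> pcomp G e \<inter> A \<longleftrightarrow> ((a + 1, b), True) \<in> pcomp G e \<inter> A)"
  proof (cases "\<exists>g. g \<in> pcomp G e \<and> g \<in> plaq (a, b)")
    case True
    then obtain g where g: "g \<in> pcomp G e" "g \<in> plaq (a, b)" by blast
    have "f \<in> pcomp G e \<inter> A \<longleftrightarrow> f \<in> A" if "f \<in> plaq (a, b)" for f
      using all[OF g that] by blast
    then show ?thesis using c by simp
  next
    case False
    then show ?thesis by auto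
  qed
qed

text \<open>The upward ray from \<open>x \<in> S\<close> crosses the boundary of \<open>S\<close> an odd number of times. These
  crossings are distributed over the components, so at least one component receives an odd
  number of them.\<close>
lemma surrounding_component:
  assumes "finite S" "x \<in> S"
  obtains e where "e \<in> bd S" "x \<in> enclosed (pcomp (bd S) e)"
proof -
  let ?P = "above_edges (bd S) x" and ?C = "pcomp (bd S) ` bd S"
  have odd: "odd (card ?P)" using enclosed_bd[OF assms(1)] assms(2) by (auto simp: enclosed_def)
  have "\<exists>c\<in>?C. x \<in> enclosed c"
  proof (rule ccontr)
    assume "\<not> ?thesis"
    then have ev: "even (card (above_edges c x))" if "c \<in> ?C" for c using that by (auto simp: enclosed_def)
    have U: "?P = (\<Union>c\<in>?C. above_edges c x)"
      using self_in_pcomp pcomp_subset by (fastforce simp: above_edges_def)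
    have "card ?P = (\<Sum>c\<in>?C. card (above_edges c x))"
      unfolding U
    proof (rule card_UN_disjoint)
      show "finite ?C" using assms(1) by simp
      show "\<forall>c\<in>?C. finite (above_edges c x)"
        using finite_subset[OF pcomp_subset finite_bd[OF assms(1)]] by (auto intro!: finite_above_edges)
      show "\<forall>c\<in>?C. \<forall>d\<in>?C. c \<noteq> d \<longrightarrow> above_edges c x \<inter> above_edges d x = {}"
      proof (intro ballI impI, rule ccontr)
        fix c d assume "c \<in> ?C" "d \<in> ?C" "c \<noteq> d" "above_edges c x \<inter> above_edges d x \<noteq> {}"
        then obtain g where "g \<in> c" "g \<in> d" unfolding above_edges_def by blast
        with \<open>c \<in> ?C\<close> \<open>d \<in> ?C\<close> \<open>c \<noteq> d\<close> show False using pcomp_eq_if_meet by blast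
      qed
    qed
    moreover have "even (\<Sum>c\<in>?C. card (above_edges c x))" using ev by (intro dvd_sum)
    ultimately show False using odd by simp
  qed
  with that show ?thesis by blast
qed

subsection \<open>Clusters of sites and the size of surrounding contours\<close>

definition link :: "site set \<Rightarrow> site rel" where
  "link S = {(x, y). x \<in> S \<and> y \<in> S \<and> nn x y}"

lemma link_rtrancl_in:
  assumes "(x, y) \<in> (link S)\<^sup>*" "x \<in> S"
  shows "y \<in> S"
  using assms by induction (auto simp: link_def)

text \<open>No boundary edge of \<open>S\<close> joins two sites of \<open>S\<close>. Hence membership in a set whose boundary is
  part of that of \<open>S\<close> is constant along paths in \<open>S\<close>: a contour that surrounds one site of a
  cluster surrounds the whole cluster.\<close>
lemma link_invariant:
  assumes "(x, y) \<in> (link S)\<^sup>*" "x \<in> R" "bd R \<subseteq> bd S"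
  shows "y \<in> R"
  using assms(1)
proof induction
  case base
  show ?case by (rule assms(2))
next
  case (step y z)
  have yz: "y \<in> S" "z \<in> S" "nn y z" using step.hyps by (auto simp: link_def)
  have "e \<notin> bd R" if "{fst e, tip e} = {y, z}" for e
  proof -
    have "fst e \<in> S" "tip e \<in> S" using that yz by (metis insertE insertI1 insert_iff singletonD)+
    then show ?thesis using assms(3) by (auto simp: bd_def)
  qed
  with step.IH same_side_of_bd[OF yz(3)] show ?case by blast
qed

lemma link_projection:
  fixes g :: "site \<Rightarrow> int"
  assumes "(x, y) \<in> (link S)\<^sup>*"
    and lip: "\<And>u v. nn u v \<Longrightarrow> \<bar>g u - g v\<bar> \<le> 1"
    and "min (g x) (g y) \<le> c" "c \<le> max (g x) (g y)"
  shows "\<exists>z. (x, z) \<in> (link S)\<^sup>* \<and> g z = c"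
  using assms(1,3,4)
proof induction
  case base
  then show ?case by (intro exI[of _ x]) auto
next
  case (step y z)
  have "\<bar>g y - g z\<bar> \<le> 1" using step.hyps lip by (auto simp: link_def)
  show ?case
  proof (cases "c = g z")
    case True
    then show ?thesis using step.hyps by (blast intro: rtrancl_into_rtrancl)
  next
    case False
    have "min (g x) (g y) \<le> c \<and> c \<le> max (g x) (g y)"
      using step.prems False \<open>\<bar>g y - g z\<bar> \<le> 1\<close> by (auto simp: min_def max_def split: if_splits)
    then show ?thesis using step.IH by blast
  qed
qed

lemma nn_coord: "nn u v \<Longrightarrow> \<bar>fst u - fst v\<bar> \<le> 1" "nn u v \<Longrightarrow> \<bar>snd u - snd v\<bar> \<le> 1"
  by (auto simp: nn_def)

lemma column_exit:
  assumes "finite R" "(a, b) \<in> R"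
  shows "\<exists>t\<ge>b. ((a, t), True) \<in> bd R"
proof (rule ccontr)
  assume *: "\<not> ?thesis"
  have "(a, b) \<notin> R"
  proof (rule not_in_if_ray_avoids_bd[where v = "(0, 1)", OF assms(1)])
    fix t e assume e: "{fst e, tip e} = {ray (a, b) (0, 1) t, ray (a, b) (0, 1) (Suc t)}"
    have "e = ((a, b + int t), True)"
      using e by (cases e rule: tip.cases) (auto simp: ray_def doubleton_eq_iff)
    then show "e \<notin> bd R" using * by auto
  qed (simp add: units_def)
  with assms show False by simp
qed

lemma row_exit:
  assumes "finite R" "(a, b) \<in> R"
  shows "\<exists>t\<ge>a. ((t, b), False) \<in> bd R"
proof (rule ccontr)
  assume *: "\<not> ?thesis"
  have "(a, b) \<notin> R"
  proof (rule not_in_if_ray_avoids_bd[where v = "(1, 0)", OF assms(1)])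
    fix t e assume e: "{fst e, tip e} = {ray (a, b) (1, 0) t, ray (a, b) (1, 0) (Suc t)}"
    have "e = ((a + int t, b), False)"
      using e by (cases e rule: tip.cases) (auto simp: ray_def doubleton_eq_iff)
    then show "e \<notin> bd R" using * by auto
  qed (simp add: units_def)
  with assms show False by simp
qed

lemma column_exit_below:
  assumes "finite R" "(a, b) \<in> R"
  shows "\<exists>t<b. ((a, t), True) \<in> bd R"
proof (rule ccontr)
  assume *: "\<not> ?thesis"
  have "(a, b) \<notin> R"
  proof (rule not_in_if_ray_avoids_bd[where v = "(0, -1)", OF assms(1)])
    fix t e assume e: "{fst e, tip e} = {ray (a, b) (0, -1) t, ray (a, b) (0, -1) (Suc t)}"
    have "e = ((a, b - int t - 1), True)"
      using e by (cases e rule: tip.cases) (auto simp: ray_def doubleton_eq_iff)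
    then show "e \<notin> bd R" using * by auto
  qed (simp add: units_def)
  with assms show False by simp
qed

text \<open>The path from \<open>x\<close> to \<open>y\<close> stays in \<open>R\<close>, so it meets every column (or row) between them inside
  \<open>R\<close>, and from there the ray along the column (row) leaves \<open>R\<close> through a boundary edge of its
  own.\<close>
lemma bd_size:
  assumes R: "finite R" and xR: "x \<in> R" and sub: "bd R \<subseteq> bd S" and xy: "(x, y) \<in> (link S)\<^sup>*"
  shows "\<bar>fst y - fst x\<bar> < int (card (bd R))" "\<bar>snd y - snd x\<bar> < int (card (bd R))"
proof -
  have fin: "finite (bd R)" using R by simp
  have hit: "\<exists>z\<in>R. g z = c" if "\<And>u v. nn u v \<Longrightarrow> \<bar>g u - g v\<bar> \<le> 1"
    "c \<in> {min (g x) (g y)..max (g x) (g y)}" for g :: "site \<Rightarrow> int" and c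
    using link_projection[where g = g and c = c, OF xy that(1)] that(2) link_invariant[OF _ xR sub] by auto
  have main: "\<bar>g y - g x\<bar> < int (card (bd R))"
    if lip: "\<And>u v. nn u v \<Longrightarrow> \<bar>g u - g v\<bar> \<le> 1"
      and ex: "\<And>z. z \<in> R \<Longrightarrow> \<exists>e\<in>bd R. g (fst e) = g z" for g :: "site \<Rightarrow> int"
  proof -
    have "{min (g x) (g y)..max (g x) (g y)} \<subseteq> (\<lambda>e. g (fst e)) ` bd R"
      using hit[of g, OF lip] ex by force
    then have "card {min (g x) (g y)..max (g x) (g y)} \<le> card (bd R)"
      using fin by (rule surj_card_le[rotated])
    then show ?thesis by (auto simp: min_def max_def split: if_splits)
  qed
  show "\<bar>fst y - fst x\<bar> < int (card (bd R))"
    using nn_coord(1) column_exit[OF R] by (intro main) force+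
  show "\<bar>snd y - snd x\<bar> < int (card (bd R))"
    using nn_coord(2) row_exit[OF R] by (intro main) force+
qed

subsection \<open>Counting linked edge sets\<close>

definition nbrs :: "edge \<Rightarrow> edge set" where
  "nbrs e = {f. \<exists>p. e \<in> plaq p \<and> f \<in> plaq p}"

lemma nbrs_subset:
  "nbrs e \<subseteq> plaq (fst e) \<union> plaq (if snd e then (fst (fst e) - 1, snd (fst e)) else (fst (fst e), snd (fst e) - 1))"
  (is "_ \<subseteq> plaq _ \<union> plaq ?q")
proof
  fix f assume "f \<in> nbrs e"
  then obtain a b where ab: "e \<in> plaq (a, b)" "f \<in> plaq (a, b)" by (auto simp: nbrs_def)
  from ab(1) have "fst e = (a, b) \<or> ?q = (a, b)" by auto
  with ab(2) show "f \<in> plaq (fst e) \<union> plaq ?q" by fastforce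
qed

lemma card_plaq_le: "finite (plaq p) \<and> card (plaq p) \<le> 4"
  by (cases p) (simp add: card_insert_if)

lemma finite_nbrs: "finite (nbrs e)"
  using nbrs_subset card_plaq_le by (meson finite_UnI finite_subset)

lemma card_nbrs_le: "card (nbrs e) \<le> 8"
proof -
  let ?p = "if snd e then (fst (fst e) - 1, snd (fst e)) else (fst (fst e), snd (fst e) - 1)"
  have "card (nbrs e) \<le> card (plaq (fst e) \<union> plaq ?p)"
    using nbrs_subset card_plaq_le by (intro card_mono) auto
  also have "\<dots> \<le> card (plaq (fst e)) + card (plaq ?p)" by (rule card_Un_le)
  also have "\<dots> \<le> 8" using card_plaq_le[of "fst e"] card_plaq_le[of ?p] by linarith
  finally show ?thesis .
qed

fun walks :: "edge \<Rightarrow> nat \<Rightarrow> edge list set" where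
  "walks e 0 = {[e]}"
| "walks e (Suc n) = (\<Union>f\<in>nbrs e. Cons e ` walks f n)"

lemma walks_Cons: "f \<in> nbrs e \<Longrightarrow> ws \<in> walks f n \<Longrightarrow> e # ws \<in> walks e (Suc n)"
  by auto

lemma finite_walks: "finite (walks e n)"
  by (induction n arbitrary: e) (auto simp: finite_nbrs)

lemma card_walks_le: "card (walks e n) \<le> 8 ^ n"
proof (induction n arbitrary: e)
  case (Suc n)
  have "card (walks e (Suc n)) \<le> (\<Sum>f\<in>nbrs e. card (Cons e ` walks f n))"
    by (simp add: card_UN_le finite_nbrs)
  also have "\<dots> \<le> (\<Sum>f\<in>nbrs e. 8 ^ n)"
    by (intro sum_mono order_trans[OF card_image_le Suc.IH] finite_walks)
  also have "\<dots> \<le> 8 ^ Suc n" using card_nbrs_le[of e] by simp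
  finally show ?case .
qed simp

lemma nbrs_sym: "f \<in> nbrs e \<Longrightarrow> e \<in> nbrs f"
  by (auto simp: nbrs_def)

lemma nbrs_height: "f \<in> nbrs e \<Longrightarrow> \<bar>snd (fst f) - snd (fst e)\<bar> \<le> 1"
proof -
  assume "f \<in> nbrs e"
  then obtain a b where "e \<in> plaq (a, b)" "f \<in> plaq (a, b)" by (auto simp: nbrs_def)
  then show ?thesis by auto
qed

lemma walks_height: "ws \<in> walks e n \<Longrightarrow> f \<in> set ws \<Longrightarrow> \<bar>snd (fst f) - snd (fst e)\<bar> \<le> int n"
proof (induction n arbitrary: e ws)
  case (Suc n)
  then obtain g vs where g: "g \<in> nbrs e" "vs \<in> walks g n" "ws = e # vs" by auto
  show ?case
  proof (cases "f = e")
    case False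
    with Suc.prems g have "f \<in> set vs" by auto
    then have "\<bar>snd (fst f) - snd (fst g)\<bar> \<le> int n" using Suc.IH[OF g(2)] by blast
    with nbrs_height[OF g(1)] show ?thesis by simp
  qed simp
qed simp

lemma walks_hd: "ws \<in> walks e n \<Longrightarrow> ws \<noteq> [] \<and> hd ws = e"
  by (cases n) auto

text \<open>A neighbour \<open>v\<close> of a visited edge \<open>u\<close> is visited by going from \<open>u\<close> to \<open>v\<close> and back.\<close>
lemma walks_detour:
  assumes "ws \<in> walks e n" "u \<in> set ws" "v \<in> nbrs u"
  shows "\<exists>ws'\<in>walks e (n + 2). set ws' = insert v (set ws)"
  using assms(1,2)
proof (induction n arbitrary: e ws)
  case 0
  then have "ws = [e]" "u = e" by auto
  have "[v, e] \<in> walks v (Suc 0)" using nbrs_sym[OF assms(3)] \<open>u = e\<close> by simp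
  moreover have "v \<in> nbrs e" using assms(3) \<open>u = e\<close> by simp
  ultimately have "[e, v, e] \<in> walks e (0 + 2)" by (auto simp: numeral_2_eq_2 simp del: walks.simps(1))
  then show ?case using \<open>ws = [e]\<close> by (intro bexI[of _ "[e, v, e]"]) auto
next
  case (Suc n)
  then obtain g vs where g: "g \<in> nbrs e" "vs \<in> walks g n" "ws = e # vs" by auto
  show ?case
  proof (cases "u = e")
    case True
    have "v \<in> nbrs e" "e \<in> nbrs v" using assms(3) True nbrs_sym by auto
    then have "e # v # ws \<in> walks e (Suc n + 2)"
      using walks_Cons[OF _ walks_Cons[OF _ Suc.prems(1)]] by simp
    then show ?thesis using g(3) by (intro bexI[of _ "e # v # ws"]) auto
  next
    case False
    with Suc.prems g have "u \<in> set vs" by auto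
    then obtain vs' where "vs' \<in> walks g (n + 2)" "set vs' = insert v (set vs)"
      using Suc.IH[OF g(2)] by blast
    then have "e # vs' \<in> walks e (Suc n + 2)" "set (e # vs') = insert v (set ws)"
      using walks_Cons[OF g(1), of vs' "n + 2"] g(3) by auto
    then show ?thesis by blast
  qed
qed

text \<open>A connected set is built up edge by edge, each new edge being adjacent to an old one and
  costing a detour of two steps. Connected sets of \<open>m\<close> edges through a given edge are thus
  images of walks with \<open>2 (m - 1)\<close> steps, and their number grows at most exponentially in \<open>m\<close>.
  This is the entropy bound of the Peierls argument.\<close>
lemma linked_walk:
  assumes "finite F" "linked F" "e \<in> F"
  shows "\<exists>ws\<in>walks e (2 * (card F - 1)). set ws = F"
proof -
  have "\<exists>D ws. D \<subseteq> F \<and> card D = Suc n \<and> ws \<in> walks e (2 * n) \<and> set ws = D"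
    if "n < card F" for n
    using that
  proof (induction n)
    case 0
    show ?case using assms(3) by (intro exI[of _ "{e}"] exI[of _ "[e]"]) auto
  next
    case (Suc n)
    then obtain D ws where D: "D \<subseteq> F" "card D = Suc n" "ws \<in> walks e (2 * n)" "set ws = D"
      by auto
    have eD: "e \<in> D" using walks_hd[OF D(3)] D(4) hd_in_set by fastforce
    obtain f where f: "f \<in> F" "f \<notin> D" using D(1,2) Suc.prems assms(1)
      by (metis card_mono finite_subset not_less subset_iff)
    have "(e, f) \<in> (steps F)\<^sup>*" using assms(2,3) f by (auto simp: linked_def)
    then have "f \<in> D \<or> (\<exists>u v. u \<in> D \<and> v \<notin> D \<and> (u, v) \<in> steps F)"
      by induction (use eD in blast)+
    then obtain u v where uv: "u \<in> D" "v \<notin> D" "(u, v) \<in> steps F" using f by blast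
    then have "v \<in> nbrs u" "v \<in> F" by (auto simp: steps_def nbrs_def)
    then obtain ws' where "ws' \<in> walks e (2 * n + 2)" "set ws' = insert v D"
      using walks_detour[OF D(3)] uv(1) D(4) by metis
    moreover have "card (insert v D) = Suc (Suc n)"
      using D(1,2) uv(2) assms(1) finite_subset by (metis card_insert_disjoint)
    ultimately show ?case using D(1) \<open>v \<in> F\<close>
      by (intro exI[of _ "insert v D"] exI[of _ ws']) auto
  qed
  moreover have "card F > 0" using assms(1,3) by (auto simp: card_gt_0_iff)
  ultimately obtain D ws where D: "D \<subseteq> F" "card D = Suc (card F - 1)"
    "ws \<in> walks e (2 * (card F - 1))" "set ws = D"
    by (metis diff_less zero_less_one)
  have "D = F" using D(1,2) \<open>card F > 0\<close> assms(1) by (intro card_subset_eq) auto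
  with D show ?thesis by blast
qed

text \<open>A finite family that contains every connected contour of \<open>m\<close> edges around \<open>x\<close>. Such a
  contour crosses the vertical line through \<open>x\<close> above and below \<open>x\<close>; being connected, it
  cannot cross it higher than its number of edges allows, which limits the possible starting
  edges of the covering walk.\<close>
definition contours :: "site \<Rightarrow> nat \<Rightarrow> edge set set" where
  "contours x m = (\<Union>h\<in>{0..2 * m}. set ` walks ((fst x, snd x + int h), True) (2 * (m - 1)))"

lemma finite_contours: "finite (contours x m)"
  by (simp add: contours_def finite_walks)

lemma card_contours_le:
  assumes "m \<ge> 1"
  shows "card (contours x m) \<le> 256 ^ m"
proof -
  have "card (contours x m) \<le> (\<Sum>h\<in>{0..2 * m}. card (set ` walks ((fst x, snd x + int h), True) (2 * (m - 1))))"
    unfolding contours_def by (rule card_UN_le) simp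
  also have "\<dots> \<le> (\<Sum>h\<in>{0..2 * m}. 8 ^ (2 * (m - 1)))"
    by (intro sum_mono order_trans[OF card_image_le card_walks_le] finite_walks)
  also have "\<dots> = (2 * m + 1) * 64 ^ (m - 1)" by (simp add: power_mult)
  also have "\<dots> \<le> 4 ^ m * 64 ^ m"
  proof (intro mult_mono power_increasing)
    show "2 * m + 1 \<le> 4 ^ m" using assms by (induction m rule: nat_induct_at_least) auto
  qed auto
  also have "\<dots> = 256 ^ m" by (simp flip: power_mult_distrib)
  finally show ?thesis .
qed

lemma linked_in_contours:
  assumes "finite F" "linked F" "((fst x, t), True) \<in> F" "t \<ge> snd x" "((fst x, s), True) \<in> F" "s < snd x"
  shows "F \<in> contours x (card F)"
proof -
  obtain ws where ws: "ws \<in> walks ((fst x, t), True) (2 * (card F - 1))" "set ws = F"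
    using linked_walk[OF assms(1-3)] by blast
  have "\<bar>s - t\<bar> \<le> int (2 * (card F - 1))"
    using walks_height[OF ws(1), of "((fst x, s), True)"] assms(5) ws(2) by simp
  then have "nat (t - snd x) \<in> {0..2 * card F}" "t = snd x + int (nat (t - snd x))"
    using assms(4,6) by auto
  with ws show ?thesis unfolding contours_def by (intro UN_I[of "nat (t - snd x)"]) auto
qed

section \<open>The Peierls estimate for two copies\<close>

text \<open>A configuration is given by its finite set \<open>A\<close> of minus sites, all other spins being plus.
  Every bond between unequal spins contributes \<open>-2\<close> to the exponent of the Ising weight, and
  there are \<open>card (bd A)\<close> of them; the volume does not enter.\<close>
definition wt :: "real \<Rightarrow> site set \<Rightarrow> real" where
  "wt \<beta> A = exp (- 2 * \<beta> * real (card (bd A)))"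

text \<open>The spins of \<open>\<Lambda>\<close> are summed over, those of \<open>M\<close> are minus and all others plus.\<close>
definition Z :: "real \<Rightarrow> site set \<Rightarrow> site set \<Rightarrow> real" where
  "Z \<beta> \<Lambda> M = (\<Sum>B\<in>Pow \<Lambda>. wt \<beta> (B \<union> M))"

text \<open>Every site outside \<open>\<Lambda>\<close> can escape to infinity outside \<open>\<Lambda>\<close>. Contours of configurations in \<open>\<Lambda>\<close>
  then enclose sites of \<open>\<Lambda>\<close> only, so that their interiors may be flipped. A box from which a
  full row has been removed still has this property, although it is no longer connected.\<close>
definition exterior_rays :: "site set \<Rightarrow> bool" where
  "exterior_rays \<Lambda> \<longleftrightarrow> (\<forall>z. z \<notin> \<Lambda> \<longrightarrow> (\<exists>v\<in>units. \<forall>t. ray z v t \<notin> \<Lambda>))"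

lemma wt_pos: "wt \<beta> A > 0"
  by (simp add: wt_def)

lemma Z_pos: "finite \<Lambda> \<Longrightarrow> Z \<beta> \<Lambda> M > 0"
  unfolding Z_def by (intro sum_pos) (auto simp: wt_pos)

lemma enclosed_subset:
  assumes "exterior_rays \<Lambda>" "B \<subseteq> \<Lambda>" "F \<subseteq> bd B" "finite F" "cocycle F"
  shows "enclosed F \<subseteq> \<Lambda>"
proof
  fix z assume z: "z \<in> enclosed F"
  show "z \<in> \<Lambda>"
  proof (rule ccontr)
    assume "z \<notin> \<Lambda>"
    then obtain v where v: "v \<in> units" "\<And>t. ray z v t \<notin> \<Lambda>"
      using assms(1) unfolding exterior_rays_def by blast
    have "z \<notin> enclosed F"
    proof (rule not_in_if_ray_avoids_bd[OF finite_enclosed[OF assms(4,5)] v(1)])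
      fix t e assume e: "{fst e, tip e} = {ray z v t, ray z v (Suc t)}"
      have "fst e \<notin> \<Lambda>" "tip e \<notin> \<Lambda>" using e v(2) by (metis doubleton_eq_iff)+
      then have "e \<notin> bd B" using assms(2) by (auto simp: bd_def)
      then show "e \<notin> bd (enclosed F)" using assms(3) bd_enclosed[OF assms(4,5)] by blast
    qed
    with z show False by simp
  qed
qed

text \<open>Flipping the spins enclosed by \<open>F\<close> removes \<open>F\<close> from the boundary, except that edges between
  \<open>B\<close> and \<open>M\<close> are not in the boundary before and enter it. There are at most \<open>4 * card M\<close> of
  those, and each counts twice: once as missing gain, once as loss.\<close>
lemma card_bd_flip:
  assumes "finite B" "finite M" "F \<subseteq> bd B" "finite F" "cocycle F" "enclosed F \<inter> M = {}"
  shows "card (bd (sym_diff B (enclosed F) \<union> M)) + card F \<le> card (bd (B \<union> M)) + 8 * card M"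
proof -
  let ?X = "bd (B \<union> M)"
  have fin: "finite ?X" using assms(1,2) by simp
  have "sym_diff B (enclosed F) \<union> M = sym_diff (B \<union> M) (enclosed F)" using assms(6) by blast
  moreover have "bd (sym_diff A T) = sym_diff (bd A) (bd T)" for A T by (auto simp: bd_def)
  ultimately have eq: "bd (sym_diff B (enclosed F) \<union> M) = sym_diff ?X F"
    using bd_enclosed[OF assms(4,5)] by simp
  have "F - ?X \<subseteq> inc M" using assms(3) by (auto simp: bd_def inc_def)
  then have "card (F - ?X) \<le> 4 * card M"
    using card_mono[OF finite_inc[OF assms(2)]] card_inc_le[OF assms(2)] order_trans by blast
  moreover have "card (sym_diff ?X F) = card (?X - F) + card (F - ?X)"
    using fin assms(4) by (intro card_Un_disjoint) auto
  moreover have "card ?X = card (?X - F) + card (?X \<inter> F)"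
    using card_Un_disjoint[of "?X - F" "?X \<inter> F"] fin by (simp add: Un_Diff_Int Int_Diff Diff_Int_distrib disjoint_iff)
  moreover have "card F = card (F - ?X) + card (?X \<inter> F)"
    using card_Un_disjoint[of "F - ?X" "F \<inter> ?X"] assms(4) by (simp add: Un_Diff_Int Int_commute Diff_Int_distrib disjoint_iff)
  ultimately show ?thesis unfolding eq by linarith
qed

text \<open>The Peierls estimate: the flip of the spins enclosed by \<open>F\<close> is injective and increases the
  weight by the exponential factor.\<close>
lemma contour_weight:
  assumes "\<beta> \<ge> 0" "finite \<Lambda>" "finite M" "\<Lambda> \<inter> M = {}" "exterior_rays \<Lambda>" "finite F" "cocycle F"
  shows "(\<Sum>B | B \<in> Pow \<Lambda> \<and> F \<subseteq> bd B. wt \<beta> (B \<union> M))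
           \<le> exp (- 2 * \<beta> * (real (card F) - 8 * real (card M))) * Z \<beta> \<Lambda> M"
proof -
  let ?K = "{B \<in> Pow \<Lambda>. F \<subseteq> bd B}" and ?f = "\<lambda>B. sym_diff B (enclosed F)"
  let ?c = "exp (- 2 * \<beta> * (real (card F) - 8 * real (card M)))"
  have fK: "finite ?K" using assms(2) by simp
  have sub: "?f B \<subseteq> \<Lambda>" and T: "enclosed F \<subseteq> \<Lambda>" if "B \<in> ?K" for B
    using enclosed_subset[OF assms(5) _ _ assms(6,7), of B] that by blast+
  have inj: "inj_on ?f ?K" by (rule inj_onI) blast
  have le: "wt \<beta> (B \<union> M) \<le> ?c * wt \<beta> (?f B \<union> M)" if B: "B \<in> ?K" for B
  proof -
    have "finite B" using B assms(2) finite_subset by auto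
    then have "card (bd (?f B \<union> M)) + card F \<le> card (bd (B \<union> M)) + 8 * card M"
      using card_bd_flip[of B M F] B T[OF B] assms by blast
    then have "real (card F) - 8 * real (card M) + real (card (bd (?f B \<union> M))) \<le> real (card (bd (B \<union> M)))"
      by linarith
    then have "(2 * \<beta>) * (real (card F) - 8 * real (card M) + real (card (bd (?f B \<union> M)))) \<le> (2 * \<beta>) * real (card (bd (B \<union> M)))"
      using assms(1) by (intro mult_left_mono) auto
    then show ?thesis by (simp add: wt_def flip: exp_add) (simp add: algebra_simps)
  qed
  have "(\<Sum>B\<in>?K. wt \<beta> (B \<union> M)) \<le> (\<Sum>B\<in>?K. ?c * wt \<beta> (?f B \<union> M))"
    by (intro sum_mono le)
  also have "\<dots> = ?c * (\<Sum>B\<in>?f ` ?K. wt \<beta> (B \<union> M))"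
    by (subst sum.reindex[OF inj]) (simp add: sum_distrib_left)
  also have "\<dots> \<le> ?c * (\<Sum>B\<in>Pow \<Lambda>. wt \<beta> (B \<union> M))"
    using sub assms(2) by (intro mult_left_mono sum_mono2) (auto simp: wt_pos less_imp_le)
  finally show ?thesis by (simp add: Z_def)
qed

text \<open>Pairs of configurations in which a path from \<open>x\<close> reaches the distance \<open>d\<close> through sites that
  are minus in at least one of the two copies.\<close>
definition far_pairs :: "site set \<Rightarrow> site set \<Rightarrow> site \<Rightarrow> nat \<Rightarrow> (site set \<times> site set) set" where
  "far_pairs \<Lambda> \<Lambda>' x d = {(B, B'). B \<subseteq> \<Lambda> \<and> B' \<subseteq> \<Lambda>' \<and> x \<in> B \<union> B' \<and>
     (\<exists>y. (x, y) \<in> (link (B \<union> B'))\<^sup>* \<and> (int d \<le> \<bar>fst y - fst x\<bar> \<or> int d \<le> \<bar>snd y - snd x\<bar>))}"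

text \<open>A boundary component \<open>E\<close> of \<open>B \<union> B'\<close> surrounds the whole path and is therefore long. It need
  not consist of contours of \<open>B\<close> and of \<open>B'\<close>, but the component \<open>C\<close> of \<open>bd B \<union> bd B'\<close> that
  contains it splits into a part in \<open>bd B\<close> and a part in \<open>bd B'\<close>, both cocycles, so that in
  each copy separately a flip is possible.\<close>
lemma far_pair_contour:
  assumes "finite \<Lambda>" "finite \<Lambda>'" "(B, B') \<in> far_pairs \<Lambda> \<Lambda>' x d"
  obtains F F' where "F \<subseteq> bd B" "F' \<subseteq> bd B'" "cocycle F" "cocycle F'"
    "F \<union> F' \<in> contours x (card (F \<union> F'))" "d < card (F \<union> F')"
proof -
  let ?S = "B \<union> B'" and ?G = "bd B \<union> bd B'"
  from assms(3) obtain y where B: "B \<subseteq> \<Lambda>" "B' \<subseteq> \<Lambda>'" and x: "x \<in> ?S" and xy: "(x, y) \<in> (link ?S)\<^sup>*"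
    and far: "int d \<le> \<bar>fst y - fst x\<bar> \<or> int d \<le> \<bar>snd y - snd x\<bar>"
    by (auto simp: far_pairs_def)
  have fin: "finite B" "finite B'" using B assms(1,2) finite_subset by auto
  then have finS: "finite ?S" and finG: "finite ?G" by auto
  obtain e where e: "e \<in> bd ?S" "x \<in> enclosed (pcomp (bd ?S) e)"
    using surrounding_component[OF finS x] by blast
  \<comment> \<open>The contour of the union of the two minus sets that surrounds \<open>x\<close>, and with it the path to \<open>y\<close>.\<close>
  define E where "E = pcomp (bd ?S) e"
  have ES: "E \<subseteq> bd ?S" unfolding E_def by (rule pcomp_subset[OF e(1)])
  have finE: "finite E" using ES finite_bd[OF finS] finite_subset by blast
  have "E \<inter> bd ?S = E" using ES by blast
  then have cE: "cocycle E"
    using cocycle_pcomp_Int[OF e(1) order_refl cocycle_bd] unfolding E_def by simp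
  define R where "R = enclosed E"
  have R: "finite R" "bd R = E" "x \<in> R"
    using finite_enclosed[OF finE cE] bd_enclosed[OF finE cE] e(2) by (auto simp: R_def E_def)
  have dE: "d < card E"
    using bd_size[OF R(1,3) _ xy] R(2) ES far by auto
  have SG: "bd ?S \<subseteq> ?G" by (auto simp: bd_def)
  have eG: "e \<in> ?G" using e(1) SG by blast
  \<comment> \<open>Passing to the larger graph \<open>?G\<close> makes the parts in \<open>bd B\<close> and in \<open>bd B'\<close> cocycles.\<close>
  define C where "C = pcomp ?G e"
  have CG: "C \<subseteq> ?G" unfolding C_def by (rule pcomp_subset[OF eG])
  have finC: "finite C" using CG finG finite_subset by blast
  have "e \<in> E" unfolding E_def by (rule self_in_pcomp)
  then have EC: "E \<subseteq> C" unfolding C_def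
    using ES SG linked_pcomp[of "bd ?S" e] by (intro linked_subset_pcomp) (auto simp: E_def)
  obtain a b where ab: "x = (a, b)" by (cases x)
  obtain t where t: "t \<ge> b" "((a, t), True) \<in> bd R"
    using column_exit[OF R(1), of a b] R(3) ab by auto
  obtain s where s: "s < b" "((a, s), True) \<in> bd R"
    using column_exit_below[OF R(1), of a b] R(3) ab by auto
  have "C \<in> contours x (card C)"
    using linked_in_contours[OF finC, of x t s] t s R(2) EC ab linked_pcomp[of ?G e]
    by (auto simp: C_def)
  moreover have "(C \<inter> bd B) \<union> (C \<inter> bd B') = C" using CG by blast
  moreover have "d < card C" using dE card_mono[OF finC EC] by linarith
  moreover have "cocycle (C \<inter> bd B)" "cocycle (C \<inter> bd B')"
    unfolding C_def by (intro cocycle_pcomp_Int eG cocycle_bd; blast)+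
  ultimately show ?thesis by (intro that[of "C \<inter> bd B" "C \<inter> bd B'"]) auto
qed

lemma sum_powers_le:
  fixes q :: real
  assumes "0 \<le> q" "q \<le> 1 / 2"
  shows "(\<Sum>m=a..N. q ^ m) \<le> 2 * q ^ a"
proof (cases "a \<le> N")
  case True
  then show ?thesis
  proof (induction a rule: inc_induct)
    case base
    show ?case using assms by simp
  next
    case (step a)
    have "(\<Sum>m=a..N. q ^ m) = q ^ a + (\<Sum>m=Suc a..N. q ^ m)"
      using step.hyps by (simp add: sum.atLeast_Suc_atMost)
    also have "\<dots> \<le> q ^ a + 2 * (q * q ^ a)" using step.IH by simp
    also have "\<dots> \<le> 2 * q ^ a" using mult_right_mono[OF assms(2), of "q ^ a"] assms(1) by simp
    finally show ?case .
  qed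
qed (use assms in auto)

lemma sum_Sigma_snd:
  assumes "finite A" "\<And>x. x \<in> A \<Longrightarrow> finite (B x)"
  shows "(\<Sum>t\<in>Sigma A B. h (snd t)) = (\<Sum>x\<in>A. sum h (B x))"
  using assms by (simp add: sum.Sigma split_def)

text \<open>Sum of the Peierls weights over all pairs \<open>(F1, F2)\<close> whose union is a possible contour
  around \<open>x\<close>. The factor \<open>1024 ^ m\<close> is the product of the \<open>256 ^ m\<close> possible unions and of at
  most \<open>4 ^ m\<close> ways of distributing one over the two copies. The minus spins in \<open>M\<close> cost \<open>exp
  (16 * \<beta> * card M)\<close> in each copy.\<close>
lemma peierls_sum:
  assumes "\<beta> \<ge> 0" "finite \<Lambda>" "finite \<Lambda>'" "exterior_rays \<Lambda>" "exterior_rays \<Lambda>'"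
    and "finite M" "\<Lambda> \<inter> M = {}" "\<Lambda>' \<inter> M = {}"
  shows "\<exists>N. (\<Sum>(B, B')\<in>far_pairs \<Lambda> \<Lambda>' x d. wt \<beta> (B \<union> M) * wt \<beta> (B' \<union> M))
           \<le> (\<Sum>m=Suc d..N. 1024 ^ m * exp (- 2 * \<beta> * (real m - 16 * real (card M)))) * (Z \<beta> \<Lambda> M * Z \<beta> \<Lambda>' M)"
proof -
  define K where "K \<Lambda> F = {B \<in> Pow \<Lambda>. F \<subseteq> bd B}" for \<Lambda> F
  define P where "P F = {(F1, F2). F1 \<union> F2 = F \<and> cocycle F1 \<and> cocycle F2}" for F
  define C where "C m = {F \<in> contours x m. card F = m}" for m
  define N where "N = 4 * (card \<Lambda> + card \<Lambda>')"
  \<comment> \<open>Every far pair is counted at least once, together with the size \<open>m\<close> of its contour, the contour \<open>F\<close> and the two parts of \<open>F\<close>.\<close>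
  define T where "T = (SIGMA m:{Suc d..N}. SIGMA F:C m. SIGMA p:P F. K \<Lambda> (fst p) \<times> K \<Lambda>' (snd p))"
  define g where "g = (\<lambda>(B, B'). wt \<beta> (B \<union> M) * wt \<beta> (B' \<union> M))"
  define c where "c m = exp (- 2 * \<beta> * (real m - 16 * real (card M)))" for m
  have g0: "g p \<ge> 0" for p by (auto simp: g_def less_imp_le wt_pos split: prod.splits)
  have finK: "finite (K \<Lambda> F)" "finite (K \<Lambda>' F)" for F using assms(2,3) by (auto simp: K_def)
  have finC: "finite (C m)" for m by (simp add: C_def finite_contours)
  have CF: "finite F" "card F = m" if "F \<in> C m" for F m
    using that by (auto simp: C_def contours_def)
  have Psub: "P F \<subseteq> Pow F \<times> Pow F" for F by (auto simp: P_def)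
  have finP: "finite (P F)" if "finite F" for F
    using finite_subset[OF Psub] that by simp
  have finT: "finite T"
    unfolding T_def using finC finP CF(1) finK by (intro finite_SigmaI) auto
  have finfar: "finite (far_pairs \<Lambda> \<Lambda>' x d)"
    by (rule finite_subset[of _ "Pow \<Lambda> \<times> Pow \<Lambda>'"]) (use assms(2,3) in \<open>auto simp: far_pairs_def\<close>)
  have "sum g (far_pairs \<Lambda> \<Lambda>' x d) \<le> (\<Sum>t\<in>T. g (snd (snd (snd t))))"
  proof (rule sum_le_included[OF finfar finT, where i = "\<lambda>t. snd (snd (snd t))"])
    show "\<forall>t\<in>T. 0 \<le> g (snd (snd (snd t)))" using g0 by blast
    show "\<forall>p\<in>far_pairs \<Lambda> \<Lambda>' x d. \<exists>t\<in>T. snd (snd (snd t)) = p \<and> g p \<le> g (snd (snd (snd t)))"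
    proof
      fix p assume p: "p \<in> far_pairs \<Lambda> \<Lambda>' x d"
      obtain B B' where pp: "p = (B, B')" by (cases p)
      have B: "B \<subseteq> \<Lambda>" "B' \<subseteq> \<Lambda>'" using p pp by (auto simp: far_pairs_def)
      obtain F F' where F: "F \<subseteq> bd B" "F' \<subseteq> bd B'" "cocycle F" "cocycle F'"
        "F \<union> F' \<in> contours x (card (F \<union> F'))" "d < card (F \<union> F')"
        using far_pair_contour[OF assms(2,3)] p pp by metis
      have finB: "finite B" "finite B'" using B assms(2,3) finite_subset by auto
      have bdle: "card (bd B) \<le> 4 * card \<Lambda>" if "B \<subseteq> \<Lambda>" "finite \<Lambda>" for B \<Lambda>
      proof -
        have "card (bd B) \<le> card (inc B)"
          using that finite_subset by (intro card_mono bd_subset_inc finite_inc) blast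
        also have "\<dots> \<le> 4 * card B" using that finite_subset by (intro card_inc_le) blast
        also have "\<dots> \<le> 4 * card \<Lambda>" using card_mono[OF that(2,1)] by simp
        finally show ?thesis .
      qed
      have "card (F \<union> F') \<le> card (bd B \<union> bd B')"
        using F(1,2) finB by (intro card_mono) auto
      also have "\<dots> \<le> N" unfolding N_def
        using order_trans[OF card_Un_le[of "bd B" "bd B'"] add_mono[OF bdle[OF B(1) assms(2)] bdle[OF B(2) assms(3)]]]
        by simp
      finally have "(card (F \<union> F'), F \<union> F', (F, F'), p) \<in> T"
        using F B by (auto simp: T_def C_def P_def K_def pp)
      then show "\<exists>t\<in>T. snd (snd (snd t)) = p \<and> g p \<le> g (snd (snd (snd t)))" by force
    qed
  qed
  also have "\<dots> = (\<Sum>m=Suc d..N. \<Sum>F\<in>C m. \<Sum>p\<in>P F. \<Sum>b\<in>K \<Lambda> (fst p) \<times> K \<Lambda>' (snd p). g b)"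
    unfolding T_def
  proof (subst sum_Sigma_snd, goal_cases)
    case 2
    show ?case using finC finP CF(1) finK by (auto intro!: finite_SigmaI)
  next
    case 3
    show ?case
    proof (intro sum.cong refl, subst sum_Sigma_snd, goal_cases)
      case (2 m)
      then show ?case using finC finP CF(1) finK by (auto intro!: finite_SigmaI)
    next
      case (3 m)
      show ?case
      proof (intro sum.cong refl, subst sum_Sigma_snd, goal_cases)
        case (1 F)
        then show ?case using 3 finP CF(1) by auto
      qed (use finK in auto)
    qed (use finC in auto)
  qed auto
  also have "\<dots> \<le> (\<Sum>m=Suc d..N. \<Sum>F\<in>C m. \<Sum>p\<in>P F. c m * (Z \<beta> \<Lambda> M * Z \<beta> \<Lambda>' M))"
  proof (intro sum_mono)
    fix m F p assume m: "m \<in> {Suc d..N}" and F: "F \<in> C m" and p: "p \<in> P F"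
    obtain F1 F2 where pp: "p = (F1, F2)" by (cases p)
    have FF: "F1 \<union> F2 = F" "cocycle F1" "cocycle F2" using p pp by (auto simp: P_def)
    have fin: "finite F1" "finite F2" using CF(1)[OF F] FF(1) by auto
    have "m \<le> card F1 + card F2" using CF(2)[OF F] FF(1) card_Un_le[of F1 F2] by simp
    then have mle: "real m \<le> real (card F1) + real (card F2)" by linarith
    have "(\<Sum>b\<in>K \<Lambda> F1 \<times> K \<Lambda>' F2. g b) = (\<Sum>B\<in>K \<Lambda> F1. wt \<beta> (B \<union> M)) * (\<Sum>B\<in>K \<Lambda>' F2. wt \<beta> (B \<union> M))"
      by (simp add: g_def sum_product sum.cartesian_product)
    also have "\<dots> \<le> (exp (- 2 * \<beta> * (real (card F1) - 8 * real (card M))) * Z \<beta> \<Lambda> M) *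
                     (exp (- 2 * \<beta> * (real (card F2) - 8 * real (card M))) * Z \<beta> \<Lambda>' M)"
      unfolding K_def
      using assms fin FF Z_pos less_imp_le
      by (intro mult_mono contour_weight sum_nonneg mult_nonneg_nonneg) (auto simp: wt_pos less_imp_le Z_pos)
    also have "\<dots> = exp (- 2 * \<beta> * (real (card F1) + real (card F2) - 16 * real (card M))) * (Z \<beta> \<Lambda> M * Z \<beta> \<Lambda>' M)"
    proof -
      have "- 2 * \<beta> * (real (card F1) + real (card F2) - 16 * real (card M)) =
        - 2 * \<beta> * (real (card F1) - 8 * real (card M)) + - 2 * \<beta> * (real (card F2) - 8 * real (card M))"
        by (simp add: algebra_simps)
      then show ?thesis by (simp only: exp_add) simp
    qed
    also have "\<dots> \<le> c m * (Z \<beta> \<Lambda> M * Z \<beta> \<Lambda>' M)"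
      using mult_left_mono[OF mle assms(1)] Z_pos[OF assms(2), of \<beta> M] Z_pos[OF assms(3), of \<beta> M]
      unfolding c_def by (intro mult_right_mono) (auto simp: algebra_simps)
    finally show "(\<Sum>b\<in>K \<Lambda> (fst p) \<times> K \<Lambda>' (snd p). g b) \<le> c m * (Z \<beta> \<Lambda> M * Z \<beta> \<Lambda>' M)"
      by (simp add: pp)
  qed
  also have "\<dots> \<le> (\<Sum>m=Suc d..N. 1024 ^ m * (c m * (Z \<beta> \<Lambda> M * Z \<beta> \<Lambda>' M)))"
  proof (intro sum_mono)
    fix m assume m: "m \<in> {Suc d..N}"
    let ?z = "c m * (Z \<beta> \<Lambda> M * Z \<beta> \<Lambda>' M)"
    have z: "?z \<ge> 0" using Z_pos[OF assms(2), of \<beta> M] Z_pos[OF assms(3), of \<beta> M] by (simp add: c_def)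
    have "(\<Sum>p\<in>P F. ?z) \<le> 4 ^ m * ?z" if F: "F \<in> C m" for F
    proof -
      have "card (P F) \<le> card (Pow F \<times> Pow F)"
        using CF(1)[OF F] by (intro card_mono Psub) auto
      also have "\<dots> = 4 ^ m"
        using CF(1,2)[OF F] by (simp add: card_cartesian_product card_Pow flip: power_mult_distrib)
      finally have "real (card (P F)) \<le> 4 ^ m" by (metis of_nat_le_iff of_nat_numeral of_nat_power)
      then show ?thesis using mult_right_mono[OF _ z] by simp
    qed
    then have "(\<Sum>F\<in>C m. \<Sum>p\<in>P F. ?z) \<le> (\<Sum>F\<in>C m. 4 ^ m * ?z)" by (rule sum_mono)
    also have "\<dots> = real (card (C m)) * (4 ^ m * ?z)" by simp
    also have "\<dots> \<le> 256 ^ m * (4 ^ m * ?z)"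
    proof (intro mult_right_mono)
      have "card (C m) \<le> card (contours x m)"
        by (intro card_mono finite_contours) (auto simp: C_def)
      also have "\<dots> \<le> 256 ^ m" using m by (intro card_contours_le) auto
      finally show "real (card (C m)) \<le> 256 ^ m" by (metis of_nat_le_iff of_nat_numeral of_nat_power)
    qed (use z in auto)
    also have "\<dots> = 1024 ^ m * ?z" by (simp flip: power_mult_distrib mult.assoc)
    finally show "(\<Sum>F\<in>C m. \<Sum>p\<in>P F. ?z) \<le> 1024 ^ m * ?z" .
  qed
  finally show ?thesis
    by (intro exI[of _ N]) (simp add: g_def c_def sum_distrib_right mult.assoc)
qed

text \<open>The price per contour edge, with energy and entropy taken together.\<close>
definition small :: "real \<Rightarrow> real" where
  "small \<beta> = 1024 * exp (- 2 * \<beta>)"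

lemma peierls:
  assumes "\<beta> \<ge> 0" "small \<beta> \<le> 1 / 2" "finite \<Lambda>" "finite \<Lambda>'" "exterior_rays \<Lambda>" "exterior_rays \<Lambda>'"
    and "finite M" "\<Lambda> \<inter> M = {}" "\<Lambda>' \<inter> M = {}"
  shows "(\<Sum>(B, B')\<in>far_pairs \<Lambda> \<Lambda>' x d. wt \<beta> (B \<union> M) * wt \<beta> (B' \<union> M))
           \<le> 2 * small \<beta> ^ Suc d * exp (32 * \<beta> * real (card M)) * (Z \<beta> \<Lambda> M * Z \<beta> \<Lambda>' M)"
proof -
  obtain N where N: "(\<Sum>(B, B')\<in>far_pairs \<Lambda> \<Lambda>' x d. wt \<beta> (B \<union> M) * wt \<beta> (B' \<union> M))
           \<le> (\<Sum>m=Suc d..N. 1024 ^ m * exp (- 2 * \<beta> * (real m - 16 * real (card M)))) * (Z \<beta> \<Lambda> M * Z \<beta> \<Lambda>' M)"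
    using peierls_sum[of \<beta> \<Lambda> \<Lambda>' M x d] assms by blast
  have "1024 ^ m * exp (- 2 * \<beta> * (real m - 16 * real (card M))) =
          small \<beta> ^ m * exp (32 * \<beta> * real (card M))" for m
    by (simp add: small_def power_mult_distrib algebra_simps flip: exp_of_nat_mult exp_add)
  then have "(\<Sum>m=Suc d..N. 1024 ^ m * exp (- 2 * \<beta> * (real m - 16 * real (card M)))) =
          (\<Sum>m=Suc d..N. small \<beta> ^ m) * exp (32 * \<beta> * real (card M))"
    by (simp add: sum_distrib_right)
  also have "\<dots> \<le> 2 * small \<beta> ^ Suc d * exp (32 * \<beta> * real (card M))"
    using assms(2) by (intro mult_right_mono sum_powers_le) (auto simp: small_def)
  finally have "(\<Sum>m=Suc d..N. 1024 ^ m * exp (- 2 * \<beta> * (real m - 16 * real (card M)))) * (Z \<beta> \<Lambda> M * Z \<beta> \<Lambda>' M)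
     \<le> 2 * small \<beta> ^ Suc d * exp (32 * \<beta> * real (card M)) * (Z \<beta> \<Lambda> M * Z \<beta> \<Lambda>' M)"
    using Z_pos[OF assms(3), of \<beta> M] Z_pos[OF assms(4), of \<beta> M] by (intro mult_right_mono) auto
  with N show ?thesis by linarith
qed

section \<open>Swapping disagreement clusters\<close>

text \<open>Expectation with respect to the Gibbs measure in \<open>\<Lambda>\<close> with minus spins on \<open>M\<close>.\<close>
definition mean :: "real \<Rightarrow> site set \<Rightarrow> site set \<Rightarrow> (site set \<Rightarrow> real) \<Rightarrow> real" where
  "mean \<beta> \<Lambda> M f = (\<Sum>B\<in>Pow \<Lambda>. f B * wt \<beta> (B \<union> M)) / Z \<beta> \<Lambda> M"

text \<open>The connected part of the disagreement set of two configurations that hangs on \<open>X\<close>.\<close>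
definition cluster :: "site set \<Rightarrow> site set \<Rightarrow> site set \<Rightarrow> site set" where
  "cluster X B B' = (link (sym_diff B B'))\<^sup>* `` (X \<inter> sym_diff B B')"

definition swap :: "site set \<Rightarrow> site set \<times> site set \<Rightarrow> site set \<times> site set" where
  "swap X = (\<lambda>(B, B'). let C = cluster X B B' in (B - C \<union> B' \<inter> C, B' - C \<union> B \<inter> C))"

lemma cluster_subset: "cluster X B B' \<subseteq> sym_diff B B'"
  unfolding cluster_def using link_rtrancl_in by blast

lemma cluster_closed:
  assumes "u \<in> cluster X B B'" "nn u v" "v \<in> sym_diff B B'"
  shows "v \<in> cluster X B B'"
proof -
  have "u \<in> sym_diff B B'" using assms(1) cluster_subset by blast
  then have "(u, v) \<in> link (sym_diff B B')" using assms(2,3) by (simp add: link_def)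
  with assms(1) show ?thesis unfolding cluster_def by (meson Image_iff rtrancl_into_rtrancl)
qed

lemma seed_in_cluster: "x \<in> X \<Longrightarrow> x \<in> sym_diff B B' \<Longrightarrow> x \<in> cluster X B B'"
  unfolding cluster_def by blast

lemma sym_diff_swap:
  "swap X (B, B') = (B1, B1') \<Longrightarrow> sym_diff B1 B1' = sym_diff B B'"
  using cluster_subset[of X B B'] by (auto simp: swap_def Let_def)

lemma cluster_swap:
  "swap X (B, B') = (B1, B1') \<Longrightarrow> cluster X B1 B1' = cluster X B B'"
  using sym_diff_swap[of X B B' B1 B1'] by (simp add: cluster_def)

lemma swap_swap: "swap X (swap X p) = p"
proof -
  obtain B B' where p: "p = (B, B')" by (cases p)
  obtain B1 B1' where s: "swap X (B, B') = (B1, B1')" by (cases "swap X (B, B')")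
  have "swap X (B1, B1') = (B, B')"
    using s cluster_swap[OF s] cluster_subset[of X B B'] by (auto simp: swap_def Let_def)
  then show ?thesis using p s by simp
qed

text \<open>Two configurations that agree just outside \<open>C\<close> may exchange their restrictions to \<open>C\<close>
  without changing the total number of broken bonds.\<close>
lemma card_bd_swap:
  assumes "finite A" "finite A'" "\<And>u v. nn u v \<Longrightarrow> u \<in> C \<Longrightarrow> v \<notin> C \<Longrightarrow> v \<in> A \<longleftrightarrow> v \<in> A'"
  shows "card (bd (A - C \<union> A' \<inter> C)) + card (bd (A' - C \<union> A \<inter> C)) = card (bd A) + card (bd A')"
proof -
  define I where "I = inc C"
  have agree: "tip e \<in> A \<longleftrightarrow> tip e \<in> A'" if "fst e \<in> C" "tip e \<notin> C" for e
    using assms(3)[OF _ that] nn_iff_edge by blast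
  have agree': "fst e \<in> A \<longleftrightarrow> fst e \<in> A'" if "tip e \<in> C" "fst e \<notin> C" for e
    using assms(3)[OF _ that] nn_iff_edge by blast
  have eq: "bd (A - C \<union> A' \<inter> C) = (bd A' \<inter> I) \<union> (bd A - I)" if
    "\<And>e. fst e \<in> C \<Longrightarrow> tip e \<notin> C \<Longrightarrow> tip e \<in> A \<longleftrightarrow> tip e \<in> A'"
    "\<And>e. tip e \<in> C \<Longrightarrow> fst e \<notin> C \<Longrightarrow> fst e \<in> A \<longleftrightarrow> fst e \<in> A'" for A A'
  proof (intro set_eqI)
    fix e
    show "e \<in> bd (A - C \<union> A' \<inter> C) \<longleftrightarrow> e \<in> (bd A' \<inter> I) \<union> (bd A - I)"
      using that[of e] by (cases "fst e \<in> C"; cases "tip e \<in> C") (simp_all add: bd_def I_def inc_def)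
  qed
  have card: "card ((X \<inter> I) \<union> (Y - I)) = card (X \<inter> I) + card (Y - I)" if "finite X" "finite Y" for X Y
    using that by (intro card_Un_disjoint) auto
  have split: "card X = card (X \<inter> I) + card (X - I)" if "finite X" for X
    using card[OF that that] by (simp add: Int_Diff_Un)
  have "card (bd (A - C \<union> A' \<inter> C)) = card (bd A' \<inter> I) + card (bd A - I)"
    using eq[of A A'] agree agree' card assms(1,2) by simp
  moreover have "card (bd (A' - C \<union> A \<inter> C)) = card (bd A \<inter> I) + card (bd A' - I)"
    using eq[of A' A] agree agree' card assms(1,2) by simp
  ultimately show ?thesis using split[of "bd A"] split[of "bd A'"] assms(1,2) by simp
qed

lemma wt_swap:
  assumes "finite B" "finite B'" "finite M" "swap X (B, B') = (B1, B1')"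
  shows "wt \<beta> (B1 \<union> M) * wt \<beta> (B1' \<union> M) = wt \<beta> (B \<union> M) * wt \<beta> (B' \<union> M)"
proof -
  let ?C = "cluster X B B'"
  have "card (bd (B \<union> M - ?C \<union> (B' \<union> M) \<inter> ?C)) + card (bd (B' \<union> M - ?C \<union> (B \<union> M) \<inter> ?C)) =
        card (bd (B \<union> M)) + card (bd (B' \<union> M))"
  proof (rule card_bd_swap)
    fix u v assume "nn u v" "u \<in> ?C" "v \<notin> ?C"
    then have "v \<notin> sym_diff B B'" using cluster_closed by blast
    then show "v \<in> B \<union> M \<longleftrightarrow> v \<in> B' \<union> M" by blast
  qed (use assms in auto)
  moreover have "B1 \<union> M = B \<union> M - ?C \<union> (B' \<union> M) \<inter> ?C" "B1' \<union> M = B' \<union> M - ?C \<union> (B \<union> M) \<inter> ?C"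
    using assms(4) by (auto simp: swap_def Let_def)
  ultimately have "card (bd (B1 \<union> M)) + card (bd (B1' \<union> M)) = card (bd (B \<union> M)) + card (bd (B' \<union> M))"
    by simp
  then have "real (card (bd (B1 \<union> M))) + real (card (bd (B1' \<union> M))) =
             real (card (bd (B \<union> M))) + real (card (bd (B' \<union> M)))" by linarith
  then show ?thesis unfolding wt_def exp_add[symmetric] distrib_left[symmetric] by (simp only:)
qed

text \<open>The swap is an involution that preserves the joint weight, so observables which it turns
  into their negatives have mean zero.\<close>
lemma swap_sum_eq_0:
  fixes h :: "site set \<times> site set \<Rightarrow> real"
  assumes "finite \<Lambda>" "finite \<Lambda>'" "finite M" "G \<subseteq> Pow \<Lambda> \<times> Pow \<Lambda>'"
    and "\<And>p. p \<in> G \<Longrightarrow> swap X p \<in> G" "\<And>p. p \<in> G \<Longrightarrow> h (swap X p) = - h p"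
  shows "(\<Sum>p\<in>G. h p * (wt \<beta> (fst p \<union> M) * wt \<beta> (snd p \<union> M))) = 0"
proof -
  let ?W = "\<lambda>p. wt \<beta> (fst p \<union> M) * wt \<beta> (snd p \<union> M)"
  have "(\<Sum>p\<in>G. h p * ?W p) = (\<Sum>p\<in>G. h (swap X p) * ?W (swap X p))"
    by (rule sum.reindex_bij_witness[of _ "swap X" "swap X"]) (auto simp: swap_swap assms(5))
  also have "\<dots> = (\<Sum>p\<in>G. - (h p * ?W p))"
  proof (rule sum.cong[OF refl])
    fix p assume p: "p \<in> G"
    obtain B B' where pp: "p = (B, B')" by (cases p)
    obtain B1 B1' where s: "swap X (B, B') = (B1, B1')" by (cases "swap X (B, B')")
    have "B \<subseteq> \<Lambda>" "B' \<subseteq> \<Lambda>'" using p pp assms(4) by auto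
    then have "finite B" "finite B'" using assms(1,2) by (auto intro: finite_subset)
    then have "?W (swap X p) = ?W p" using wt_swap[OF _ _ assms(3) s] pp s by simp
    then show "h (swap X p) * ?W (swap X p) = - (h p * ?W p)" using assms(6)[OF p] by simp
  qed
  finally show ?thesis by (simp add: sum_negf)
qed

lemma cluster_far:
  assumes "B \<subseteq> \<Lambda>" "B' \<subseteq> \<Lambda>'" "y \<in> cluster X B B'"
    and far: "\<And>x. x \<in> X \<inter> (\<Lambda> \<union> \<Lambda>') \<Longrightarrow> int d \<le> \<bar>fst y - fst x\<bar> \<or> int d \<le> \<bar>snd y - snd x\<bar>"
  shows "(B, B') \<in> (\<Union>x\<in>X. far_pairs \<Lambda> \<Lambda>' x d)"
proof -
  obtain x where x: "x \<in> X" "x \<in> sym_diff B B'" "(x, y) \<in> (link (sym_diff B B'))\<^sup>*"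
    using assms(3) unfolding cluster_def by blast
  have "link (sym_diff B B') \<subseteq> link (B \<union> B')" by (auto simp: link_def)
  then have "(x, y) \<in> (link (B \<union> B'))\<^sup>*" using x(3) rtrancl_mono by blast
  moreover have "x \<in> B \<union> B'" using x(2) by blast
  moreover have "int d \<le> \<bar>fst y - fst x\<bar> \<or> int d \<le> \<bar>snd y - snd x\<bar>"
    using far x(1) calculation(2) assms(1,2) by blast
  ultimately show ?thesis using x(1) assms(1,2) unfolding far_pairs_def by blast
qed

text \<open>On \<open>G\<close> the contributions cancel by the swap. Outside \<open>G\<close> some site of \<open>X\<close> is connected to a
  far site by disagreements; where two copies disagree one of them is minus, so that the
  Peierls estimate applies.\<close>
lemma swap_bound:
  fixes h :: "site set \<times> site set \<Rightarrow> real"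
  assumes \<beta>: "\<beta> \<ge> 0" "small \<beta> \<le> 1 / 2" and fin: "finite \<Lambda>" "finite \<Lambda>'" "exterior_rays \<Lambda>" "exterior_rays \<Lambda>'"
    and M: "finite M" "\<Lambda> \<inter> M = {}" "\<Lambda>' \<inter> M = {}" and X: "finite X"
    and G: "G \<subseteq> Pow \<Lambda> \<times> Pow \<Lambda>'" "\<And>p. p \<in> G \<Longrightarrow> swap X p \<in> G" "\<And>p. p \<in> G \<Longrightarrow> h (swap X p) = - h p"
    and K: "\<And>p. p \<in> Pow \<Lambda> \<times> Pow \<Lambda>' \<Longrightarrow> \<bar>h p\<bar> \<le> K" "K \<ge> 0"
    and far: "Pow \<Lambda> \<times> Pow \<Lambda>' - G \<subseteq> (\<Union>x\<in>X. far_pairs \<Lambda> \<Lambda>' x d)"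
  shows "\<bar>\<Sum>p\<in>Pow \<Lambda> \<times> Pow \<Lambda>'. h p * (wt \<beta> (fst p \<union> M) * wt \<beta> (snd p \<union> M))\<bar>
           \<le> K * real (card X) * (2 * small \<beta> ^ Suc d * exp (32 * \<beta> * real (card M))) * (Z \<beta> \<Lambda> M * Z \<beta> \<Lambda>' M)"
proof -
  let ?W = "\<lambda>p. wt \<beta> (fst p \<union> M) * wt \<beta> (snd p \<union> M)"
  let ?A = "Pow \<Lambda> \<times> Pow \<Lambda>'" and ?F = "\<Union>x\<in>X. far_pairs \<Lambda> \<Lambda>' x d"
  have finA: "finite ?A" using fin by simp
  have W0: "?W p \<ge> 0" for p by (simp add: wt_pos less_imp_le)
  have sub: "far_pairs \<Lambda> \<Lambda>' x d \<subseteq> ?A" for x by (auto simp: far_pairs_def)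
  then have finfar: "finite (far_pairs \<Lambda> \<Lambda>' x d)" for x by (rule finite_subset[OF _ finA])
  have "(\<Sum>p\<in>?A. h p * ?W p) = (\<Sum>p\<in>?A - G. h p * ?W p) + (\<Sum>p\<in>G. h p * ?W p)"
    by (rule sum.subset_diff[OF G(1) finA])
  also have "(\<Sum>p\<in>G. h p * ?W p) = 0"
    by (rule swap_sum_eq_0[where h = h and X = X and G = G, OF fin(1,2) M(1) G])
  finally have "\<bar>\<Sum>p\<in>?A. h p * ?W p\<bar> = \<bar>\<Sum>p\<in>?A - G. h p * ?W p\<bar>" by simp
  also have "\<dots> \<le> (\<Sum>p\<in>?A - G. \<bar>h p * ?W p\<bar>)" by (rule sum_abs)
  also have "\<dots> \<le> (\<Sum>p\<in>?A - G. K * ?W p)"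
  proof (rule sum_mono)
    fix p assume "p \<in> ?A - G"
    then have "\<bar>h p\<bar> * ?W p \<le> K * ?W p" using K(1)[of p] W0 by (intro mult_right_mono) auto
    then show "\<bar>h p * ?W p\<bar> \<le> K * ?W p" by (simp only: abs_mult[of _ "?W p"] abs_of_nonneg[OF W0])
  qed
  also have "\<dots> \<le> (\<Sum>p\<in>?F. K * ?W p)"
    using far W0 K(2) X finfar by (intro sum_mono2) auto
  also have "\<dots> \<le> (\<Sum>x\<in>X. \<Sum>p\<in>far_pairs \<Lambda> \<Lambda>' x d. K * ?W p)"
  proof -
    have "(\<Sum>p\<in>?F. K * ?W p) \<le> (\<Sum>t\<in>(SIGMA x:X. far_pairs \<Lambda> \<Lambda>' x d). K * ?W (snd t))"
      using X finfar W0 K(2)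
      by (intro sum_le_included[where i = snd]) (auto intro!: mult_nonneg_nonneg)
    also have "\<dots> = (\<Sum>x\<in>X. \<Sum>p\<in>far_pairs \<Lambda> \<Lambda>' x d. K * ?W p)"
      by (rule sum_Sigma_snd[OF X finfar])
    finally show ?thesis .
  qed
  also have "\<dots> \<le> (\<Sum>x\<in>X. K * (2 * small \<beta> ^ Suc d * exp (32 * \<beta> * real (card M)) * (Z \<beta> \<Lambda> M * Z \<beta> \<Lambda>' M)))"
  proof (rule sum_mono)
    fix x assume "x \<in> X"
    have "(\<Sum>p\<in>far_pairs \<Lambda> \<Lambda>' x d. ?W p) \<le> 2 * small \<beta> ^ Suc d * exp (32 * \<beta> * real (card M)) * (Z \<beta> \<Lambda> M * Z \<beta> \<Lambda>' M)"
      using peierls[OF \<beta> fin M, of x d] by (simp add: split_def)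
    then show "(\<Sum>p\<in>far_pairs \<Lambda> \<Lambda>' x d. K * ?W p) \<le> K * (2 * small \<beta> ^ Suc d * exp (32 * \<beta> * real (card M)) * (Z \<beta> \<Lambda> M * Z \<beta> \<Lambda>' M))"
      using K(2) by (simp add: mult_left_mono flip: sum_distrib_left)
  qed
  also have "\<dots> = K * real (card X) * (2 * small \<beta> ^ Suc d * exp (32 * \<beta> * real (card M))) * (Z \<beta> \<Lambda> M * Z \<beta> \<Lambda>' M)"
    by simp
  finally show ?thesis .
qed

lemma double_sum:
  fixes f g :: "site set \<Rightarrow> real"
  shows "(\<Sum>p\<in>Pow \<Lambda> \<times> Pow \<Lambda>'. f (fst p) * g (snd p) * (wt \<beta> (fst p \<union> M) * wt \<beta> (snd p \<union> M)))
    = (\<Sum>B\<in>Pow \<Lambda>. f B * wt \<beta> (B \<union> M)) * (\<Sum>B\<in>Pow \<Lambda>'. g B * wt \<beta> (B \<union> M))"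
  by (simp add: sum_product sum.cartesian_product split_def mult_ac)

lemma Z_mean: "finite \<Lambda> \<Longrightarrow> (\<Sum>B\<in>Pow \<Lambda>. f B * wt \<beta> (B \<union> M)) = mean \<beta> \<Lambda> M f * Z \<beta> \<Lambda> M"
  using Z_pos[of \<Lambda> \<beta> M] by (simp add: mean_def)

lemma Z_mean_1: "(\<Sum>B\<in>Pow \<Lambda>. 1 * wt \<beta> (B \<union> M)) = Z \<beta> \<Lambda> M"
  by (simp add: Z_def)

text \<open>Two copies, one in each volume. As long as the disagreement cluster of \<open>X\<close> stays in both
  volumes, the copies may be swapped on it, which exchanges the two values of \<open>f\<close>. Otherwise
  the cluster reaches a site that belongs to only one of the volumes.\<close>
theorem volume_comparison:
  assumes \<beta>: "\<beta> \<ge> 0" "small \<beta> \<le> 1 / 2" and fin: "finite \<Lambda>" "finite \<Lambda>'" "exterior_rays \<Lambda>" "exterior_rays \<Lambda>'"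
    and M: "finite M" "\<Lambda> \<inter> M = {}" "\<Lambda>' \<inter> M = {}" and X: "finite X"
    and f: "\<And>B. f B = f (B \<inter> X)" "\<And>B. B \<subseteq> \<Lambda> \<union> \<Lambda>' \<Longrightarrow> 0 \<le> f B \<and> f B \<le> K"
    and far: "\<And>x y. x \<in> X \<inter> (\<Lambda> \<union> \<Lambda>') \<Longrightarrow> y \<in> sym_diff \<Lambda> \<Lambda>' \<Longrightarrow>
                int d \<le> \<bar>fst y - fst x\<bar> \<or> int d \<le> \<bar>snd y - snd x\<bar>"
  shows "\<bar>mean \<beta> \<Lambda> M f - mean \<beta> \<Lambda>' M f\<bar> \<le> K * real (card X) * (2 * small \<beta> ^ Suc d * exp (32 * \<beta> * real (card M)))"
proof -
  let ?h = "\<lambda>p. f (fst p) - f (snd p)" and ?W = "\<lambda>p. wt \<beta> (fst p \<union> M) * wt \<beta> (snd p \<union> M)"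
  let ?b = "K * real (card X) * (2 * small \<beta> ^ Suc d * exp (32 * \<beta> * real (card M)))"
  define G where "G = {(B, B'). B \<subseteq> \<Lambda> \<and> B' \<subseteq> \<Lambda>' \<and> cluster X B B' \<subseteq> \<Lambda> \<inter> \<Lambda>'}"
  have "\<bar>\<Sum>p\<in>Pow \<Lambda> \<times> Pow \<Lambda>'. ?h p * ?W p\<bar> \<le> ?b * (Z \<beta> \<Lambda> M * Z \<beta> \<Lambda>' M)"
  proof (rule swap_bound[OF \<beta> fin M X])
    show "G \<subseteq> Pow \<Lambda> \<times> Pow \<Lambda>'" by (auto simp: G_def)
    have "swap X p \<in> G \<and> ?h (swap X p) = - ?h p" if "p \<in> G" for p
    proof -
      obtain B B' where p: "p = (B, B')" by (cases p)
      obtain B1 B1' where s: "swap X (B, B') = (B1, B1')" by (cases "swap X (B, B')")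
      have B: "B1 = B - cluster X B B' \<union> B' \<inter> cluster X B B'" "B1' = B' - cluster X B B' \<union> B \<inter> cluster X B B'"
        using s by (auto simp: swap_def Let_def)
      have "(B1, B1') \<in> G" using that p B cluster_swap[OF s] by (auto simp: G_def)
      moreover have "B1 \<inter> X = B' \<inter> X" "B1' \<inter> X = B \<inter> X"
        using B seed_in_cluster[of _ X B B'] cluster_subset[of X B B'] by blast+
      ultimately show ?thesis using f(1)[of B] f(1)[of B'] f(1)[of B1] f(1)[of B1'] p s by simp
    qed
    then show "\<And>p. p \<in> G \<Longrightarrow> swap X p \<in> G" "\<And>p. p \<in> G \<Longrightarrow> ?h (swap X p) = - ?h p" by blast+
    show "\<bar>?h p\<bar> \<le> K" if "p \<in> Pow \<Lambda> \<times> Pow \<Lambda>'" for p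
    proof -
      have "fst p \<subseteq> \<Lambda> \<union> \<Lambda>'" "snd p \<subseteq> \<Lambda> \<union> \<Lambda>'" using that by auto
      then show ?thesis using f(2)[of "fst p"] f(2)[of "snd p"] by auto
    qed
    show "K \<ge> 0" using f(2)[of "{}"] by simp
    show "Pow \<Lambda> \<times> Pow \<Lambda>' - G \<subseteq> (\<Union>x\<in>X. far_pairs \<Lambda> \<Lambda>' x d)"
    proof
      fix p assume p: "p \<in> Pow \<Lambda> \<times> Pow \<Lambda>' - G"
      obtain B B' where pp: "p = (B, B')" by (cases p)
      with p obtain y where y: "y \<in> cluster X B B'" "y \<notin> \<Lambda> \<inter> \<Lambda>'" and B: "B \<subseteq> \<Lambda>" "B' \<subseteq> \<Lambda>'"
        by (auto simp: G_def)
      have "y \<in> sym_diff \<Lambda> \<Lambda>'" using y B cluster_subset[of X B B'] by blast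
      then show "p \<in> (\<Union>x\<in>X. far_pairs \<Lambda> \<Lambda>' x d)"
        using cluster_far[OF B y(1)] far pp by blast
    qed
  qed
  moreover have "(\<Sum>p\<in>Pow \<Lambda> \<times> Pow \<Lambda>'. ?h p * ?W p) = (mean \<beta> \<Lambda> M f - mean \<beta> \<Lambda>' M f) * (Z \<beta> \<Lambda> M * Z \<beta> \<Lambda>' M)"
  proof -
    have "(\<Sum>p\<in>Pow \<Lambda> \<times> Pow \<Lambda>'. ?h p * ?W p) =
       (\<Sum>p\<in>Pow \<Lambda> \<times> Pow \<Lambda>'. f (fst p) * 1 * ?W p) - (\<Sum>p\<in>Pow \<Lambda> \<times> Pow \<Lambda>'. 1 * f (snd p) * ?W p)"
      unfolding sum_subtractf[symmetric] by (intro sum.cong refl) (simp add: algebra_simps)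
    also have "\<dots> = (mean \<beta> \<Lambda> M f - mean \<beta> \<Lambda>' M f) * (Z \<beta> \<Lambda> M * Z \<beta> \<Lambda>' M)"
      unfolding double_sum[where f = f and g = "\<lambda>_. 1"] double_sum[where g = f and f = "\<lambda>_. 1"]
        Z_mean[OF fin(1), of f] Z_mean[OF fin(2), of f] Z_mean_1
      by (simp add: algebra_simps)
    finally show ?thesis .
  qed
  moreover have pos: "Z \<beta> \<Lambda> M * Z \<beta> \<Lambda>' M > 0" using Z_pos fin by simp
  ultimately have "\<bar>mean \<beta> \<Lambda> M f - mean \<beta> \<Lambda>' M f\<bar> * (Z \<beta> \<Lambda> M * Z \<beta> \<Lambda>' M) \<le> ?b * (Z \<beta> \<Lambda> M * Z \<beta> \<Lambda>' M)"
    by (simp only: abs_mult[of _ "Z \<beta> \<Lambda> M * Z \<beta> \<Lambda>' M"] abs_of_pos)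
  then show ?thesis using pos by (rule mult_right_le_imp_le)
qed

text \<open>The covariance is half the mean of \<open>(f B - f B') * (g B - g B')\<close> over two independent
  copies. If the disagreement cluster of \<open>X\<close> misses \<open>Y\<close>, the swap changes the sign of the
  first factor only. Hence only pairs in which \<open>X\<close> and \<open>Y\<close> are joined by a path of
  disagreements contribute.\<close>
theorem covariance_bound:
  assumes \<beta>: "\<beta> \<ge> 0" "small \<beta> \<le> 1 / 2" and fin: "finite \<Lambda>" "exterior_rays \<Lambda>"
    and M: "finite M" "\<Lambda> \<inter> M = {}" and X: "finite X"
    and f: "\<And>B. f B = f (B \<inter> X)" "\<And>B. B \<subseteq> \<Lambda> \<Longrightarrow> 0 \<le> f B \<and> f B \<le> K"
    and g: "\<And>B. g B = g (B \<inter> Y)" "\<And>B. B \<subseteq> \<Lambda> \<Longrightarrow> 0 \<le> g B \<and> g B \<le> K"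
    and far: "\<And>x y. x \<in> X \<inter> \<Lambda> \<Longrightarrow> y \<in> Y \<inter> \<Lambda> \<Longrightarrow> int d \<le> \<bar>fst y - fst x\<bar> \<or> int d \<le> \<bar>snd y - snd x\<bar>"
  shows "\<bar>mean \<beta> \<Lambda> M (\<lambda>B. f B * g B) - mean \<beta> \<Lambda> M f * mean \<beta> \<Lambda> M g\<bar>
           \<le> K ^ 2 * real (card X) * (small \<beta> ^ Suc d * exp (32 * \<beta> * real (card M)))"
proof -
  let ?h = "\<lambda>p. (f (fst p) - f (snd p)) * (g (fst p) - g (snd p))"
  let ?W = "\<lambda>p. wt \<beta> (fst p \<union> M) * wt \<beta> (snd p \<union> M)"
  let ?b = "K ^ 2 * real (card X) * (2 * small \<beta> ^ Suc d * exp (32 * \<beta> * real (card M)))"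
  define G where "G = {(B, B'). B \<subseteq> \<Lambda> \<and> B' \<subseteq> \<Lambda> \<and> cluster X B B' \<inter> Y = {}}"
  have "\<bar>\<Sum>p\<in>Pow \<Lambda> \<times> Pow \<Lambda>. ?h p * ?W p\<bar> \<le> ?b * (Z \<beta> \<Lambda> M * Z \<beta> \<Lambda> M)"
  proof (rule swap_bound[OF \<beta> fin(1,1,2,2) M M(2) X])
    show "G \<subseteq> Pow \<Lambda> \<times> Pow \<Lambda>" by (auto simp: G_def)
    have "swap X p \<in> G \<and> ?h (swap X p) = - ?h p" if "p \<in> G" for p
    proof -
      obtain B B' where p: "p = (B, B')" by (cases p)
      obtain B1 B1' where s: "swap X (B, B') = (B1, B1')" by (cases "swap X (B, B')")
      have B: "B1 = B - cluster X B B' \<union> B' \<inter> cluster X B B'" "B1' = B' - cluster X B B' \<union> B \<inter> cluster X B B'"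
        using s by (auto simp: swap_def Let_def)
      have "(B1, B1') \<in> G" using that p B cluster_swap[OF s] by (auto simp: G_def)
      moreover have "B1 \<inter> X = B' \<inter> X" "B1' \<inter> X = B \<inter> X"
        using B seed_in_cluster[of _ X B B'] cluster_subset[of X B B'] by blast+
      moreover have "B1 \<inter> Y = B \<inter> Y" "B1' \<inter> Y = B' \<inter> Y"
        using B that p unfolding G_def by blast+
      ultimately show ?thesis
        using f(1)[of B] f(1)[of B'] f(1)[of B1] f(1)[of B1'] g(1)[of B] g(1)[of B'] g(1)[of B1] g(1)[of B1'] p s
        by (simp add: algebra_simps)
    qed
    then show "\<And>p. p \<in> G \<Longrightarrow> swap X p \<in> G" "\<And>p. p \<in> G \<Longrightarrow> ?h (swap X p) = - ?h p" by blast+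
    show "\<bar>?h p\<bar> \<le> K ^ 2" if "p \<in> Pow \<Lambda> \<times> Pow \<Lambda>" for p
    proof -
      have "\<bar>f (fst p) - f (snd p)\<bar> \<le> K" "\<bar>g (fst p) - g (snd p)\<bar> \<le> K"
        using f(2)[of "fst p"] f(2)[of "snd p"] g(2)[of "fst p"] g(2)[of "snd p"] that by auto
      then show ?thesis unfolding abs_mult power2_eq_square by (intro mult_mono) auto
    qed
    show "Pow \<Lambda> \<times> Pow \<Lambda> - G \<subseteq> (\<Union>x\<in>X. far_pairs \<Lambda> \<Lambda> x d)"
    proof
      fix p assume p: "p \<in> Pow \<Lambda> \<times> Pow \<Lambda> - G"
      obtain B B' where pp: "p = (B, B')" by (cases p)
      with p obtain y where y: "y \<in> cluster X B B'" "y \<in> Y" and B: "B \<subseteq> \<Lambda>" "B' \<subseteq> \<Lambda>"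
        by (auto simp: G_def)
      have "y \<in> Y \<inter> \<Lambda>" using y B cluster_subset[of X B B'] by blast
      then show "p \<in> (\<Union>x\<in>X. far_pairs \<Lambda> \<Lambda> x d)"
        using cluster_far[OF B y(1)] far pp by simp
    qed
  qed simp
  moreover have "(\<Sum>p\<in>Pow \<Lambda> \<times> Pow \<Lambda>. ?h p * ?W p) =
     2 * (mean \<beta> \<Lambda> M (\<lambda>B. f B * g B) - mean \<beta> \<Lambda> M f * mean \<beta> \<Lambda> M g) * (Z \<beta> \<Lambda> M * Z \<beta> \<Lambda> M)"
  proof -
    have "(\<Sum>p\<in>Pow \<Lambda> \<times> Pow \<Lambda>. ?h p * ?W p) =
       (\<Sum>p\<in>Pow \<Lambda> \<times> Pow \<Lambda>. (f (fst p) * g (fst p)) * 1 * ?W p) + (\<Sum>p\<in>Pow \<Lambda> \<times> Pow \<Lambda>. 1 * (f (snd p) * g (snd p)) * ?W p)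
       - (\<Sum>p\<in>Pow \<Lambda> \<times> Pow \<Lambda>. f (fst p) * g (snd p) * ?W p) - (\<Sum>p\<in>Pow \<Lambda> \<times> Pow \<Lambda>. g (fst p) * f (snd p) * ?W p)"
      unfolding sum.distrib[symmetric] sum_subtractf[symmetric]
      by (intro sum.cong refl) (simp add: algebra_simps)
    also have "\<dots> = 2 * (mean \<beta> \<Lambda> M (\<lambda>B. f B * g B) - mean \<beta> \<Lambda> M f * mean \<beta> \<Lambda> M g) * (Z \<beta> \<Lambda> M * Z \<beta> \<Lambda> M)"
    proof -
      note m = Z_mean[OF fin(1), of _ \<beta> M]
      have fg: "(\<Sum>B\<in>Pow \<Lambda>. f B * g B * wt \<beta> (B \<union> M)) = mean \<beta> \<Lambda> M (\<lambda>B. f B * g B) * Z \<beta> \<Lambda> M"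
        by (rule m)
      show ?thesis
        unfolding double_sum[where f = "\<lambda>B. f B * g B" and g = "\<lambda>_. 1"]
          double_sum[where g = "\<lambda>B. f B * g B" and f = "\<lambda>_. 1"]
          double_sum[where f = f and g = g] double_sum[where f = g and g = f]
          fg m[of f] m[of g] Z_mean_1
        by (simp add: algebra_simps)
    qed
    finally show ?thesis .
  qed
  moreover have pos: "Z \<beta> \<Lambda> M * Z \<beta> \<Lambda> M > 0" using Z_pos fin by simp
  ultimately have "\<bar>2 * (mean \<beta> \<Lambda> M (\<lambda>B. f B * g B) - mean \<beta> \<Lambda> M f * mean \<beta> \<Lambda> M g)\<bar> * (Z \<beta> \<Lambda> M * Z \<beta> \<Lambda> M)
      \<le> ?b * (Z \<beta> \<Lambda> M * Z \<beta> \<Lambda> M)"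
    by (simp only: abs_mult[of _ "Z \<beta> \<Lambda> M * Z \<beta> \<Lambda> M"] abs_of_pos)
  then have "\<bar>2 * (mean \<beta> \<Lambda> M (\<lambda>B. f B * g B) - mean \<beta> \<Lambda> M f * mean \<beta> \<Lambda> M g)\<bar> \<le> ?b"
    using pos by (rule mult_right_le_imp_le)
  then have "2 * \<bar>mean \<beta> \<Lambda> M (\<lambda>B. f B * g B) - mean \<beta> \<Lambda> M f * mean \<beta> \<Lambda> M g\<bar> \<le> ?b"
    by (simp only: abs_mult abs_numeral)
  then show ?thesis by simp
qed

section \<open>The partition function with minus spins on the layer\<close>

text \<open>With all spins of the layer prescribed, the free spins are those of the box off the layer.
  The centre \<open>a\<close> is needed for translation invariance.\<close>
definition strip :: "int \<Rightarrow> nat \<Rightarrow> site set" where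
  "strip a n = {a - int n..a + int n} \<times> {- int n..int n} - {z. snd z = 0}"

definition lay :: "int set \<Rightarrow> site set" where
  "lay M = (\<lambda>i. (i, 0)) ` M"

text \<open>The factor by which the weight changes when the spins of \<open>M\<close> become minus. It is written
  with the edges at \<open>M\<close> only, which makes it a local observable also for infinite \<open>A\<close>, where
  weights make no sense.\<close>
definition gain :: "real \<Rightarrow> site set \<Rightarrow> site set \<Rightarrow> real" where
  "gain \<beta> M A = exp (- 2 * \<beta> * (real (card (bd (A \<union> M) \<inter> inc M)) - real (card (bd A \<inter> inc M))))"

definition nbhd :: "site set \<Rightarrow> site set" where
  "nbhd M = fst ` inc M \<union> tip ` inc M"

lemma finite_strip [simp]: "finite (strip a n)"
  by (simp add: strip_def)

lemma finite_lay [simp]: "finite M \<Longrightarrow> finite (lay M)"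
  by (simp add: lay_def)

lemma card_lay [simp]: "card (lay M) = card M"
  unfolding lay_def by (rule card_image) (auto simp: inj_on_def)

lemma lay_empty [simp]: "lay {} = {}"
  by (simp add: lay_def)

lemma lay_insert: "lay (insert p M) = lay M \<union> lay {p}"
  by (auto simp: lay_def)

lemma strip_Int_lay [simp]: "strip a n \<inter> lay M = {}"
  by (auto simp: strip_def lay_def)

lemma exterior_rays_strip: "exterior_rays (strip a n)"
  unfolding exterior_rays_def
proof (intro allI impI)
  fix z :: site assume "z \<notin> strip a n"
  then consider "snd z = 0" | "fst z > a + int n" | "fst z < a - int n" | "snd z > int n" | "snd z < - int n"
    by (cases z) (force simp: strip_def)
  then show "\<exists>v\<in>units. \<forall>t. ray z v t \<notin> strip a n"
  proof cases
    case 1 then show ?thesis by (intro bexI[of _ "(1, 0)"]) (auto simp: strip_def ray_def units_def)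
  next
    case 2 then show ?thesis by (intro bexI[of _ "(1, 0)"]) (auto simp: strip_def ray_def units_def)
  next
    case 3 then show ?thesis by (intro bexI[of _ "(-1, 0)"]) (auto simp: strip_def ray_def units_def)
  next
    case 4 then show ?thesis by (intro bexI[of _ "(0, 1)"]) (auto simp: strip_def ray_def units_def)
  next
    case 5 then show ?thesis by (intro bexI[of _ "(0, -1)"]) (auto simp: strip_def ray_def units_def)
  qed
qed

lemma finite_nbhd: "finite M \<Longrightarrow> finite (nbhd M)"
  by (simp add: nbhd_def)

lemma card_nbhd_le: "finite M \<Longrightarrow> card (nbhd M) \<le> 8 * card M"
proof -
  assume M: "finite M"
  have "card (nbhd M) \<le> card (fst ` inc M) + card (tip ` inc M)"
    unfolding nbhd_def by (rule card_Un_le)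
  also have "\<dots> \<le> card (inc M) + card (inc M)"
    using M by (intro add_mono card_image_le) auto
  also have "\<dots> \<le> 8 * card M" using card_inc_le[OF M] by simp
  finally show ?thesis .
qed

lemma nbhd_near:
  assumes "x \<in> nbhd M"
  shows "\<exists>p\<in>M. \<bar>fst x - fst p\<bar> \<le> 1 \<and> \<bar>snd x - snd p\<bar> \<le> 1"
proof -
  obtain e where e: "fst e \<in> M \<or> tip e \<in> M" "x = fst e \<or> x = tip e"
    using assms by (auto simp: nbhd_def inc_def)
  have "\<bar>fst (fst e) - fst (tip e)\<bar> \<le> 1 \<and> \<bar>snd (fst e) - snd (tip e)\<bar> \<le> 1"
    by (cases e rule: tip.cases) auto
  with e show ?thesis by (metis abs_minus_commute diff_self abs_zero zero_le_one)
qed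

lemma gain_local: "A \<inter> nbhd M = A' \<inter> nbhd M \<Longrightarrow> gain \<beta> M A = gain \<beta> M A'"
proof -
  assume eq: "A \<inter> nbhd M = A' \<inter> nbhd M"
  have "z \<in> A \<longleftrightarrow> z \<in> A'" if "z \<in> nbhd M" for z using eq that by blast
  then have "fst e \<in> A \<longleftrightarrow> fst e \<in> A'" "tip e \<in> A \<longleftrightarrow> tip e \<in> A'" if "e \<in> inc M" for e
    using that by (auto simp: nbhd_def)
  then have "bd (A \<union> M) \<inter> inc M = bd (A' \<union> M) \<inter> inc M" "bd A \<inter> inc M = bd A' \<inter> inc M"
    by (auto simp: bd_def)
  then show ?thesis by (simp add: gain_def)
qed

lemma wt_Un:
  assumes "finite A" "finite M"
  shows "wt \<beta> (A \<union> M) = gain \<beta> M A * wt \<beta> A"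
proof -
  have split: "card X = card (X \<inter> inc M) + card (X - inc M)" if "finite X" for X
    using card_Un_disjoint[of "X \<inter> inc M" "X - inc M"] that by (simp add: Int_Diff_Un disjoint_iff)
  have "bd (A \<union> M) - inc M = bd A - inc M" by (auto simp: bd_def inc_def)
  then have "real (card (bd (A \<union> M))) =
      (real (card (bd (A \<union> M) \<inter> inc M)) - real (card (bd A \<inter> inc M))) + real (card (bd A))"
    using split[of "bd A"] split[of "bd (A \<union> M)"] assms by simp
  then show ?thesis unfolding wt_def gain_def exp_add[symmetric] distrib_left[symmetric] by (simp only:)
qed

lemma gain_bounds:
  assumes "\<beta> \<ge> 0" "finite M"
  shows "exp (- 8 * \<beta> * real (card M)) \<le> gain \<beta> M A" "gain \<beta> M A \<le> exp (8 * \<beta> * real (card M))"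
proof -
  have "card (X \<inter> inc M) \<le> 4 * card M" for X
    using card_mono[of "inc M" "X \<inter> inc M"] card_inc_le[OF assms(2)] assms(2) by auto
  then have le: "real (card (X \<inter> inc M)) \<le> 4 * real (card M)" for X
    by (metis of_nat_le_iff of_nat_mult of_nat_numeral)
  define D where "D = real (card (bd (A \<union> M) \<inter> inc M)) - real (card (bd A \<inter> inc M))"
  have "D \<le> 4 * real (card M)" "- D \<le> 4 * real (card M)"
    unfolding D_def using le[of "bd A"] le[of "bd (A \<union> M)"] by linarith+
  then have "(2 * \<beta>) * D \<le> (2 * \<beta>) * (4 * real (card M))" "(2 * \<beta>) * (- D) \<le> (2 * \<beta>) * (4 * real (card M))"
    using assms(1) by (intro mult_left_mono; simp)+
  then show "exp (- 8 * \<beta> * real (card M)) \<le> gain \<beta> M A" "gain \<beta> M A \<le> exp (8 * \<beta> * real (card M))"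
    unfolding gain_def D_def[symmetric] by simp_all
qed

lemma Z_Un:
  assumes "finite \<Lambda>" "finite M" "finite N"
  shows "Z \<beta> \<Lambda> (M \<union> N) = mean \<beta> \<Lambda> M (\<lambda>B. gain \<beta> N (B \<union> M)) * Z \<beta> \<Lambda> M"
proof -
  have "Z \<beta> \<Lambda> (M \<union> N) = (\<Sum>B\<in>Pow \<Lambda>. gain \<beta> N (B \<union> M) * wt \<beta> (B \<union> M))"
    unfolding Z_def
  proof (rule sum.cong[OF refl])
    fix B assume "B \<in> Pow \<Lambda>"
    then have "finite (B \<union> M)" using assms finite_subset by auto
    then show "wt \<beta> (B \<union> (M \<union> N)) = gain \<beta> N (B \<union> M) * wt \<beta> (B \<union> M)"
      using wt_Un[of "B \<union> M" N \<beta>] assms by (simp add: Un_assoc)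
  qed
  then show ?thesis by (simp add: Z_mean[OF assms(1)])
qed

definition ratio :: "real \<Rightarrow> int \<Rightarrow> nat \<Rightarrow> int set \<Rightarrow> real" where
  "ratio \<beta> a n M = Z \<beta> (strip a n) (lay M) / Z \<beta> (strip a n) {}"

text \<open>The relative weight of the layer configuration with minus spins exactly on \<open>M\<close>, in the limit
  of large boxes. The specification is \<open>rho\<close> up to normalization.\<close>
definition rho :: "real \<Rightarrow> int set \<Rightarrow> real" where
  "rho \<beta> M = lim (\<lambda>n. ratio \<beta> 0 n M)"

lemma ratio_mean: "finite M \<Longrightarrow> ratio \<beta> a n M = mean \<beta> (strip a n) {} (gain \<beta> (lay M))"
  using Z_Un[of "strip a n" "{}" "lay M" \<beta>] Z_pos[of "strip a n" \<beta> "{}"] by (simp add: ratio_def)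

text \<open>The ratio is the mean of the local observable \<^const>\<open>gain\<close> with plus spins on the whole
  layer, so that volumes which agree near \<open>M\<close> give almost the same value. This covers both the
  convergence along boxes and the independence of their centres.\<close>
lemma ratio_compare:
  assumes \<beta>: "\<beta> \<ge> 0" "small \<beta> \<le> 1 / 2" and R: "R \<ge> 0" "M \<subseteq> {- R..R}" "\<bar>a\<bar> \<le> R" "\<bar>b\<bar> \<le> R"
    and d: "int d + 2 * R + 1 \<le> int n" "int d + 2 * R + 1 \<le> int m"
  shows "\<bar>ratio \<beta> a n M - ratio \<beta> b m M\<bar> \<le> exp (8 * \<beta> * real (card M)) * real (card (nbhd (lay M))) * (2 * small \<beta> ^ Suc d)"
proof -
  have M: "finite M" by (rule finite_subset[OF R(2)]) simp
  have "\<bar>mean \<beta> (strip a n) {} (gain \<beta> (lay M)) - mean \<beta> (strip b m) {} (gain \<beta> (lay M))\<bar>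
    \<le> exp (8 * \<beta> * real (card M)) * real (card (nbhd (lay M))) * (2 * small \<beta> ^ Suc d * exp (32 * \<beta> * real (card ({} :: site set))))"
  proof (rule volume_comparison[OF \<beta>])
    show "gain \<beta> (lay M) B = gain \<beta> (lay M) (B \<inter> nbhd (lay M))" for B
      by (rule gain_local) blast
    show "0 \<le> gain \<beta> (lay M) B \<and> gain \<beta> (lay M) B \<le> exp (8 * \<beta> * real (card M))" for B
      using gain_bounds(2)[OF \<beta>(1), of "lay M" B] M by (simp add: gain_def)
    fix x y assume x: "x \<in> nbhd (lay M) \<inter> (strip a n \<union> strip b m)" and y: "y \<in> sym_diff (strip a n) (strip b m)"
    obtain p where p: "p \<in> lay M" "\<bar>fst x - fst p\<bar> \<le> 1" "\<bar>snd x - snd p\<bar> \<le> 1"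
      using nbhd_near x by blast
    from p(1) obtain l where l: "l \<in> M" "p = (l, 0)" by (auto simp: lay_def)
    have "- R \<le> l" "l \<le> R" using R(2) l(1) by auto
    then have x': "\<bar>fst x\<bar> \<le> R + 1" "\<bar>snd x\<bar> \<le> 1" using p l(2) by auto
    have "snd y \<noteq> 0" using y by (auto simp: strip_def)
    moreover have "y \<notin> strip a n \<or> y \<notin> strip b m" using y by blast
    ultimately have "\<bar>fst y - a\<bar> > int n \<or> \<bar>snd y\<bar> > int n \<or> \<bar>fst y - b\<bar> > int m \<or> \<bar>snd y\<bar> > int m"
      by (cases y) (auto simp: strip_def)
    then show "int d \<le> \<bar>fst y - fst x\<bar> \<or> int d \<le> \<bar>snd y - snd x\<bar>"
      using x' R(1,3,4) d by arith
  qed (use M in \<open>auto simp: exterior_rays_strip finite_nbhd\<close>)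
  then show ?thesis by (simp add: ratio_mean[OF M])
qed

lemma ratio_compare_lim:
  assumes \<beta>: "\<beta> \<ge> 0" "small \<beta> \<le> 1 / 2" and M: "finite M"
  shows "\<exists>K R. \<forall>d n m. d + R \<le> n \<longrightarrow> d + R \<le> m \<longrightarrow> \<bar>ratio \<beta> a n M - ratio \<beta> b m M\<bar> \<le> K * (1 / 2) ^ d"
proof -
  \<comment> \<open>Any bound for the sites of \<open>M\<close> and for the two centres.\<close>
  define R where "R = (\<Sum>i\<in>M. \<bar>i\<bar>) + \<bar>a\<bar> + \<bar>b\<bar>"
  have R: "R \<ge> 0" "\<bar>a\<bar> \<le> R" "\<bar>b\<bar> \<le> R" by (simp_all add: R_def sum_nonneg)
  have "\<bar>i\<bar> \<le> R" if "i \<in> M" for i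
    using member_le_sum[of i M "\<lambda>i. \<bar>i\<bar>"] that M by (simp add: R_def)
  then have MR: "M \<subseteq> {- R..R}" by fastforce
  define K where "K = exp (8 * \<beta> * real (card M)) * real (card (nbhd (lay M))) * 2"
  have K: "K \<ge> 0" by (simp add: K_def)
  have s: "0 \<le> small \<beta>" by (simp add: small_def)
  have "\<bar>ratio \<beta> a n M - ratio \<beta> b m M\<bar> \<le> K * (1 / 2) ^ d"
    if "d + nat (2 * R + 1) \<le> n" "d + nat (2 * R + 1) \<le> m" for d n m
  proof -
    have "int d + 2 * R + 1 \<le> int n" "int d + 2 * R + 1 \<le> int m" using that R(1) by linarith+
    then have "\<bar>ratio \<beta> a n M - ratio \<beta> b m M\<bar> \<le> K * small \<beta> ^ Suc d"
      using ratio_compare[OF \<beta> R(1) MR R(2,3)] by (simp add: K_def mult.assoc)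
    also have "\<dots> \<le> K * (1 / 2) ^ Suc d" using s \<beta>(2) K by (intro mult_left_mono power_mono)
    also have "\<dots> \<le> K * (1 / 2) ^ d" using K by (intro mult_left_mono power_decreasing) auto
    finally show ?thesis .
  qed
  then show ?thesis by blast
qed

lemma power_half_small:
  fixes K e :: real
  assumes "e > 0"
  shows "\<exists>d. K * (1 / 2) ^ d < e"
proof -
  have "(\<lambda>d. K * (1 / 2) ^ d) \<longlonglongrightarrow> 0" by (intro tendsto_mult_right_zero LIMSEQ_power_zero) simp
  then have "eventually (\<lambda>d. K * (1 / 2) ^ d < e) sequentially" using assms by (rule order_tendstoD)
  then show ?thesis unfolding eventually_sequentially by blast
qed

lemma ratio_tendsto_0:
  assumes \<beta>: "\<beta> \<ge> 0" "small \<beta> \<le> 1 / 2" and M: "finite M"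
  shows "(\<lambda>n. ratio \<beta> 0 n M) \<longlonglongrightarrow> rho \<beta> M"
proof -
  obtain K R where KR: "\<And>d n m. d + R \<le> n \<Longrightarrow> d + R \<le> m \<Longrightarrow> \<bar>ratio \<beta> 0 n M - ratio \<beta> 0 m M\<bar> \<le> K * (1 / 2) ^ d"
    using ratio_compare_lim[OF \<beta> M, of 0 0] by blast
  have "Cauchy (\<lambda>n. ratio \<beta> 0 n M)"
  proof (rule CauchyI)
    fix e :: real assume "e > 0"
    then obtain d where "K * (1 / 2) ^ d < e" using power_half_small by blast
    then show "\<exists>N. \<forall>m\<ge>N. \<forall>n\<ge>N. norm (ratio \<beta> 0 m M - ratio \<beta> 0 n M) < e"
      using KR[of d] by (intro exI[of _ "d + R"]) (auto intro: le_less_trans)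
  qed
  then have "convergent (\<lambda>n. ratio \<beta> 0 n M)" by (rule Cauchy_convergent)
  then show ?thesis unfolding rho_def by (simp add: convergent_LIMSEQ_iff)
qed

lemma ratio_tendsto:
  assumes \<beta>: "\<beta> \<ge> 0" "small \<beta> \<le> 1 / 2" and M: "finite M"
  shows "(\<lambda>n. ratio \<beta> a n M) \<longlonglongrightarrow> rho \<beta> M"
proof -
  obtain K R where KR: "\<And>d n m. d + R \<le> n \<Longrightarrow> d + R \<le> m \<Longrightarrow> \<bar>ratio \<beta> a n M - ratio \<beta> 0 m M\<bar> \<le> K * (1 / 2) ^ d"
    using ratio_compare_lim[OF \<beta> M, of a 0] by blast
  have "(\<lambda>n. ratio \<beta> a n M - ratio \<beta> 0 n M) \<longlonglongrightarrow> 0"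
  proof (rule LIMSEQ_I)
    fix e :: real assume "e > 0"
    then obtain d where "K * (1 / 2) ^ d < e" using power_half_small by blast
    then show "\<exists>N. \<forall>n\<ge>N. norm (ratio \<beta> a n M - ratio \<beta> 0 n M - 0) < e"
      using KR[of d] by (intro exI[of _ "d + R"]) (auto intro: le_less_trans)
  qed
  then have "(\<lambda>n. (ratio \<beta> a n M - ratio \<beta> 0 n M) + ratio \<beta> 0 n M) \<longlonglongrightarrow> 0 + rho \<beta> M"
    using ratio_tendsto_0[OF \<beta> M] by (rule tendsto_add)
  then show ?thesis by simp
qed

subsection \<open>Translation invariance\<close>

definition shift :: "int \<Rightarrow> site \<Rightarrow> site" where
  "shift s z = (fst z + s, snd z)"

lemma inj_shift: "inj (shift s)"
  by (auto simp: inj_def shift_def prod_eq_iff)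

lemma shift_shift: "shift s (shift (- s) z) = z" "shift (- s) (shift s z) = z"
  by (auto simp: shift_def)

lemma card_bd_shift: "card (bd (shift s ` A)) = card (bd A)"
proof -
  have mem: "z \<in> shift s ` A \<longleftrightarrow> shift (- s) z \<in> A" for z s and A :: "site set"
    by (metis imageE image_eqI shift_shift)
  have tip: "tip (shift s z, d) = shift s (tip (z, d))" for z d s
    by (cases "(z, d)" rule: tip.cases) (auto simp: shift_def)
  have "bd (shift s ` A) = map_prod (shift s) id ` bd A"
  proof (intro set_eqI iffI)
    fix e assume e: "e \<in> bd (shift s ` A)"
    then have "map_prod (shift (- s)) id e \<in> bd A" by (cases e, auto simp: bd_def mem tip)
    moreover have "e = map_prod (shift s) id (map_prod (shift (- s)) id e)"
      by (cases e) (simp add: shift_shift)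
    ultimately show "e \<in> map_prod (shift s) id ` bd A" by blast
  next
    fix e assume "e \<in> map_prod (shift s) id ` bd A"
    then show "e \<in> bd (shift s ` A)" by (auto simp: bd_def mem tip shift_shift)
  qed
  moreover have "inj (map_prod (shift s) (id :: bool \<Rightarrow> bool))"
    using inj_shift by (auto simp: inj_def)
  ultimately show ?thesis by (simp add: card_image inj_on_subset)
qed

lemma Z_shift: "Z \<beta> (shift s ` \<Lambda>) (shift s ` M) = Z \<beta> \<Lambda> M"
proof -
  have "Z \<beta> (shift s ` \<Lambda>) (shift s ` M) = (\<Sum>B\<in>image (shift s) ` Pow \<Lambda>. wt \<beta> (B \<union> shift s ` M))"
    unfolding Z_def by (simp add: image_Pow_surj)
  also have "\<dots> = (\<Sum>B\<in>Pow \<Lambda>. wt \<beta> (shift s ` B \<union> shift s ` M))"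
    by (rule sum.reindex_cong[OF inj_on_image_Pow]) (auto intro: inj_on_subset[OF inj_shift])
  also have "\<dots> = Z \<beta> \<Lambda> M"
    unfolding Z_def image_Un[symmetric] wt_def card_bd_shift ..
  finally show ?thesis .
qed

lemma rho_shift:
  assumes \<beta>: "\<beta> \<ge> 0" "small \<beta> \<le> 1 / 2" and M: "finite M"
  shows "rho \<beta> ((+) s ` M) = rho \<beta> M"
proof -
  have lay: "shift s ` lay M = lay ((+) s ` M)" by (auto simp: shift_def lay_def image_image)
  have strip: "shift s ` strip 0 n = strip s n" for n
  proof (intro set_eqI iffI)
    fix z assume "z \<in> strip s n"
    then have "shift (- s) z \<in> strip 0 n" by (auto simp: shift_def strip_def mem_Times_iff)
    then show "z \<in> shift s ` strip 0 n" by (metis image_eqI shift_shift(1))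
  qed (auto simp: shift_def strip_def)
  have "ratio \<beta> s n ((+) s ` M) = ratio \<beta> 0 n M" for n
    unfolding ratio_def
    using Z_shift[of \<beta> s "strip 0 n" "lay M"] Z_shift[of \<beta> s "strip 0 n" "{}"] by (simp add: lay strip)
  then have "(\<lambda>n. ratio \<beta> 0 n M) \<longlonglongrightarrow> rho \<beta> ((+) s ` M)"
    using ratio_tendsto[OF \<beta>, of "(+) s ` M" s] M by simp
  then show ?thesis using ratio_tendsto[OF \<beta> M, of 0] by (rule LIMSEQ_unique)
qed

lemma Z_insert_bounds:
  assumes "\<beta> \<ge> 0" "finite M" "finite \<Lambda>"
  shows "exp (- 8 * \<beta>) * Z \<beta> \<Lambda> (lay M) \<le> Z \<beta> \<Lambda> (lay (insert p M))"
    "Z \<beta> \<Lambda> (lay (insert p M)) \<le> exp (8 * \<beta>) * Z \<beta> \<Lambda> (lay M)"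
proof -
  have eq: "Z \<beta> \<Lambda> (lay (insert p M)) = (\<Sum>B\<in>Pow \<Lambda>. gain \<beta> (lay {p}) (B \<union> lay M) * wt \<beta> (B \<union> lay M))"
    unfolding lay_insert[of p M] using assms by (subst Z_Un) (auto simp: Z_mean[OF assms(3)])
  have b: "exp (- 8 * \<beta>) \<le> gain \<beta> (lay {p}) A" "gain \<beta> (lay {p}) A \<le> exp (8 * \<beta>)" for A
    using gain_bounds[OF assms(1), of "lay {p}" A] by auto
  show "exp (- 8 * \<beta>) * Z \<beta> \<Lambda> (lay M) \<le> Z \<beta> \<Lambda> (lay (insert p M))"
    "Z \<beta> \<Lambda> (lay (insert p M)) \<le> exp (8 * \<beta>) * Z \<beta> \<Lambda> (lay M)"
    unfolding eq unfolding Z_def sum_distrib_left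
    by (intro sum_mono mult_right_mono b less_imp_le[OF wt_pos])+
qed

lemma ratio_insert_bounds:
  assumes "\<beta> \<ge> 0" "finite M"
  shows "exp (- 8 * \<beta>) * ratio \<beta> a n M \<le> ratio \<beta> a n (insert p M)"
    "ratio \<beta> a n (insert p M) \<le> exp (8 * \<beta>) * ratio \<beta> a n M"
  using Z_insert_bounds[OF assms, of "strip a n" p] Z_pos[of "strip a n" \<beta> "{}"]
  by (simp_all add: ratio_def divide_right_mono)

lemma rho_empty [simp]: "rho \<beta> {} = 1"
proof -
  have "ratio \<beta> 0 n {} = 1" for n
    using Z_pos[of "strip 0 n" \<beta> "{}"] by (simp add: ratio_def)
  then show ?thesis by (simp add: rho_def)
qed

lemma rho_insert_bounds:
  assumes \<beta>: "\<beta> \<ge> 0" "small \<beta> \<le> 1 / 2" and M: "finite M"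
  shows "exp (- 8 * \<beta>) * rho \<beta> M \<le> rho \<beta> (insert p M)" "rho \<beta> (insert p M) \<le> exp (8 * \<beta>) * rho \<beta> M"
proof -
  have "(\<lambda>n. exp c * ratio \<beta> 0 n M) \<longlonglongrightarrow> exp c * rho \<beta> M" for c
    by (intro tendsto_intros ratio_tendsto \<beta> M)
  moreover have "(\<lambda>n. ratio \<beta> 0 n (insert p M)) \<longlonglongrightarrow> rho \<beta> (insert p M)"
    by (intro ratio_tendsto \<beta>) (use M in simp)
  ultimately show "exp (- 8 * \<beta>) * rho \<beta> M \<le> rho \<beta> (insert p M)" "rho \<beta> (insert p M) \<le> exp (8 * \<beta>) * rho \<beta> M"
    using ratio_insert_bounds[OF \<beta>(1) M] by (meson LIMSEQ_le)+
qed

lemma rho_pos: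
  assumes \<beta>: "\<beta> \<ge> 0" "small \<beta> \<le> 1 / 2" and M: "finite M"
  shows "rho \<beta> M > 0"
  using M
proof (induction M)
  case (insert p M)
  have "0 < exp (- 8 * \<beta>) * rho \<beta> M" using insert by simp
  also have "\<dots> \<le> rho \<beta> (insert p M)" using rho_insert_bounds[OF \<beta>] insert by blast
  finally show ?case .
qed simp

subsection \<open>Decay of the interaction between two distant minus spins\<close>

text \<open>Making both spins minus has a gain which is the product of the two single gains, because
  spins at distance two or more have no bond in common. The failure of the ratios to factorize
  is therefore exactly a covariance of local observables near \<open>j\<close> and near \<open>i\<close>.\<close>
lemma ratio_covariance:
  assumes \<beta>: "\<beta> \<ge> 0" "small \<beta> \<le> 1 / 2" and m: "finite m" and ji: "j + 2 \<le> i"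
  shows "\<bar>ratio \<beta> 0 n (insert j (insert i m)) * ratio \<beta> 0 n m - ratio \<beta> 0 n (insert j m) * ratio \<beta> 0 n (insert i m)\<bar>
    \<le> exp (16 * \<beta>) * 8 * (small \<beta> ^ nat (i - j - 1) * exp (32 * \<beta> * real (card m))) * (ratio \<beta> 0 n m)\<^sup>2"
proof -
  let ?\<Lambda> = "strip 0 n" and ?M = "lay m"
  let ?f = "\<lambda>B. gain \<beta> (lay {j}) (B \<union> ?M)" and ?g = "\<lambda>B. gain \<beta> (lay {i}) (B \<union> ?M)"
  let ?c = "exp (16 * \<beta>) * 8 * (small \<beta> ^ nat (i - j - 1) * exp (32 * \<beta> * real (card m)))"
  have near: "\<bar>fst x - p\<bar> \<le> 1" if "x \<in> nbhd (lay {p})" for x p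
    using nbhd_near[OF that] by (auto simp: lay_def)
  have far: "(i, 0) \<notin> nbhd (lay {j})" using near[of "(i, 0)" j] ji by auto
  have Zj: "Z \<beta> ?\<Lambda> (lay (insert j m)) = mean \<beta> ?\<Lambda> ?M ?f * Z \<beta> ?\<Lambda> ?M"
    unfolding lay_insert[of j m] using m by (intro Z_Un) auto
  have Zi: "Z \<beta> ?\<Lambda> (lay (insert i m)) = mean \<beta> ?\<Lambda> ?M ?g * Z \<beta> ?\<Lambda> ?M"
    unfolding lay_insert[of i m] using m by (intro Z_Un) auto
  have Zji: "Z \<beta> ?\<Lambda> (lay (insert j (insert i m))) = mean \<beta> ?\<Lambda> ?M (\<lambda>B. ?f B * ?g B) * Z \<beta> ?\<Lambda> ?M"
  proof -
    have "Z \<beta> ?\<Lambda> (lay (insert j (insert i m))) = (\<Sum>B\<in>Pow ?\<Lambda>. ?f B * ?g B * wt \<beta> (B \<union> ?M))"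
      unfolding Z_def
    proof (rule sum.cong[OF refl])
      fix B assume "B \<in> Pow ?\<Lambda>"
      then have fin: "finite (B \<union> ?M)" using m finite_subset[OF _ finite_strip, of B 0 n] by auto
      have "wt \<beta> (B \<union> lay (insert j (insert i m))) = wt \<beta> (((B \<union> ?M) \<union> lay {i}) \<union> lay {j})"
        by (simp only: lay_insert[of j "insert i m"] lay_insert[of i m] Un_assoc)
      also have "\<dots> = gain \<beta> (lay {j}) ((B \<union> ?M) \<union> lay {i}) * (?g B * wt \<beta> (B \<union> ?M))"
        using fin wt_Un[of "B \<union> ?M \<union> lay {i}" "lay {j}" \<beta>] wt_Un[of "B \<union> ?M" "lay {i}" \<beta>] by simp
      also have "gain \<beta> (lay {j}) ((B \<union> ?M) \<union> lay {i}) = ?f B"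
        using far by (intro gain_local) (auto simp: lay_def)
      finally show "wt \<beta> (B \<union> lay (insert j (insert i m))) = ?f B * ?g B * wt \<beta> (B \<union> ?M)" by simp
    qed
    then show ?thesis by (simp add: Z_mean)
  qed
  have "\<bar>mean \<beta> ?\<Lambda> ?M (\<lambda>B. ?f B * ?g B) - mean \<beta> ?\<Lambda> ?M ?f * mean \<beta> ?\<Lambda> ?M ?g\<bar>
     \<le> (exp (8 * \<beta>))\<^sup>2 * real (card (nbhd (lay {j}))) * (small \<beta> ^ Suc (nat (i - j - 2)) * exp (32 * \<beta> * real (card ?M)))"
  proof (rule covariance_bound[OF \<beta>, where Y = "nbhd (lay {i})"])
    fix B
    show "?f B = gain \<beta> (lay {j}) (B \<inter> nbhd (lay {j}) \<union> ?M)" by (rule gain_local) blast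
    show "?g B = gain \<beta> (lay {i}) (B \<inter> nbhd (lay {i}) \<union> ?M)" by (rule gain_local) blast
    show "0 \<le> ?f B \<and> ?f B \<le> exp (8 * \<beta>)" "0 \<le> ?g B \<and> ?g B \<le> exp (8 * \<beta>)"
      using gain_bounds(2)[OF \<beta>(1), of "lay {j}" "B \<union> ?M"] gain_bounds(2)[OF \<beta>(1), of "lay {i}" "B \<union> ?M"]
      by (simp_all add: gain_def)
  next
    fix x y assume "x \<in> nbhd (lay {j}) \<inter> ?\<Lambda>" "y \<in> nbhd (lay {i}) \<inter> ?\<Lambda>"
    then have "\<bar>fst x - j\<bar> \<le> 1" "\<bar>fst y - i\<bar> \<le> 1" using near by auto
    then show "int (nat (i - j - 2)) \<le> \<bar>fst y - fst x\<bar> \<or> int (nat (i - j - 2)) \<le> \<bar>snd y - snd x\<bar>"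
      using ji by linarith
  qed (use m in \<open>auto simp: exterior_rays_strip finite_nbhd\<close>)
  also have "\<dots> \<le> ?c"
  proof -
    have "Suc (nat (i - j - 2)) = nat (i - j - 1)" using ji by linarith
    moreover have "(exp (8 * \<beta>))\<^sup>2 = exp (16 * \<beta>)" by (simp flip: exp_double)
    moreover have "real (card (nbhd (lay {j}))) \<le> 8" using card_nbhd_le[of "lay {j}"] by simp
    ultimately show ?thesis by (simp add: small_def mult_right_mono)
  qed
  finally have cov: "\<bar>mean \<beta> ?\<Lambda> ?M (\<lambda>B. ?f B * ?g B) - mean \<beta> ?\<Lambda> ?M ?f * mean \<beta> ?\<Lambda> ?M ?g\<bar> \<le> ?c" .
  let ?r = "ratio \<beta> 0 n m"
  have r: "ratio \<beta> 0 n (insert j (insert i m)) * ?r - ratio \<beta> 0 n (insert j m) * ratio \<beta> 0 n (insert i m)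
    = (mean \<beta> ?\<Lambda> ?M (\<lambda>B. ?f B * ?g B) - mean \<beta> ?\<Lambda> ?M ?f * mean \<beta> ?\<Lambda> ?M ?g) * ?r\<^sup>2"
    unfolding ratio_def Zj Zi Zji by (simp add: power2_eq_square algebra_simps add_divide_distrib diff_divide_distrib)
  show ?thesis unfolding r abs_mult using cov by (simp add: mult_right_mono)
qed

lemma rho_covariance:
  assumes \<beta>: "\<beta> \<ge> 0" "small \<beta> \<le> 1 / 2" and m: "finite m" and ji: "j + 2 \<le> i"
  shows "\<bar>rho \<beta> (insert j (insert i m)) * rho \<beta> m - rho \<beta> (insert j m) * rho \<beta> (insert i m)\<bar>
    \<le> exp (16 * \<beta>) * 8 * (small \<beta> ^ nat (i - j - 1) * exp (32 * \<beta> * real (card m))) * (rho \<beta> m)\<^sup>2"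
proof (rule LIMSEQ_le)
  show "(\<lambda>n. \<bar>ratio \<beta> 0 n (insert j (insert i m)) * ratio \<beta> 0 n m - ratio \<beta> 0 n (insert j m) * ratio \<beta> 0 n (insert i m)\<bar>)
    \<longlonglongrightarrow> \<bar>rho \<beta> (insert j (insert i m)) * rho \<beta> m - rho \<beta> (insert j m) * rho \<beta> (insert i m)\<bar>"
    by (intro tendsto_intros ratio_tendsto \<beta>) (use m in auto)
  show "(\<lambda>n. exp (16 * \<beta>) * 8 * (small \<beta> ^ nat (i - j - 1) * exp (32 * \<beta> * real (card m))) * (ratio \<beta> 0 n m)\<^sup>2)
    \<longlonglongrightarrow> exp (16 * \<beta>) * 8 * (small \<beta> ^ nat (i - j - 1) * exp (32 * \<beta> * real (card m))) * (rho \<beta> m)\<^sup>2"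
    by (intro tendsto_intros ratio_tendsto \<beta> m)
qed (use ratio_covariance[OF assms] in blast)

section \<open>The specification of the layer\<close>

lemma edge_ends_distinct: "fst e \<noteq> tip e"
  by (cases e rule: tip.cases) auto

lemma edge_ends_inject: "{fst e, tip e} = {fst f, tip f} \<Longrightarrow> e = f"
  by (cases e rule: tip.cases; cases f rule: tip.cases) (auto simp: doubleton_eq_iff)

lemma bonds_eq: "bonds \<Lambda> = (\<lambda>e. {fst e, tip e}) ` inc \<Lambda>"
proof (intro set_eqI iffI)
  fix b assume "b \<in> bonds \<Lambda>"
  then obtain x y where b: "b = {x, y}" "nn x y" "{x, y} \<inter> \<Lambda> \<noteq> {}" by (auto simp: bonds_def)
  from nn_iff_edge[of x y] b(2) obtain e where "(x = fst e \<and> y = tip e) \<or> (y = fst e \<and> x = tip e)" by blast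
  then have "{fst e, tip e} = {x, y}" by auto
  moreover from this b(3) have "e \<in> inc \<Lambda>" by (auto simp: inc_def doubleton_eq_iff)
  ultimately show "b \<in> (\<lambda>e. {fst e, tip e}) ` inc \<Lambda>" using b(1) by blast
next
  fix b assume "b \<in> (\<lambda>e. {fst e, tip e}) ` inc \<Lambda>"
  then obtain e where e: "b = {fst e, tip e}" "e \<in> inc \<Lambda>" by blast
  have "nn (fst e) (tip e)" using nn_iff_edge by blast
  with e show "b \<in> bonds \<Lambda>" unfolding bonds_def inc_def by blast
qed

definition spins :: "site set \<Rightarrow> site set \<Rightarrow> site \<Rightarrow> real" where
  "spins \<Lambda> A = restrict (\<lambda>x. if x \<in> A then -1 else 1) \<Lambda>"

lemma spins_in: "spins \<Lambda> A \<in> \<Lambda> \<rightarrow>\<^sub>E {-1, 1}"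
  by (auto simp: spins_def)

lemma minus_spins: "A \<subseteq> \<Lambda> \<Longrightarrow> {x \<in> \<Lambda>. spins \<Lambda> A x = -1} = A"
  by (auto simp: spins_def)

lemma spins_minus:
  assumes "X \<in> \<Lambda> \<rightarrow>\<^sub>E {-1, 1 :: real}"
  shows "spins \<Lambda> {x \<in> \<Lambda>. X x = -1} = X"
proof
  fix x
  show "spins \<Lambda> {x \<in> \<Lambda>. X x = -1} x = X x"
    using PiE_mem[OF assms, of x] PiE_arb[OF assms, of x] by (cases "x \<in> \<Lambda>") (auto simp: spins_def)
qed

lemma ising_weight_spins:
  assumes "finite \<Lambda>" "A \<subseteq> \<Lambda>"
  shows "ising_weight \<beta> \<Lambda> (spins \<Lambda> A) = wt \<beta> A"
proof -
  let ?s = "plus_off \<Lambda> (spins \<Lambda> A)"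
  have s: "?s x = (if x \<in> A then -1 else 1)" for x
    using assms(2) by (auto simp: plus_off_def spins_def)
  have "(\<Sum>b\<in>bonds \<Lambda>. (\<Prod>x\<in>b. ?s x) - 1) = (\<Sum>e\<in>inc \<Lambda>. (\<Prod>x\<in>{fst e, tip e}. ?s x) - 1)"
    unfolding bonds_eq by (rule sum.reindex_cong[OF inj_onI]) (auto dest: edge_ends_inject)
  also have "\<dots> = (\<Sum>e\<in>inc \<Lambda>. if e \<in> bd A then -2 else 0)"
    using edge_ends_distinct by (intro sum.cong) (auto simp: s bd_def)
  also have "\<dots> = - 2 * real (card (inc \<Lambda> \<inter> bd A))"
    using assms(1) by (simp add: sum.If_cases)
  also have "inc \<Lambda> \<inter> bd A = bd A" using bd_subset_inc[of A] assms(2) by (auto simp: inc_def)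
  finally show ?thesis by (simp add: ising_weight_def wt_def)
qed

lemma finite_box [simp]: "finite (box n)"
  by (simp add: box_def)

text \<open>A spin configuration in \<open>\<Lambda>\<close> is the same as its set of minus sites. The normalization is the
  partition function without minus spins outside \<open>\<Lambda>\<close>.\<close>
lemma prob_ising:
  assumes "finite \<Lambda>"
  shows "\<P>(X in ising_plus \<beta> \<Lambda>. P X) = (\<Sum>A | A \<subseteq> \<Lambda> \<and> P (spins \<Lambda> A). wt \<beta> A) / Z \<beta> \<Lambda> {}"
proof -
  let ?S = "\<Lambda> \<rightarrow>\<^sub>E {-1, 1 :: real}"
  have finS: "finite ?S" using assms by (simp add: finite_PiE)
  have tr: "(\<Sum>X | X \<in> ?S \<and> Q X. g X) = (\<Sum>A | A \<subseteq> \<Lambda> \<and> Q (spins \<Lambda> A). g (spins \<Lambda> A))" for Q and g :: "_ \<Rightarrow> real"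
    by (rule sum.reindex_bij_witness[of _ "spins \<Lambda>" "\<lambda>X. {x \<in> \<Lambda>. X x = -1}"])
      (auto simp: spins_minus minus_spins spins_in)
  have tot: "(\<Sum>X\<in>?S. ising_weight \<beta> \<Lambda> X) = Z \<beta> \<Lambda> {}"
  proof -
    have "(\<Sum>X\<in>?S. ising_weight \<beta> \<Lambda> X) = (\<Sum>A | A \<subseteq> \<Lambda>. ising_weight \<beta> \<Lambda> (spins \<Lambda> A))"
      using tr[where Q = "\<lambda>_. True" and g = "ising_weight \<beta> \<Lambda>"] by simp
    also have "\<dots> = (\<Sum>A | A \<subseteq> \<Lambda>. wt \<beta> A)"
      by (intro sum.cong refl) (simp add: ising_weight_spins[OF assms])
    finally show ?thesis by (simp add: Z_def Pow_def)
  qed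
  let ?g = "\<lambda>X. ising_weight \<beta> \<Lambda> X / Z \<beta> \<Lambda> {}"
  have g0: "?g X \<ge> 0" for X
    using Z_pos[OF assms, of \<beta> "{}"] by (simp add: ising_weight_def)
  have "emeasure (ising_plus \<beta> \<Lambda>) {X \<in> ?S. P X} = (\<Sum>X\<in>{X \<in> ?S. P X}. ennreal (?g X))"
    unfolding ising_plus_def tot by (rule emeasure_point_measure_finite) (use finS in auto)
  also have "\<dots> = ennreal (\<Sum>X\<in>{X \<in> ?S. P X}. ?g X)" using g0 by (rule sum_ennreal)
  finally have "measure (ising_plus \<beta> \<Lambda>) {X \<in> ?S. P X} = (\<Sum>X\<in>{X \<in> ?S. P X}. ?g X)"
    unfolding measure_def using g0 by (simp add: sum_nonneg)
  also have "\<dots> = (\<Sum>A | A \<subseteq> \<Lambda> \<and> P (spins \<Lambda> A). wt \<beta> A / Z \<beta> \<Lambda> {})"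
    unfolding tr[where Q = P and g = ?g] by (intro sum.cong refl) (simp add: ising_weight_spins[OF assms])
  finally show ?thesis by (simp add: ising_plus_def space_point_measure sum_divide_distrib)
qed

lemma spins_lay:
  assumes "i \<in> {- int n..int n}"
  shows "spins (box n) A (i, 0) = (if (i, 0) \<in> A then -1 else 1)"
  using assms by (simp add: spins_def box_def)

lemma box_eq: "box n = strip 0 n \<union> lay {- int n..int n}"
  by (auto simp: box_def strip_def lay_def)

lemma lay_mem [simp]: "(i, 0) \<in> lay M \<longleftrightarrow> i \<in> M"
  by (auto simp: lay_def)

lemma not_in_strip [simp]: "(i, 0) \<notin> strip a n"
  by (simp add: strip_def)

text \<open>Conditioning on plus spins in the layer outside \<open>V\<close> leaves the weight of each configuration
  on \<open>V\<close> as the partition function of the box off the layer.\<close>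
lemma cond_prob_layer:
  assumes V: "V \<subseteq> {- int n..int n}" and \<sigma>: "\<And>i. i \<in> V \<Longrightarrow> \<sigma> i \<in> {-1, 1}"
  shows "\<P>(X in ising_plus \<beta> (box n). (\<forall>i\<in>V. X (i, 0) = \<sigma> i) \<bar> (\<forall>i\<in>{- int n..int n} - V. X (i, 0) = 1))
    = ratio \<beta> 0 n {i \<in> V. \<sigma> i = -1} / (\<Sum>M\<in>Pow V. ratio \<beta> 0 n M)"
proof -
  let ?L = "{- int n..int n}" and ?m = "{i \<in> V. \<sigma> i = -1}"
  let ?P = "\<lambda>X :: site \<Rightarrow> real. \<forall>i\<in>V. X (i, 0) = \<sigma> i" and ?Q = "\<lambda>X :: site \<Rightarrow> real. \<forall>i\<in>?L - V. X (i, 0) = 1"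
  have finV: "finite V" by (rule finite_subset[OF V]) simp
  have m1: "(-1::real) \<noteq> 1" by simp
  have Q: "?Q (spins (box n) A) \<longleftrightarrow> A \<inter> lay ?L \<subseteq> lay V" if "A \<subseteq> box n" for A
  proof -
    have "?Q (spins (box n) A) \<longleftrightarrow> (\<forall>i\<in>?L - V. (i, 0) \<notin> A)"
      using spins_lay[of _ n A] by auto
    then show ?thesis by (auto simp: lay_def)
  qed
  have PQ: "?P (spins (box n) A) \<and> ?Q (spins (box n) A) \<longleftrightarrow> A \<inter> lay ?L = lay ?m" if "A \<subseteq> box n" for A
  proof -
    have "?P (spins (box n) A) \<longleftrightarrow> (\<forall>i\<in>V. (i, 0) \<in> A \<longleftrightarrow> \<sigma> i = -1)"
    proof (intro ball_cong refl)
      fix i assume "i \<in> V"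
      then have "i \<in> ?L" "\<sigma> i \<in> {-1, 1}" using V \<sigma> by auto
      then show "spins (box n) A (i, 0) = \<sigma> i \<longleftrightarrow> ((i, 0) \<in> A \<longleftrightarrow> \<sigma> i = -1)"
        using spins_lay[of i n A] by (cases "(i, 0) \<in> A") auto
    qed
    moreover have "(\<forall>i\<in>V. (i, 0) \<in> A \<longleftrightarrow> \<sigma> i = -1) \<and> A \<inter> lay ?L \<subseteq> lay V \<longleftrightarrow> A \<inter> lay ?L = lay ?m"
      using V by (auto simp: lay_def)
    ultimately show ?thesis using Q[OF that] by blast
  qed
  have num: "(\<Sum>A | A \<subseteq> box n \<and> (?P (spins (box n) A) \<and> ?Q (spins (box n) A)). wt \<beta> A) = Z \<beta> (strip 0 n) (lay ?m)"
    unfolding Z_def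
  proof (rule sum.reindex_bij_witness[of _ "\<lambda>B. B \<union> lay ?m" "\<lambda>A. A - lay ?L"])
    fix A assume A: "A \<in> {A. A \<subseteq> box n \<and> (?P (spins (box n) A) \<and> ?Q (spins (box n) A))}"
    then have A': "A \<subseteq> box n" "A \<inter> lay ?L = lay ?m" using PQ by auto
    show eq: "A - lay ?L \<union> lay ?m = A" unfolding A'(2)[symmetric] by blast
    show "A - lay ?L \<in> Pow (strip 0 n)" using A'(1) box_eq by blast
    show "wt \<beta> (A - lay ?L \<union> lay ?m) = wt \<beta> A" by (simp only: eq)
  next
    fix B assume B: "B \<in> Pow (strip 0 n)"
    have "lay ?m \<subseteq> lay ?L" using V by (auto simp: lay_def)
    moreover have "B \<inter> lay ?L = {}" using B strip_Int_lay[of 0 n ?L] by blast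
    ultimately have 0: "B \<union> lay ?m - lay ?L = B" and 1: "(B \<union> lay ?m) \<inter> lay ?L = lay ?m" by blast+
    show "B \<union> lay ?m - lay ?L = B" by (rule 0)
    have 2: "B \<union> lay ?m \<subseteq> box n" using B box_eq \<open>lay ?m \<subseteq> lay ?L\<close> by blast
    show "B \<union> lay ?m \<in> {A. A \<subseteq> box n \<and> (?P (spins (box n) A) \<and> ?Q (spins (box n) A))}"
      using PQ[OF 2] 1 2 by blast
  qed
  have den: "(\<Sum>A | A \<subseteq> box n \<and> ?Q (spins (box n) A). wt \<beta> A) = (\<Sum>M\<in>Pow V. Z \<beta> (strip 0 n) (lay M))"
  proof -
    have "(\<Sum>M\<in>Pow V. Z \<beta> (strip 0 n) (lay M)) = (\<Sum>p\<in>Pow V \<times> Pow (strip 0 n). wt \<beta> (snd p \<union> lay (fst p)))"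
      by (simp add: Z_def sum.cartesian_product split_def)
    also have "\<dots> = (\<Sum>A | A \<subseteq> box n \<and> ?Q (spins (box n) A). wt \<beta> A)"
    proof (rule sum.reindex_bij_witness[of _ "\<lambda>A. ({i \<in> V. (i, 0) \<in> A}, A - lay ?L)" "\<lambda>p. snd p \<union> lay (fst p)"])
      fix p assume "p \<in> Pow V \<times> Pow (strip 0 n)"
      then obtain M B where p: "p = (M, B)" "M \<subseteq> V" "B \<subseteq> strip 0 n" by auto
      have "lay M \<subseteq> lay ?L" "lay M \<subseteq> lay V" using V p(2) by (auto simp: lay_def)
      moreover have B: "B \<inter> lay ?L = {}" using p(3) strip_Int_lay[of 0 n ?L] by blast
      ultimately have "B \<union> lay M - lay ?L = B" "(B \<union> lay M) \<inter> lay ?L \<subseteq> lay V" by blast+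
      moreover have "(i, 0) \<notin> B" for i using p(3) by auto
      moreover have sub: "B \<union> lay M \<subseteq> box n" using p(3) box_eq \<open>lay M \<subseteq> lay ?L\<close> by blast
      ultimately show "({i \<in> V. (i, 0) \<in> snd p \<union> lay (fst p)}, snd p \<union> lay (fst p) - lay ?L) = p"
        "snd p \<union> lay (fst p) \<in> {A. A \<subseteq> box n \<and> ?Q (spins (box n) A)}"
        using p(2) Q[OF sub] by (auto simp: p(1))
    next
      fix A assume "A \<in> {A. A \<subseteq> box n \<and> ?Q (spins (box n) A)}"
      then have A: "A \<subseteq> box n" "A \<inter> lay ?L \<subseteq> lay V" using Q by auto
      show "snd ({i \<in> V. (i, 0) \<in> A}, A - lay ?L) \<union> lay (fst ({i \<in> V. (i, 0) \<in> A}, A - lay ?L)) = A"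
        using A(2) V by (auto simp: lay_def)
      show "({i \<in> V. (i, 0) \<in> A}, A - lay ?L) \<in> Pow V \<times> Pow (strip 0 n)"
        using A(1) box_eq by blast
    qed simp
    finally show ?thesis by simp
  qed
  have pos: "Z \<beta> (strip 0 n) {} > 0" "Z \<beta> (box n) {} > 0" by (simp_all add: Z_pos)
  have "(\<Sum>M\<in>Pow V. ratio \<beta> 0 n M) = (\<Sum>M\<in>Pow V. Z \<beta> (strip 0 n) (lay M)) / Z \<beta> (strip 0 n) {}"
    by (simp add: ratio_def sum_divide_distrib)
  then show ?thesis
    unfolding cond_prob_def prob_ising[OF finite_box] num den using pos by (simp add: ratio_def)
qed

lemma layer_spec_eq:
  assumes \<beta>: "\<beta> \<ge> 0" "small \<beta> \<le> 1 / 2" and V: "finite V" and \<sigma>: "\<And>i. i \<in> V \<Longrightarrow> \<sigma> i \<in> {-1, 1}"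
  shows "layer_spec \<beta> V \<sigma> (\<lambda>_. 1) = rho \<beta> {i \<in> V. \<sigma> i = -1} / (\<Sum>M\<in>Pow V. rho \<beta> M)"
proof -
  let ?g = "\<lambda>n. \<P>(X in ising_plus \<beta> (box n). (\<forall>i\<in>V. X (i, 0) = \<sigma> i) \<bar> (\<forall>i\<in>{- int n..int n} - V. X (i, 0) = 1))"
  have fin: "finite M" if "M \<in> Pow V" for M using that V finite_subset by auto
  have "(\<Sum>M\<in>Pow V. rho \<beta> M) > 0"
    using V by (intro sum_pos rho_pos \<beta> fin) auto
  then have "(\<lambda>n. ratio \<beta> 0 n {i \<in> V. \<sigma> i = -1} / (\<Sum>M\<in>Pow V. ratio \<beta> 0 n M)) \<longlonglongrightarrow>
      rho \<beta> {i \<in> V. \<sigma> i = -1} / (\<Sum>M\<in>Pow V. rho \<beta> M)"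
    using V by (intro tendsto_intros ratio_tendsto \<beta> fin) auto
  moreover have "eventually (\<lambda>n. ?g n = ratio \<beta> 0 n {i \<in> V. \<sigma> i = -1} / (\<Sum>M\<in>Pow V. ratio \<beta> 0 n M)) sequentially"
  proof -
    obtain N where N: "\<And>i. i \<in> V \<Longrightarrow> \<bar>i\<bar> \<le> int N"
    proof
      fix i assume "i \<in> V"
      then have "nat \<bar>i\<bar> \<le> (\<Sum>y\<in>V. nat \<bar>y\<bar>)" using V by (intro member_le_sum) auto
      then show "\<bar>i\<bar> \<le> int (\<Sum>y\<in>V. nat \<bar>y\<bar>)" by linarith
    qed
    have "V \<subseteq> {- int n..int n}" if "n \<ge> N" for n
    proof
      fix i assume "i \<in> V"
      then show "i \<in> {- int n..int n}" using N[of i] that by auto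
    qed
    then show ?thesis unfolding eventually_sequentially using cond_prob_layer \<sigma> by blast
  qed
  ultimately have "?g \<longlonglongrightarrow> rho \<beta> {i \<in> V. \<sigma> i = -1} / (\<Sum>M\<in>Pow V. rho \<beta> M)"
    by (simp add: tendsto_cong)
  then show ?thesis unfolding layer_spec_def by (rule limI)
qed

section \<open>Decay of the telescoping potential\<close>

definition minuses :: "int \<Rightarrow> int \<Rightarrow> (int \<Rightarrow> real) \<Rightarrow> int set" where
  "minuses j i \<xi> = {l \<in> {j..i}. \<xi> l = -1}"

lemma finite_minuses [simp]: "finite (minuses j i \<xi>)"
  by (rule finite_subset[of _ "{j..i}"]) (auto simp: minuses_def)

lemma ln_diff_le:
  fixes a b c :: real
  assumes "c > 0" "c \<le> a" "c \<le> b"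
  shows "\<bar>ln a - ln b\<bar> \<le> \<bar>a - b\<bar> / c"
proof -
  have "ln a - ln b \<le> \<bar>a - b\<bar> / c" if "c \<le> a" "c \<le> b" for a b :: real
  proof -
    have pos: "a > 0" "b > 0" using that assms(1) by auto
    have "ln a - ln b = ln (a / b)" using pos by (simp add: ln_div)
    also have "\<dots> \<le> a / b - 1" using pos by (intro ln_le_minus_one) simp
    also have "\<dots> = (a - b) / b" using pos by (simp add: diff_divide_distrib)
    also have "\<dots> \<le> \<bar>a - b\<bar> / b" using pos by (intro divide_right_mono) auto
    also have "\<dots> \<le> \<bar>a - b\<bar> / c" using pos that assms(1) by (intro divide_left_mono) auto
    finally show ?thesis .
  qed
  from this[of a b] this[of b a] assms(2,3) show ?thesis by (simp add: abs_minus_commute abs_le_iff)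
qed

text \<open>The second condition makes \<^term>\<open>small \<beta> * exp (16 * \<beta> / 9)\<close> at most one half: a contour
  of \<open>k\<close> edges must still be unlikely if \<open>k / 18\<close> boundary spins are minus, each of them
  costing \<open>exp (32 * \<beta>)\<close>.\<close>
locale low_temperature =
  fixes \<beta> :: real
  assumes nonneg: "0 \<le> \<beta>" and cold: "2048 \<le> exp (2 * \<beta> / 9)"
begin

lemma small_times: "small \<beta> * exp (16 * \<beta> / 9) \<le> 1 / 2"
proof -
  have "small \<beta> * exp (16 * \<beta> / 9) = 1024 / exp (2 * \<beta> / 9)"
    by (simp add: small_def flip: exp_add exp_minus divide_inverse) (simp add: exp_minus field_simps flip: exp_add)
  also have "\<dots> \<le> 1024 / 2048" using cold by (intro divide_left_mono) auto
  finally show ?thesis by simp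
qed

lemma small_le: "small \<beta> \<le> 1 / 2"
proof -
  have "small \<beta> * 1 \<le> small \<beta> * exp (16 * \<beta> / 9)"
    using nonneg by (intro mult_left_mono) (auto simp: small_def)
  with small_times show ?thesis by simp
qed

lemma small_pos: "small \<beta> > 0"
  by (simp add: small_def)

lemmas params = nonneg small_le

lemma rho_positive: "finite M \<Longrightarrow> rho \<beta> M > 0"
  by (rule rho_pos[OF params])

lemma rho_nonzero [simp]: "finite M \<Longrightarrow> rho \<beta> M \<noteq> 0"
  using rho_positive by force

lemma layer_spec_plus_off:
  assumes "W \<subseteq> {j..i}" "\<xi> \<in> UNIV \<rightarrow> {-1, 1}"
  shows "layer_spec \<beta> {j..i} (plus_off W \<xi>) (\<lambda>_. 1) = rho \<beta> (minuses j i \<xi> \<inter> W) / (\<Sum>M\<in>Pow {j..i}. rho \<beta> M)"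
proof -
  have "{l \<in> {j..i}. plus_off W \<xi> l = -1} = minuses j i \<xi> \<inter> W"
    using assms(1) by (auto simp: plus_off_def minuses_def)
  moreover have "plus_off W \<xi> l \<in> {-1, 1}" for l
    using assms(2) by (auto simp: plus_off_def)
  ultimately show ?thesis using layer_spec_eq[OF params, of "{j..i}" "plus_off W \<xi>"] by simp
qed

lemma normalization_pos: "finite V \<Longrightarrow> (\<Sum>M\<in>Pow V. rho \<beta> M) > 0"
  by (intro sum_pos rho_positive) (auto intro: finite_subset)

text \<open>The normalizations cancel, since the four terms belong to the same volume.\<close>
lemma telescoping_rho:
  assumes "j < i" "\<xi> \<in> UNIV \<rightarrow> {-1, 1}"
  shows "telescoping \<beta> {j..i} \<xi> = ln (rho \<beta> (minuses j i \<xi> - {j}) * rho \<beta> (minuses j i \<xi> - {i}) /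
     (rho \<beta> (minuses j i \<xi> - {j, i}) * rho \<beta> (minuses j i \<xi>)))"
proof -
  let ?m = "minuses j i \<xi>" and ?S = "\<Sum>M\<in>Pow {j..i}. rho \<beta> M"
  have "?m \<inter> {j<..i} = ?m - {j}" "?m \<inter> {j..<i} = ?m - {i}" "?m \<inter> {j<..<i} = ?m - {j, i}" "?m \<inter> {j..i} = ?m"
    by (auto simp: minuses_def)
  moreover have "{j<..i} \<subseteq> {j..i}" "{j..<i} \<subseteq> {j..i}" "{j<..<i} \<subseteq> {j..i}" by auto
  ultimately show ?thesis
    using normalization_pos[of "{j..i}"] assms layer_spec_plus_off[OF _ assms(2), of _ j i]
    by (simp add: telescoping_interval Let_def)
qed

lemma telescoping_rho_singleton:
  assumes "\<xi> \<in> UNIV \<rightarrow> {-1, 1}"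
  shows "telescoping \<beta> {i} \<xi> = - ln (rho \<beta> (minuses i i \<xi>))"
proof -
  have "(\<lambda>_::int. 1::real) = plus_off {} \<xi>" by (auto simp: plus_off_def)
  then have "layer_spec \<beta> {i} (\<lambda>_. 1) (\<lambda>_. 1) = 1 / (\<Sum>M\<in>Pow {i..i}. rho \<beta> M)"
    using layer_spec_plus_off[OF _ assms, of "{}" i i] by simp
  moreover have "minuses i i \<xi> \<inter> {i} = minuses i i \<xi>" by (auto simp: minuses_def)
  then have "layer_spec \<beta> {i} (plus_off {i} \<xi>) (\<lambda>_. 1) = rho \<beta> (minuses i i \<xi>) / (\<Sum>M\<in>Pow {i..i}. rho \<beta> M)"
    using layer_spec_plus_off[OF _ assms, of "{i}" i i] by simp
  ultimately show ?thesis
    using normalization_pos[of "{i..i}"] rho_positive[of "minuses i i \<xi>"]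
    by (simp add: telescoping_singleton ln_div)
qed

lemma ln_rho_remove:
  assumes "finite M"
  shows "\<bar>ln (rho \<beta> M) - ln (rho \<beta> (M - {p}))\<bar> \<le> 8 * \<beta>"
proof (cases "p \<in> M")
  case True
  let ?N = "M - {p}"
  have M: "insert p ?N = M" using True by blast
  have fin: "finite ?N" using assms by simp
  have "exp (- 8 * \<beta>) * rho \<beta> ?N \<le> rho \<beta> M" "rho \<beta> M \<le> exp (8 * \<beta>) * rho \<beta> ?N"
    using rho_insert_bounds[OF params fin, of p] M by auto
  then have "ln (exp (- 8 * \<beta>) * rho \<beta> ?N) \<le> ln (rho \<beta> M)" "ln (rho \<beta> M) \<le> ln (exp (8 * \<beta>) * rho \<beta> ?N)"
    using rho_positive[OF fin] rho_positive[OF assms] by (subst ln_le_cancel_iff; simp)+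
  then show ?thesis using rho_positive[OF fin] by (simp add: ln_mult)
qed (use nonneg in simp)

text \<open>Every term of the potential compares layer configurations that differ at single sites, and
  one spin has only four bonds.\<close>
lemma telescoping_bounded:
  assumes "j \<le> i" "\<xi> \<in> UNIV \<rightarrow> {-1, 1}"
  shows "\<bar>telescoping \<beta> {j..i} \<xi>\<bar> \<le> 16 * \<beta>"
proof (cases "j = i")
  case True
  let ?m = "minuses i i \<xi>"
  have m: "?m - {i} = {}" by (auto simp: minuses_def)
  have "\<bar>ln (rho \<beta> ?m)\<bar> \<le> 8 * \<beta>" using ln_rho_remove[of ?m i] unfolding m by simp
  then show ?thesis using True nonneg telescoping_rho_singleton[OF assms(2), of i] by simp
next
  case False
  let ?m = "minuses j i \<xi>"
  have "?m - {j, i} = ?m - {j} - {i}" by blast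
  then have "\<bar>ln (rho \<beta> (?m - {j})) - ln (rho \<beta> (?m - {j, i}))\<bar> \<le> 8 * \<beta>"
    using ln_rho_remove[of "?m - {j}" i] by simp
  moreover have "\<bar>ln (rho \<beta> ?m) - ln (rho \<beta> (?m - {i}))\<bar> \<le> 8 * \<beta>"
    by (rule ln_rho_remove) simp
  moreover have "telescoping \<beta> {j..i} \<xi> = ln (rho \<beta> (?m - {j})) + ln (rho \<beta> (?m - {i})) -
      (ln (rho \<beta> (?m - {j, i})) + ln (rho \<beta> ?m))"
    using False assms telescoping_rho[of j i \<xi>] rho_positive by (simp add: ln_div ln_mult)
  ultimately show ?thesis by linarith
qed

text \<open>If one of the end spins is plus, the four terms cancel in pairs. If both are minus, the
  potential measures by how much the relative weights of these two spins fail to factorize,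
  given the spins in between. The contour that would correlate them has more than \<open>k - 2\<close>
  edges, and at most \<open>k / 18\<close> minus spins lower its cost.\<close>
lemma telescoping_decay:
  assumes k: "2 \<le> k" and \<xi>: "\<xi> \<in> UNIV \<rightarrow> {-1, 1}"
    and few: "18 * card (minuses j (j + int k) \<xi> - {j, j + int k}) \<le> k"
  shows "\<bar>telescoping \<beta> {j..j + int k} \<xi>\<bar> \<le> exp (32 * \<beta>) * 8 / small \<beta> * (1 / 2) ^ k"
proof -
  define i where "i = j + int k"
  have ji: "j + 2 \<le> i" using k by (simp add: i_def)
  define m where "m = minuses j i \<xi>"
  have tele: "telescoping \<beta> {j..i} \<xi> = ln (rho \<beta> (m - {j}) * rho \<beta> (m - {i}) / (rho \<beta> (m - {j, i}) * rho \<beta> m))"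
    unfolding m_def using ji \<xi> by (intro telescoping_rho) auto
  have fm: "finite m" by (simp add: m_def)
  have pos: "rho \<beta> (m - A) > 0" "rho \<beta> m > 0" for A by (simp_all add: rho_positive fm)
  have "\<bar>telescoping \<beta> {j..i} \<xi>\<bar> \<le> exp (32 * \<beta>) * 8 / small \<beta> * (1 / 2) ^ k"
  proof (cases "j \<in> m \<and> i \<in> m")
    case False
    then have "m - {j} = m \<and> m - {j, i} = m - {i} \<or> m - {i} = m \<and> m - {j, i} = m - {j}" by blast
    then have "telescoping \<beta> {j..i} \<xi> = 0"
      unfolding tele using pos(1)[of "{i}"] pos(1)[of "{j}"] pos(2) by (elim disjE conjE) simp_all
    then show ?thesis using small_pos by simp
  next
    case True
    define m0 where "m0 = m - {j, i}"
    let ?r = "rho \<beta> m0"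
    have f0: "finite m0" using fm by (simp add: m0_def)
    have eqs: "m - {j} = insert i m0" "m - {i} = insert j m0" "m = insert j (insert i m0)"
      using True ji by (auto simp: m0_def)
    have r: "?r > 0" by (rule rho_positive[OF f0])
    \<comment> \<open>Both products are bounded below by \<open>?c\<close>, and above this level the logarithm is Lipschitz with constant \<open>1 / ?c\<close>.\<close>
    let ?A = "rho \<beta> (insert i m0) * rho \<beta> (insert j m0)" and ?B = "?r * rho \<beta> (insert j (insert i m0))"
    let ?c = "exp (- 16 * \<beta>) * ?r\<^sup>2"
    have cexp: "exp (- 16 * \<beta>) = exp (- 8 * \<beta>) * exp (- 8 * \<beta>)" by (simp flip: exp_add)
    have ins: "exp (- 8 * \<beta>) * ?r \<le> rho \<beta> (insert p m0)" for p
      using rho_insert_bounds(1)[OF params f0] .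
    have cA: "?c \<le> ?A"
    proof -
      have "(exp (- 8 * \<beta>) * ?r) * (exp (- 8 * \<beta>) * ?r) \<le> ?A"
        using r by (intro mult_mono ins) (auto intro: less_imp_le rho_positive f0)
      then show ?thesis unfolding cexp by (simp only: power2_eq_square mult_ac)
    qed
    have "exp (- 8 * \<beta>) * (exp (- 8 * \<beta>) * ?r) \<le> exp (- 8 * \<beta>) * rho \<beta> (insert i m0)"
      using ins by (intro mult_left_mono) auto
    also have "\<dots> \<le> rho \<beta> (insert j (insert i m0))"
      using rho_insert_bounds(1)[OF params, of "insert i m0" j] f0 by simp
    finally have "?r * (exp (- 8 * \<beta>) * (exp (- 8 * \<beta>) * ?r)) \<le> ?B"
      using r by (intro mult_left_mono) auto
    then have cB: "?c \<le> ?B" unfolding cexp by (simp only: power2_eq_square mult_ac)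
    have "telescoping \<beta> {j..i} \<xi> = ln ?A - ln ?B"
      unfolding tele m0_def[symmetric] unfolding eqs(1,2) by (subst eqs(3)) (simp add: ln_div rho_positive f0)
    then have "\<bar>telescoping \<beta> {j..i} \<xi>\<bar> \<le> \<bar>?A - ?B\<bar> / ?c"
      using ln_diff_le[OF _ cA cB] r by simp
    also have "\<bar>?A - ?B\<bar> \<le> exp (16 * \<beta>) * 8 * (small \<beta> ^ nat (i - j - 1) * exp (32 * \<beta> * real (card m0))) * ?r\<^sup>2"
      using rho_covariance[OF params f0 ji] by (simp add: abs_minus_commute mult.commute)
    then have "\<bar>?A - ?B\<bar> / ?c \<le> exp (16 * \<beta>) * 8 * (small \<beta> ^ nat (i - j - 1) * exp (32 * \<beta> * real (card m0))) * ?r\<^sup>2 / ?c"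
      using r by (intro divide_right_mono) auto
    also have "\<dots> = exp (32 * \<beta>) * 8 * (small \<beta> ^ nat (i - j - 1) * exp (32 * \<beta> * real (card m0)))"
    proof -
      have "exp (32 * \<beta>) = exp (16 * \<beta>) * exp (16 * \<beta>)" by (simp flip: exp_add)
      then show ?thesis using r by (simp add: exp_minus field_simps)
    qed
    also have "\<dots> \<le> exp (32 * \<beta>) * 8 * ((1 / 2) ^ k / small \<beta>)"
    proof (intro mult_left_mono)
      have few': "18 * real (card m0) \<le> real k"
        using few by (simp add: m0_def m_def i_def)
      have "32 * \<beta> * real (card m0) = (16 * \<beta> / 9) * (18 * real (card m0))" by simp
      also have "\<dots> \<le> (16 * \<beta> / 9) * real k" using few' nonneg by (intro mult_left_mono) auto
      finally have "exp (32 * \<beta> * real (card m0)) \<le> exp (16 * \<beta> / 9) ^ k"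
        by (simp add: mult.commute flip: exp_of_nat_mult)
      then have "small \<beta> ^ k * exp (32 * \<beta> * real (card m0)) \<le> small \<beta> ^ k * exp (16 * \<beta> / 9) ^ k"
        using small_pos by (intro mult_left_mono) auto
      also have "\<dots> = (small \<beta> * exp (16 * \<beta> / 9)) ^ k" by (simp add: power_mult_distrib)
      also have "\<dots> \<le> (1 / 2) ^ k" using small_times small_pos by (intro power_mono) auto
      finally have *: "small \<beta> ^ k * exp (32 * \<beta> * real (card m0)) \<le> (1 / 2) ^ k" .
      have "nat (i - j - 1) = k - 1" by (simp add: i_def)
      then have "small \<beta> ^ nat (i - j - 1) = small \<beta> ^ k / small \<beta>"
        using k small_pos by (simp add: power_diff)
      then show "small \<beta> ^ nat (i - j - 1) * exp (32 * \<beta> * real (card m0)) \<le> (1 / 2) ^ k / small \<beta>"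
        using divide_right_mono[OF *, of "small \<beta>"] small_pos by simp
    qed auto
    finally show ?thesis by simp
  qed
  then show ?thesis by (simp add: i_def)
qed

lemma minuses_shift: "minuses (j + a) (i + a) \<xi> = (+) a ` minuses j i (\<lambda>l. \<xi> (l + a))"
proof (intro set_eqI iffI)
  fix l assume "l \<in> minuses (j + a) (i + a) \<xi>"
  then have "l - a \<in> minuses j i (\<lambda>l. \<xi> (l + a))" by (auto simp: minuses_def)
  then show "l \<in> (+) a ` minuses j i (\<lambda>l. \<xi> (l + a))" by (intro image_eqI[of _ _ "l - a"]) auto
qed (auto simp: minuses_def add.commute)

lemma telescoping_shift:
  assumes "j \<le> i" "\<xi> \<in> UNIV \<rightarrow> {-1, 1}"
  shows "telescoping \<beta> {j + a..i + a} \<xi> = telescoping \<beta> {j..i} (\<lambda>l. \<xi> (l + a))"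
proof -
  let ?\<xi> = "\<lambda>l. \<xi> (l + a)"
  let ?m = "minuses j i ?\<xi>"
  have \<xi>': "?\<xi> \<in> UNIV \<rightarrow> {-1, 1}" using assms(2) by auto
  have img: "(+) a ` ?m - {j + a} = (+) a ` (?m - {j})" "(+) a ` ?m - {i + a} = (+) a ` (?m - {i})"
    "(+) a ` ?m - {j + a, i + a} = (+) a ` (?m - {j, i})" by (auto simp: image_iff)
  show ?thesis
  proof (cases "j = i")
    case True
    then show ?thesis
      using telescoping_rho_singleton[OF assms(2), of "i + a"] telescoping_rho_singleton[OF \<xi>', of i]
      by (simp add: minuses_shift rho_shift[OF params])
  next
    case False
    then show ?thesis
      using telescoping_rho[OF _ assms(2), of "j + a" "i + a"] telescoping_rho[OF _ \<xi>', of j i] assms(1)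
      by (simp add: minuses_shift img rho_shift[OF params])
  qed
qed

lemma telescoping_local:
  assumes "j \<le> i" "\<xi> \<in> UNIV \<rightarrow> {-1, 1}" "\<xi>' \<in> UNIV \<rightarrow> {-1, 1}" "minuses j i \<xi> = minuses j i \<xi>'"
  shows "telescoping \<beta> {j..i} \<xi> = telescoping \<beta> {j..i} \<xi>'"
proof (cases "j = i")
  case True
  then show ?thesis using assms by (simp add: telescoping_rho_singleton)
next
  case False
  then show ?thesis using assms by (simp add: telescoping_rho)
qed

end

lemma low_temperature_above: "\<beta> \<ge> 9 / 2 * ln 2048 \<Longrightarrow> low_temperature \<beta>"
proof
  assume \<beta>: "\<beta> \<ge> 9 / 2 * ln 2048"
  have "0 \<le> ln (2048 :: real)" by (rule ln_ge_zero) simp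
  then show "0 \<le> \<beta>" using \<beta> by linarith
  have "2048 = exp (ln (2048 :: real))" by simp
  also have "\<dots> \<le> exp (2 * \<beta> / 9)" using \<beta> by (subst exp_le_cancel_iff) simp
  finally show "2048 \<le> exp (2 * \<beta> / 9)" .
qed

section \<open>Integrals of the potential\<close>

locale layer_measure = low_temperature +
  fixes \<mu> :: "(int \<Rightarrow> real) measure" and \<alpha> c :: real
  assumes prob: "prob_space \<mu>" and sets_eq: "sets \<mu> = sets Omega"
    and invariant: "\<And>a :: int. distr \<mu> Omega (\<lambda>\<sigma> i. \<sigma> (i + a)) = \<mu>"
    and \<alpha>: "1 \<le> \<alpha>" and c: "0 < c"
    and tail: "\<And>n. 1 \<le> n \<Longrightarrow> \<P>(\<sigma> in \<mu>. l_plus \<alpha> 0 \<sigma> > enat n) \<le> exp (- c * real n)"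
begin

sublocale prob_space \<mu>
  by (rule prob)

abbreviation U :: "int set \<Rightarrow> (int \<Rightarrow> real) \<Rightarrow> real" where
  "U \<equiv> telescoping \<beta>"

lemma space_eq: "space \<mu> = UNIV \<rightarrow> {-1, 1}"
  using sets_eq_imp_space_eq[OF sets_eq] by (simp add: Omega_def space_PiM PiE_UNIV_domain)

lemma coordinate_measurable [measurable]: "(\<lambda>\<xi>. \<xi> l) \<in> borel_measurable \<mu>"
proof -
  have "(\<lambda>\<xi>. \<xi> l) \<in> measurable Omega (count_space {-1, 1})"
    unfolding Omega_def by (rule measurable_component_singleton) simp
  then have "(\<lambda>\<xi>. \<xi> l) \<in> measurable \<mu> (count_space {-1, 1})"
    by (simp add: measurable_cong_sets[OF sets_eq refl])
  then show ?thesis by (rule measurable_compose) simp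
qed

lemma U_measurable_interval:
  assumes "j \<le> i"
  shows "U {j..i} \<in> borel_measurable \<mu>"
proof -
  \<comment> \<open>The potential sees the configuration only through its minus sites in the interval, of which there are finitely many sets.\<close>
  define v where "v M = U {j..i} (\<lambda>l. if l \<in> M then -1 else 1)" for M
  have v: "U {j..i} \<xi> = v (minuses j i \<xi>)" if "\<xi> \<in> space \<mu>" for \<xi>
    unfolding v_def using that assms space_eq
    by (intro telescoping_local) (auto simp: minuses_def)
  have "(\<lambda>\<xi>. minuses j i \<xi>) \<in> measurable \<mu> (count_space (Pow {j..i}))"
  proof (subst measurable_count_space_eq2, simp, intro conjI ballI)
    show "(\<lambda>\<xi>. minuses j i \<xi>) \<in> space \<mu> \<rightarrow> Pow {j..i}" by (auto simp: minuses_def)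
    fix M assume M: "M \<in> Pow {j..i}"
    have "(\<lambda>\<xi>. minuses j i \<xi>) -` {M} \<inter> space \<mu> = {\<xi> \<in> space \<mu>. \<forall>l\<in>{j..i}. (\<xi> l = -1) = (l \<in> M)}"
    proof -
      have "minuses j i \<xi> = M \<longleftrightarrow> (\<forall>l\<in>{j..i}. (\<xi> l = -1) = (l \<in> M))" for \<xi>
        using M unfolding minuses_def set_eq_iff by blast
      then show ?thesis by auto
    qed
    also have "\<dots> \<in> sets \<mu>"
    proof (rule sets.sets_Collect_finite_All')
      fix l
      show "{\<xi> \<in> space \<mu>. (\<xi> l = -1) = (l \<in> M)} \<in> sets \<mu>" by measurable
    qed (use assms in auto)
    finally show "(\<lambda>\<xi>. minuses j i \<xi>) -` {M} \<inter> space \<mu> \<in> sets \<mu>" .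
  qed
  then have "(\<lambda>\<xi>. v (minuses j i \<xi>)) \<in> borel_measurable \<mu>" by (rule measurable_compose) simp
  then show ?thesis using v by (simp cong: measurable_cong)
qed

lemma U_integrable_interval: "j \<le> i \<Longrightarrow> integrable \<mu> (U {j..i})"
  using telescoping_bounded[of j i] space_eq
  by (intro integrable_const_bound[where B = "16 * \<beta>"] U_measurable_interval) auto

lemma U_integrable: "integrable \<mu> (U A)"
proof (cases "\<exists>j i. j \<le> i \<and> A = {j..i}")
  case True
  then show ?thesis using U_integrable_interval by blast
next
  case False
  then have "U A = (\<lambda>_. 0)" using telescoping_other by blast
  then show ?thesis by simp
qed

lemma shift_measurable: "(\<lambda>\<sigma> i. \<sigma> (i + a)) \<in> measurable \<mu> Omega"
  unfolding Omega_def
proof (rule measurable_PiM_single')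
  fix i :: int
  have "(\<lambda>\<xi>. \<xi> (i + a)) \<in> measurable Omega (count_space {-1, 1})"
    unfolding Omega_def by (rule measurable_component_singleton) simp
  then show "(\<lambda>\<xi>. \<xi> (i + a)) \<in> measurable \<mu> (count_space {-1, 1})"
    by (simp add: measurable_cong_sets[OF sets_eq refl])
qed (auto simp: space_eq)

lemma integral_shift:
  fixes g :: "real \<Rightarrow> real"
  assumes "j \<le> i" and g[measurable]: "g \<in> borel_measurable borel"
  shows "(\<integral>\<xi>. g (U {j + a..i + a} \<xi>) \<partial>\<mu>) = (\<integral>\<xi>. g (U {j..i} \<xi>) \<partial>\<mu>)"
proof -
  have "(\<lambda>\<xi>. g (U {j..i} \<xi>)) \<in> borel_measurable \<mu>"
    using measurable_compose[OF U_measurable_interval[OF assms(1)] g] .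
  then have m: "(\<lambda>\<xi>. g (U {j..i} \<xi>)) \<in> borel_measurable Omega"
    by (simp add: measurable_cong_sets[OF sets_eq refl])
  have "(\<integral>\<xi>. g (U {j + a..i + a} \<xi>) \<partial>\<mu>) = (\<integral>\<xi>. g (U {j..i} (\<lambda>l. \<xi> (l + a))) \<partial>\<mu>)"
    using telescoping_shift[OF assms(1)] space_eq by (intro Bochner_Integration.integral_cong) auto
  also have "\<dots> = (\<integral>\<xi>. g (U {j..i} \<xi>) \<partial>distr \<mu> Omega (\<lambda>\<sigma> i. \<sigma> (i + a)))"
    by (rule integral_distr[OF shift_measurable m, symmetric])
  finally show ?thesis by (simp add: invariant)
qed

definition u :: "nat \<Rightarrow> real" where
  "u k = (\<integral>\<xi>. U {0..int k} \<xi> \<partial>\<mu>)"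

definition u_abs :: "nat \<Rightarrow> real" where
  "u_abs k = (\<integral>\<xi>. \<bar>U {0..int k} \<xi>\<bar> \<partial>\<mu>)"

lemma integral_U: "(\<integral>\<xi>. U {j..j + int k} \<xi> \<partial>\<mu>) = u k"
  using integral_shift[of 0 "int k" "\<lambda>x. x" j] by (simp add: u_def add.commute)

lemma integral_abs_U: "(\<integral>\<xi>. \<bar>U {j..j + int k} \<xi>\<bar> \<partial>\<mu>) = u_abs k"
  using integral_shift[of 0 "int k" abs j] by (simp add: u_abs_def add.commute)

lemma abs_u_le: "\<bar>u k\<bar> \<le> u_abs k"
  unfolding u_def u_abs_def by (rule integral_abs_bound)

lemma l_plus_le_iff:
  "\<not> l_plus \<alpha> 0 \<xi> > enat k \<longleftrightarrow>
    (\<exists>n\<in>{1..k}. \<forall>m\<ge>n. (1 / real m) * (\<Sum>j<m. \<xi> (0 + int j)) \<ge> 8 / 9 * \<alpha>)"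
proof -
  have ex: "(\<exists>x\<in>{enat n | n. P n}. x < enat (Suc k)) \<longleftrightarrow> (\<exists>n. P n \<and> n < Suc k)" for P by fastforce
  have le_iff: "x \<le> enat k \<longleftrightarrow> x < enat (Suc k)" for x by (cases x) auto
  show ?thesis
    unfolding not_less le_iff l_plus_def Inf_less_iff ex by (auto simp: less_Suc_eq_le)
qed

text \<open>An average spin of at least \<open>8 / 9\<close> means that at most one spin out of 18 is minus.\<close>
lemma few_minuses:
  assumes "\<xi> \<in> space \<mu>" "k \<ge> 1" "\<not> l_plus \<alpha> 0 \<xi> > enat k"
  shows "18 * card (minuses 0 (int k) \<xi> - {0, int k}) \<le> k"
proof -
  have "(1 / real k) * (\<Sum>j<k. \<xi> (int j)) \<ge> 8 / 9 * \<alpha>"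
    using assms(3) unfolding l_plus_le_iff by auto
  then have "(\<Sum>j<k. \<xi> (int j)) \<ge> 8 / 9 * \<alpha> * real k"
    using assms(2) by (simp add: field_simps)
  moreover have "8 / 9 * \<alpha> * real k \<ge> 8 / 9 * real k"
    using \<alpha> by (intro mult_right_mono) auto
  ultimately have sum: "(\<Sum>j<k. \<xi> (int j)) \<ge> 8 / 9 * real k" by linarith
  let ?N = "{j \<in> {..<k}. \<xi> (int j) = -1}"
  have "(\<Sum>j<k. \<xi> (int j)) = (\<Sum>j<k. 1 - 2 * (if \<xi> (int j) = -1 then 1 else 0))"
    using assms(1) space_eq by (intro sum.cong) auto
  also have "\<dots> = real k - 2 * real (card ?N)"
    by (simp add: sum_subtractf sum.If_cases Int_def flip: sum_distrib_left)
  finally have "18 * real (card ?N) \<le> real k" using sum by linarith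
  then have N: "18 * card ?N \<le> k" by linarith
  have "minuses 0 (int k) \<xi> - {0, int k} \<subseteq> int ` ?N"
  proof
    fix l assume l: "l \<in> minuses 0 (int k) \<xi> - {0, int k}"
    then have "nat l \<in> ?N" "l = int (nat l)" by (auto simp: minuses_def)
    then show "l \<in> int ` ?N" by blast
  qed
  then have "card (minuses 0 (int k) \<xi> - {0, int k}) \<le> card ?N"
    by (intro surj_card_le) auto
  with N show ?thesis by linarith
qed

lemma l_plus_measurable: "{\<xi> \<in> space \<mu>. l_plus \<alpha> 0 \<xi> > enat k} \<in> sets \<mu>"
proof -
  have "{\<xi> \<in> space \<mu>. \<exists>n\<in>{1..k}. \<forall>m\<ge>n. (1 / real m) * (\<Sum>j<m. \<xi> (0 + int j)) \<ge> 8 / 9 * \<alpha>} \<in> sets \<mu>"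
    by measurable
  then have "{\<xi> \<in> space \<mu>. \<not> l_plus \<alpha> 0 \<xi> > enat k} \<in> sets \<mu>"
    unfolding l_plus_le_iff .
  then show ?thesis using sets.sets_Collect_neg by fastforce
qed

text \<open>Either the density of minus spins is small, and the potential decays pointwise, or it is
  not, which has exponentially small probability while the potential stays bounded.\<close>
lemma u_abs_le:
  assumes "k \<ge> 2"
  shows "u_abs k \<le> 16 * \<beta> * exp (- c) ^ k + exp (32 * \<beta>) * 8 / small \<beta> * (1 / 2) ^ k"
proof -
  let ?B = "{\<xi> \<in> space \<mu>. l_plus \<alpha> 0 \<xi> > enat k}" and ?D = "exp (32 * \<beta>) * 8 / small \<beta> * (1 / 2) ^ k"
  have D: "?D \<ge> 0" using small_pos by simp
  have pt: "\<bar>U {0..int k} \<xi>\<bar> \<le> 16 * \<beta> * indicator ?B \<xi> + ?D" if \<xi>: "\<xi> \<in> space \<mu>" for \<xi>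
  proof (cases "\<xi> \<in> ?B")
    case True
    then show ?thesis using telescoping_bounded[of 0 "int k" \<xi>] \<xi> space_eq D by simp
  next
    case False
    then have "18 * card (minuses 0 (int k) \<xi> - {0, int k}) \<le> k"
      using few_minuses[OF \<xi>] \<xi> assms by simp
    then show ?thesis using telescoping_decay[OF assms, of \<xi> 0] False \<xi> space_eq by simp
  qed
  have intB: "integrable \<mu> (\<lambda>\<xi>. 16 * \<beta> * indicat_real ?B \<xi>)"
    using l_plus_measurable by (intro integrable_mult_right integrable_real_indicator) (auto simp: less_top[symmetric])
  have "u_abs k \<le> (\<integral>\<xi>. 16 * \<beta> * indicator ?B \<xi> + ?D \<partial>\<mu>)"
    unfolding u_abs_def
  proof (rule integral_mono)
    show "integrable \<mu> (\<lambda>\<xi>. 16 * \<beta> * indicat_real ?B \<xi> + ?D)"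
      by (intro Bochner_Integration.integrable_add intB integrable_const)
    show "integrable \<mu> (\<lambda>\<xi>. \<bar>U {0..int k} \<xi>\<bar>)" using U_integrable by (rule integrable_abs)
  qed (rule pt)
  also have "\<dots> = 16 * \<beta> * prob ?B + ?D"
    by (subst Bochner_Integration.integral_add[OF intB integrable_const])
      (auto simp: prob_space intro!: arg_cong[where f = prob])
  also have "\<dots> \<le> 16 * \<beta> * exp (- c) ^ k + ?D"
  proof -
    have "prob ?B \<le> exp (- c * real k)" using tail[of k] assms by simp
    also have "\<dots> = exp (- c) ^ k" by (simp add: mult.commute flip: exp_of_nat_mult)
    finally show ?thesis using nonneg by (simp add: mult_left_mono)
  qed
  finally show ?thesis .
qed

lemma u_abs_summable: "summable u_abs"
proof (rule summable_comparison_test)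
  show "\<exists>N. \<forall>n\<ge>N. norm (u_abs n) \<le> 16 * \<beta> * exp (- c) ^ n + exp (32 * \<beta>) * 8 / small \<beta> * (1 / 2) ^ n"
    using u_abs_le by (intro exI[of _ 2]) (auto simp: u_abs_def)
  show "summable (\<lambda>n. 16 * \<beta> * exp (- c) ^ n + exp (32 * \<beta>) * 8 / small \<beta> * (1 / 2) ^ n)"
    using c by (intro summable_add summable_mult summable_geometric) auto
qed

end

section \<open>The thermodynamic limit\<close>

definition placements :: "int set \<Rightarrow> nat \<Rightarrow> int set" where
  "placements V k = {j. {j..j + int k} \<subseteq> V}"

lemma placements_subset: "placements V k \<subseteq> V"
  by (auto simp: placements_def)

text \<open>A site \<open>j \<in> V\<close> that is not the left end of a segment inside \<open>V\<close> sees the segment leave \<open>V\<close>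
  after \<open>l < k\<close> steps, and the last site before is a boundary site. It is recovered from that
  boundary site and \<open>l\<close>.\<close>
lemma lost_placements:
  assumes "finite V"
  shows "card V \<le> card (placements V k) + k * card (boundary V)"
proof -
  have finb: "finite (boundary V)" using assms by (simp add: boundary_def)
  have "V - placements V k \<subseteq> (\<Union>l<k. (\<lambda>b. b - int l) ` boundary V)"
  proof
    fix j assume j: "j \<in> V - placements V k"
    then have "\<not> {j..j + int k} \<subseteq> V" by (simp add: placements_def)
    then obtain x where x: "j \<le> x" "x \<le> j + int k" "x \<notin> V" by force
    define m where "m = (LEAST m. j + int m \<notin> V)"
    have "j + int (nat (x - j)) \<notin> V" using x by simp
    then have m: "j + int m \<notin> V" "m \<le> nat (x - j)"
      unfolding m_def by (rule LeastI, rule Least_le)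
    have "m \<noteq> 0" using m(1) j by (cases m) auto
    then obtain l where l: "m = Suc l" using not0_implies_Suc by blast
    have "j + int l \<in> V" using not_less_Least[of l "\<lambda>m. j + int m \<notin> V"] l by (auto simp: m_def)
    then have "j + int l \<in> boundary V" using m(1) l by (auto simp: boundary_def algebra_simps)
    moreover have "l < k" using l m(2) x by linarith
    ultimately show "j \<in> (\<Union>l<k. (\<lambda>b. b - int l) ` boundary V)"
      by (intro UN_I[of l] image_eqI[of _ _ "j + int l"]) auto
  qed
  then have "card (V - placements V k) \<le> card (\<Union>l<k. (\<lambda>b. b - int l) ` boundary V)"
    using finb by (intro card_mono) auto
  also have "\<dots> \<le> (\<Sum>l<k. card ((\<lambda>b. b - int l) ` boundary V))" by (rule card_UN_le) simp
  also have "\<dots> \<le> (\<Sum>l<k. card (boundary V))" using finb by (intro sum_mono card_image_le)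
  finally have "card (V - placements V k) \<le> k * card (boundary V)" by simp
  moreover have "card (V - placements V k) = card V - card (placements V k)"
    using assms placements_subset finite_subset by (metis card_Diff_subset)
  ultimately show ?thesis by linarith
qed

lemma placements_density:
  "((\<lambda>V. real (card (placements V k)) / real (card V)) \<longlongrightarrow> 1) thermodynamic"
proof (rule tendstoI)
  fix e :: real assume e: "e > 0"
  let ?d = "e / (real k + 1) / 2"
  have d: "?d > 0" using e by simp
  have close: "dist (real (card (placements V k)) / real (card V)) 1 < e"
    if V: "finite V" "{0} \<subseteq> V" "real (card (boundary V)) \<le> ?d * real (card V)" for V
  proof -
    have pos: "real (card V) > 0" using V by (auto simp: card_gt_0_iff)
    have le: "card (placements V k) \<le> card V"
      using V(1) placements_subset by (intro card_mono)
    have "real (card V) \<le> real (card (placements V k)) + real k * real (card (boundary V))"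
      using lost_placements[OF V(1), of k] by (metis of_nat_add of_nat_le_iff of_nat_mult)
    also have "real k * real (card (boundary V)) \<le> real k * (?d * real (card V))"
      using V(3) by (intro mult_left_mono) auto
    finally have "real (card V) - real (card (placements V k)) \<le> real k * ?d * real (card V)" by simp
    moreover have "real k * ?d < e"
    proof -
      have "real k * ?d = e * (real k / ((real k + 1) * 2))" by simp
      also have "\<dots> < e * 1" using e by (intro mult_strict_left_mono) auto
      finally show ?thesis by simp
    qed
    then have "real k * ?d * real (card V) < e * real (card V)" using pos by (rule mult_strict_right_mono)
    ultimately have "real (card V) - real (card (placements V k)) < e * real (card V)" by linarith
    then have "1 - real (card (placements V k)) / real (card V) < e" using pos by (simp add: field_simps)
    moreover have "real (card (placements V k)) / real (card V) \<le> 1" using pos le by simp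
    ultimately show ?thesis by (simp add: dist_real_def abs_if)
  qed
  show "\<forall>\<^sub>F V in thermodynamic. dist (real (card (placements V k)) / real (card V)) 1 < e"
    unfolding eventually_thermodynamic using close d by (intro exI[of _ "{0}"] exI[of _ ?d]) auto
qed

lemma thermodynamic_neq_bot: "thermodynamic \<noteq> bot"
proof
  assume "thermodynamic = bot"
  then have "eventually (\<lambda>_. False) thermodynamic" by simp
  with filterlim_intervals_thermodynamic have "eventually (\<lambda>n. False) sequentially"
    by (rule eventually_compose_filterlim[rotated])
  then show False by simp
qed

context layer_measure
begin

text \<open>Only intervals carry potential, and by translation invariance the integral depends on their
  length alone.\<close>
lemma integral_H_free:
  assumes "finite V"
  shows "(\<integral>\<xi>. H_free U V \<xi> \<partial>\<mu>) = (\<Sum>k. real (card (placements V k)) * u k)"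
proof -
  let ?I = "SIGMA k:{..<card V}. placements V k" and ?J = "\<lambda>(k, j). {j..j + int k}"
  let ?F = "\<lambda>A. \<integral>\<xi>. U A \<xi> \<partial>\<mu>"
  have finp: "finite (placements V k)" for k using finite_subset[OF placements_subset assms] .
  have kV: "k < card V" if "j \<in> placements V k" for j k
  proof -
    have "card {j..j + int k} \<le> card V"
      using that assms by (intro card_mono) (auto simp: placements_def)
    then show ?thesis by simp
  qed
  have inj: "inj_on ?J ?I" by (rule inj_onI) (auto simp: Icc_eq_Icc)
  have "(\<integral>\<xi>. H_free U V \<xi> \<partial>\<mu>) = (\<Sum>A\<in>Pow V. ?F A)"
    unfolding H_free_def by (rule Bochner_Integration.integral_sum) (rule U_integrable)
  also have "\<dots> = (\<Sum>A\<in>?J ` ?I. ?F A)"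
  proof (rule sum.mono_neutral_right)
    show "\<forall>A\<in>Pow V - ?J ` ?I. ?F A = 0"
    proof
      fix A assume A: "A \<in> Pow V - ?J ` ?I"
      have "A \<noteq> {j..i}" if "j \<le> i" for j i
      proof
        assume Aji: "A = {j..i}"
        have "j + int (nat (i - j)) = i" using that by simp
        with A Aji have "j \<in> placements V (nat (i - j))" by (auto simp: placements_def)
        moreover from this have "nat (i - j) < card V" by (rule kV)
        ultimately have "?J (nat (i - j), j) \<in> ?J ` ?I" by (intro imageI) auto
        with A Aji that show False by simp
      qed
      then have "U A \<xi> = 0" for \<xi> by (rule telescoping_other)
      then show "?F A = 0" by simp
    qed
  qed (use assms in \<open>auto simp: placements_def\<close>)
  also have "\<dots> = (\<Sum>p\<in>?I. ?F (?J p))" by (rule sum.reindex[OF inj, unfolded o_def])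
  also have "\<dots> = (\<Sum>k<card V. \<Sum>j\<in>placements V k. u k)"
    using finp by (subst sum.Sigma) (auto simp: integral_U intro!: sum.cong)
  also have "\<dots> = (\<Sum>k<card V. real (card (placements V k)) * u k)" by simp
  also have "\<dots> = (\<Sum>k. real (card (placements V k)) * u k)"
    using kV by (intro suminf_finite[symmetric]) (fastforce simp: card_eq_0_iff)+
  finally show ?thesis .
qed

text \<open>The contribution of the interval of length \<open>k\<close> steps in which \<open>l\<close> sites precede the origin.\<close>
definition share :: "nat \<Rightarrow> nat \<Rightarrow> (int \<Rightarrow> real) \<Rightarrow> real" where
  "share k l \<xi> = 1 / (real k + 1) * U {- int l..- int l + int k} \<xi>"

definition abs_share :: "nat \<Rightarrow> (int \<Rightarrow> real) \<Rightarrow> real" where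
  "abs_share k \<xi> = (\<Sum>l\<le>k. \<bar>share k l \<xi>\<bar>)"

text \<open>Unconditional summability of reals is absolute summability, which makes it possible to sum
  first over the \<open>k + 1\<close> positions of an interval and then over \<open>k\<close>. The case distinction
  describes the function everywhere and not only almost everywhere; this gives its
  measurability.\<close>
lemma f_pot_eq:
  "f_pot U \<xi> = (if summable (\<lambda>k. abs_share k \<xi>) then (\<Sum>k. \<Sum>l\<le>k. share k l \<xi>) else 0)"
proof -
  let ?S = "{A. finite A \<and> (0 :: int) \<in> A}" and ?I = "SIGMA k:(UNIV :: nat set). {..k}"
  let ?J = "\<lambda>(k, l). {- int l..- int l + int k}"
  let ?F = "\<lambda>A. 1 / real (card A) * U A \<xi>"
  have inj: "inj_on ?J ?I" by (rule inj_onI) (auto simp: Icc_eq_Icc)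
  have sub: "?J ` ?I \<subseteq> ?S" by auto
  have zero: "?F A = 0" if A: "A \<in> ?S - ?J ` ?I" for A
  proof -
    have "A \<noteq> {j..i}" if "j \<le> i" for j i
    proof
      assume Aji: "A = {j..i}"
      with A have "j \<le> 0" "0 \<le> i" by auto
      then have "?J (nat (i - j), nat (- j)) = A" "(nat (i - j), nat (- j)) \<in> ?I" using Aji by auto
      with A show False by blast
    qed
    then have "U A \<xi> = 0" by (rule telescoping_other)
    then show ?thesis by simp
  qed
  have FJ: "?F \<circ> ?J = (\<lambda>(k, l). share k l \<xi>)"
    by (auto simp: fun_eq_iff share_def)
  have iS: "infsum ?F ?S = infsum (\<lambda>(k, l). share k l \<xi>) ?I"
  proof -
    have "infsum ?F ?S = infsum ?F (?J ` ?I)" using zero sub by (intro infsum_cong_neutral) auto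
    also have "\<dots> = infsum (?F \<circ> ?J) ?I" by (rule infsum_reindex[OF inj])
    finally show ?thesis unfolding FJ .
  qed
  have sS: "(\<lambda>(k, l). share k l \<xi>) summable_on ?I \<longleftrightarrow> summable (\<lambda>k. abs_share k \<xi>)"
  proof -
    have "(\<lambda>(k, l). share k l \<xi>) summable_on ?I \<longleftrightarrow> (\<lambda>p. norm ((\<lambda>(k, l). share k l \<xi>) p)) summable_on ?I"
      by (rule summable_on_iff_abs_summable_on_real)
    also have "\<dots> \<longleftrightarrow> (\<lambda>k. norm (abs_share k \<xi>)) summable_on UNIV"
      by (subst Infinite_Sum.abs_summable_on_Sigma_iff) (simp add: abs_share_def)
    also have "\<dots> \<longleftrightarrow> summable (\<lambda>k. abs_share k \<xi>)"
    proof -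
      have nn: "abs_share k \<xi> \<ge> 0" for k by (simp add: abs_share_def sum_nonneg)
      then show ?thesis by (simp add: summable_on_UNIV_nonneg_real_iff)
    qed
    finally show ?thesis .
  qed
  show ?thesis
  proof (cases "summable (\<lambda>k. abs_share k \<xi>)")
    case True
    have "infsum (\<lambda>(k, l). share k l \<xi>) ?I = infsum (\<lambda>k. infsum (\<lambda>l. share k l \<xi>) {..k}) UNIV"
      by (rule infsum_Sigma'_banach[symmetric]) (use sS True in simp)
    also have "\<dots> = infsum (\<lambda>k. \<Sum>l\<le>k. share k l \<xi>) UNIV" by simp
    also have "\<dots> = (\<Sum>k. \<Sum>l\<le>k. share k l \<xi>)"
    proof (rule infsumI, rule norm_summable_imp_has_sum)
      show sn: "summable (\<lambda>k. norm (\<Sum>l\<le>k. share k l \<xi>))"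
        by (rule summable_comparison_test[OF _ True]) (auto simp: abs_share_def intro!: exI[of _ 0] sum_abs)
      show "(\<lambda>k. \<Sum>l\<le>k. share k l \<xi>) sums (\<Sum>k. \<Sum>l\<le>k. share k l \<xi>)"
        using summable_norm_cancel[OF sn] by (rule summable_sums)
    qed
    finally show ?thesis unfolding f_pot_def iS using True by simp
  next
    case False
    then have "infsum (\<lambda>(k, l). share k l \<xi>) ?I = 0" using sS infsum_not_exists by blast
    then show ?thesis unfolding f_pot_def iS using False by simp
  qed
qed

lemma share_integrable: "integrable \<mu> (share k l)"
  unfolding share_def by (intro integrable_mult_right U_integrable)

lemma integral_share: "(\<integral>\<xi>. (\<Sum>l\<le>k. share k l \<xi>) \<partial>\<mu>) = u k"
proof -
  have "(\<integral>\<xi>. (\<Sum>l\<le>k. share k l \<xi>) \<partial>\<mu>) = (\<Sum>l\<le>k. \<integral>\<xi>. share k l \<xi> \<partial>\<mu>)"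
    by (rule Bochner_Integration.integral_sum) (rule share_integrable)
  also have "\<dots> = (\<Sum>l\<le>k. 1 / (real k + 1) * u k)"
    by (intro sum.cong refl) (simp only: share_def integral_mult_right_zero integral_U)
  also have "\<dots> = u k"
    by (simp add: field_simps add_nonneg_eq_0_iff)
  finally show ?thesis .
qed

lemma abs_share_integrable: "integrable \<mu> (abs_share k)"
  unfolding abs_share_def using share_integrable by (intro Bochner_Integration.integrable_sum integrable_abs)

lemma integral_abs_share: "(\<integral>\<xi>. abs_share k \<xi> \<partial>\<mu>) = u_abs k"
proof -
  have "(\<integral>\<xi>. abs_share k \<xi> \<partial>\<mu>) = (\<Sum>l\<le>k. \<integral>\<xi>. \<bar>share k l \<xi>\<bar> \<partial>\<mu>)"
    unfolding abs_share_def using share_integrable by (intro Bochner_Integration.integral_sum integrable_abs)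
  also have "\<dots> = (\<Sum>l\<le>k. 1 / (real k + 1) * u_abs k)"
  proof (intro sum.cong refl)
    fix l
    have "(\<integral>\<xi>. \<bar>share k l \<xi>\<bar> \<partial>\<mu>) = (\<integral>\<xi>. 1 / (real k + 1) * \<bar>U {- int l..- int l + int k} \<xi>\<bar> \<partial>\<mu>)"
      by (simp add: share_def abs_mult)
    then show "(\<integral>\<xi>. \<bar>share k l \<xi>\<bar> \<partial>\<mu>) = 1 / (real k + 1) * u_abs k"
      by (simp only: integral_mult_right_zero integral_abs_U)
  qed
  also have "\<dots> = u_abs k"
    by (simp add: field_simps add_nonneg_eq_0_iff)
  finally show ?thesis .
qed

lemma AE_summable: "AE \<xi> in \<mu>. summable (\<lambda>k. abs_share k \<xi>)"
proof -
  have [measurable]: "abs_share k \<in> borel_measurable \<mu>" for k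
    using abs_share_integrable by (rule borel_measurable_integrable)
  have nn: "abs_share k \<xi> \<ge> 0" for k \<xi> by (simp add: abs_share_def sum_nonneg)
  have "(\<integral>\<^sup>+\<xi>. (\<Sum>k. ennreal (abs_share k \<xi>)) \<partial>\<mu>) = (\<Sum>k. \<integral>\<^sup>+\<xi>. ennreal (abs_share k \<xi>) \<partial>\<mu>)"
    by (rule nn_integral_suminf) simp
  also have "\<dots> = (\<Sum>k. ennreal (u_abs k))"
    using nn by (simp add: nn_integral_eq_integral[OF abs_share_integrable] integral_abs_share)
  finally have eq: "(\<integral>\<^sup>+\<xi>. (\<Sum>k. ennreal (abs_share k \<xi>)) \<partial>\<mu>) = (\<Sum>k. ennreal (u_abs k))" .
  have "0 \<le> u_abs k" for k by (simp add: u_abs_def)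
  then have "(\<integral>\<^sup>+\<xi>. (\<Sum>k. ennreal (abs_share k \<xi>)) \<partial>\<mu>) \<noteq> \<infinity>"
    unfolding eq infinity_ennreal_def by (rule ennreal_suminf_neq_top[OF u_abs_summable])
  then have "AE \<xi> in \<mu>. (\<Sum>k. ennreal (abs_share k \<xi>)) \<noteq> \<infinity>"
    by (intro nn_integral_PInf_AE) auto
  then show ?thesis
    by eventually_elim (use nn in \<open>auto intro: summable_suminf_not_top\<close>)
qed

lemma energy_eq: "energy U \<mu> = (\<Sum>k. u k)"
proof -
  let ?G = "\<lambda>k \<xi>. \<Sum>l\<le>k. share k l \<xi>"
  have Gi: "integrable \<mu> (?G k)" for k
    using share_integrable by (rule Bochner_Integration.integrable_sum)
  have Gn: "norm (?G k \<xi>) \<le> abs_share k \<xi>" for k \<xi>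
    unfolding abs_share_def real_norm_def by (rule sum_abs)
  have [measurable]: "?G k \<in> borel_measurable \<mu>" "abs_share k \<in> borel_measurable \<mu>" for k
    using Gi abs_share_integrable by (auto intro: borel_measurable_integrable)
  have nn: "abs_share k \<xi> \<ge> 0" for k \<xi> by (simp add: abs_share_def sum_nonneg)
  have iff: "summable (\<lambda>k. abs_share k \<xi>) \<longleftrightarrow> (\<Sum>k. ennreal (abs_share k \<xi>)) \<noteq> \<infinity>" for \<xi>
  proof
    show "(\<Sum>k. ennreal (abs_share k \<xi>)) \<noteq> \<infinity>" if "summable (\<lambda>k. abs_share k \<xi>)"
      unfolding infinity_ennreal_def by (rule ennreal_suminf_neq_top[OF that nn])
    show "summable (\<lambda>k. abs_share k \<xi>)" if "(\<Sum>k. ennreal (abs_share k \<xi>)) \<noteq> \<infinity>"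
      using that unfolding infinity_ennreal_def by (rule summable_suminf_not_top[OF nn])
  qed
  have "energy U \<mu> = (\<integral>\<xi>. (if (\<Sum>k. ennreal (abs_share k \<xi>)) \<noteq> \<infinity> then (\<Sum>k. ?G k \<xi>) else 0) \<partial>\<mu>)"
    unfolding energy_def f_pot_eq iff ..
  also have "\<dots> = (\<integral>\<xi>. (\<Sum>k. ?G k \<xi>) \<partial>\<mu>)"
  proof (rule integral_cong_AE)
    show "AE \<xi> in \<mu>. (if (\<Sum>k. ennreal (abs_share k \<xi>)) \<noteq> \<infinity> then (\<Sum>k. ?G k \<xi>) else 0) = (\<Sum>k. ?G k \<xi>)"
      using AE_summable by eventually_elim (use iff in auto)
  qed measurable
  also have "\<dots> = (\<Sum>k. \<integral>\<xi>. ?G k \<xi> \<partial>\<mu>)"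
  proof (rule integral_suminf[OF Gi])
    show "AE \<xi> in \<mu>. summable (\<lambda>k. norm (?G k \<xi>))"
      using AE_summable
      by eventually_elim (rule summable_comparison_test, use Gn in auto)
    show "summable (\<lambda>k. \<integral>\<xi>. norm (?G k \<xi>) \<partial>\<mu>)"
    proof (rule summable_comparison_test[OF _ u_abs_summable], intro exI[of _ 0] allI impI)
      fix k
      have "(\<integral>\<xi>. norm (?G k \<xi>) \<partial>\<mu>) \<le> (\<integral>\<xi>. abs_share k \<xi> \<partial>\<mu>)"
        using Gi abs_share_integrable Gn by (intro integral_mono integrable_norm)
      then show "norm (\<integral>\<xi>. norm (?G k \<xi>) \<partial>\<mu>) \<le> u_abs k"
        by (simp add: integral_abs_share)
    qed
  qed
  finally show ?thesis by (simp add: integral_share)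
qed

text \<open>The number of segments of \<open>k\<close> steps in \<open>V\<close> is asymptotically \<open>card V\<close>, so each term of the
  series for the mean of the Hamiltonian converges to that of the energy, and the sums of
  \<open>u_abs\<close> dominate.\<close>
theorem energy_density_limit:
  "((\<lambda>V. (1 / real (card V)) * (\<integral>\<xi>. H_free U V \<xi> \<partial>\<mu>)) \<longlongrightarrow> energy U \<mu>) thermodynamic"
proof -
  let ?a = "\<lambda>k V. real (card (placements V k)) / real (card V) * u k"
  have le1: "real (card (placements V k)) / real (card V) \<le> 1" for V k
  proof (cases "finite V")
    case True
    then have "card (placements V k) \<le> card V" using placements_subset by (intro card_mono)
    then show ?thesis by (cases "card V = 0") (auto simp: divide_le_eq)
  qed simp
  have "((\<lambda>V. \<Sum>k. ?a k V) \<longlongrightarrow> (\<Sum>k. u k)) thermodynamic"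
  proof (rule conjunct2[OF conjunct2[OF tannerys_theorem]])
    show "((\<lambda>V. ?a k V) \<longlongrightarrow> u k) thermodynamic" for k
      using tendsto_mult_right[OF placements_density[of k], of "u k"] by simp
    have "norm (?a k V) \<le> u_abs k" for k V
    proof -
      have "norm (?a k V) = real (card (placements V k)) / real (card V) * \<bar>u k\<bar>" by (simp add: abs_mult)
      also have "\<dots> \<le> 1 * u_abs k" using le1 abs_u_le by (intro mult_mono) auto
      finally show ?thesis by simp
    qed
    then show "\<forall>\<^sub>F (k, V) in at_top \<times>\<^sub>F thermodynamic. norm (?a k V) \<le> u_abs k"
      by (intro always_eventually) auto
  qed (fact u_abs_summable thermodynamic_neq_bot)+
  moreover have "\<forall>\<^sub>F V in thermodynamic. (\<Sum>k. ?a k V) = (1 / real (card V)) * (\<integral>\<xi>. H_free U V \<xi> \<partial>\<mu>)"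
    unfolding eventually_thermodynamic
  proof (intro exI[of _ "{}"] exI[of _ 1] conjI allI impI; (elim conjE)?)
    fix V :: "int set" assume V: "finite V"
    have "summable (\<lambda>k. real (card (placements V k)) * u k)"
    proof (rule summable_finite)
      show "finite {..<card V}" by simp
      fix k assume k: "k \<notin> {..<card V}"
      have "placements V k = {}"
      proof (rule ccontr)
        assume "placements V k \<noteq> {}"
        then obtain j where "{j..j + int k} \<subseteq> V" by (auto simp: placements_def)
        then have "card {j..j + int k} \<le> card V" using V by (intro card_mono)
        with k show False by simp
      qed
      then show "real (card (placements V k)) * u k = 0" by simp
    qed
    then have "(\<Sum>k. (1 / real (card V)) * (real (card (placements V k)) * u k)) =
       (1 / real (card V)) * (\<Sum>k. real (card (placements V k)) * u k)" by (rule suminf_mult)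
    then show "(\<Sum>k. ?a k V) = (1 / real (card V)) * (\<integral>\<xi>. H_free U V \<xi> \<partial>\<mu>)"
      by (simp add: integral_H_free[OF V])
  qed auto
  ultimately show ?thesis unfolding energy_eq by (rule Lim_transform_eventually)
qed

end

theorem proposition6p1:
  "\<exists>\<beta>\<^sub>0::real. \<forall>\<beta>\<ge>\<beta>\<^sub>0. \<forall>\<mu>\<in>M_class.
     ((\<lambda>V. (1 / real (card V)) * (\<integral>\<sigma>. H_free (telescoping \<beta>) V \<sigma> \<partial>\<mu>))
        \<longlongrightarrow> energy (telescoping \<beta>) \<mu>) thermodynamic"
proof (intro exI[of _ "9 / 2 * ln 2048"] allI impI ballI)
  fix \<beta> :: real and \<mu> :: "(int \<Rightarrow> real) measure"
  assume \<beta>: "\<beta> \<ge> 9 / 2 * ln 2048" and \<mu>: "\<mu> \<in> M_class"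
  from \<mu> obtain \<alpha> where \<alpha>: "\<alpha> \<in> {1<..<9/8}" and \<mu>\<alpha>: "\<mu> \<in> M_alpha \<alpha>"
    unfolding M_class_def by (rule UN_E)
  note M = \<mu>\<alpha>[unfolded M_alpha_def mem_Collect_eq]
  from M obtain c where c: "c > 0"
    and tails: "\<forall>n\<ge>1. \<P>(\<sigma> in \<mu>. l_plus \<alpha> 0 \<sigma> > enat n) \<le> exp (- c * real n) \<and>
        \<P>(\<sigma> in \<mu>. l_minus \<alpha> 0 \<sigma> > enat n) \<le> exp (- c * real n)"
    by (elim conjE exE)
  interpret low_temperature \<beta> by (rule low_temperature_above[OF \<beta>])
  interpret layer_measure \<beta> \<mu> \<alpha> c
  proof (rule layer_measure.intro[OF _ layer_measure_axioms.intro])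
    show "low_temperature \<beta>" by (rule low_temperature_above[OF \<beta>])
    show "prob_space \<mu>" using M by (elim conjE)
    show "sets \<mu> = sets Omega" using M by (elim conjE)
    show "distr \<mu> Omega (\<lambda>\<sigma> i. \<sigma> (i + a)) = \<mu>" for a :: int
      using M by (elim conjE allE)
    show "1 \<le> \<alpha>" using \<alpha> by simp
    show "0 < c" by (rule c)
    show "\<P>(\<sigma> in \<mu>. l_plus \<alpha> 0 \<sigma> > enat n) \<le> exp (- c * real n)" if "1 \<le> n" for n
      by (rule conjunct1[OF tails[rule_format, OF that]])
  qed
  show "((\<lambda>V. (1 / real (card V)) * (\<integral>\<sigma>. H_free (telescoping \<beta>) V \<sigma> \<partial>\<mu>)) \<longlongrightarrow> energy (telescoping \<beta>) \<mu>) thermodynamic"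
    by (rule energy_density_limit)
qed

end
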